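(* Let $X$ be a real algebraic variety and let $W \subset X(\mathbb{R})$ be a semialgebraic subset. For a function $f \colon W \to \mathbb{R}$, the following conditions are equivalent: (a) $f$ is hereditarily rational; (b) $f$ is rational on algebraic curves and semialgebraic.
   Context: A real algebraic variety is a quasi-projective variety $X$ defined over $\mathbb{R}$, reduced but possibly reducible; subvarieties are closed subvarieties defined over $\mathbb{R}$; $X(\mathbb{R})$ carries the Euclidean topology and may be viewed as a real algebraic subset of some $\mathbb{R}^n$. For $V\subset X(\mathbb{R})$ and $g\colon V\to\mathbb{R}$, with $Y$ the Zariski closure of $V$ in $X$, $g$ is rational if there exist a Zariski open dense $Y^0\subset Y$ and a regular function $F$ on $Y^0$ with $g|_{V\cap Y^0}=F|_{V\cap Y^0}$. $f$ is hereditarily rational if $f|_{W\cap Z}$ is rational for every real subvariety $Z\subset X$; $f$ is rational on algebraic curves if $f|_{W\cap C}$ is rational for every irreducible real algebraic curve $C\subset X$. *)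

theory Defs
  imports Main "HOL.Real"
begin

text \<open>Points of R^n are real lists of length n.  Polynomial functions on R^n
  (over the infinite field R, polynomials and polynomial functions coincide).\<close>

inductive poly_fun :: "nat \<Rightarrow> (real list \<Rightarrow> real) \<Rightarrow> bool" for n :: nat where
  pf_const: "poly_fun n (\<lambda>x. c)"
| pf_var: "i < n \<Longrightarrow> poly_fun n (\<lambda>x. x ! i)"
| pf_add: "poly_fun n p \<Longrightarrow> poly_fun n q \<Longrightarrow> poly_fun n (\<lambda>x. p x + q x)"
| pf_mult: "poly_fun n p \<Longrightarrow> poly_fun n q \<Longrightarrow> poly_fun n (\<lambda>x. p x * q x)"

definition Rn :: "nat \<Rightarrow> real list set" where
  "Rn n = {x. length x = n}"

definition alg_set :: "nat \<Rightarrow> real list set \<Rightarrow> bool" where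
  "alg_set n T \<longleftrightarrow> (\<exists>P. finite P \<and> (\<forall>p\<in>P. poly_fun n p) \<and>
      T = {x \<in> Rn n. \<forall>p\<in>P. p x = 0})"

definition zar_closure :: "nat \<Rightarrow> real list set \<Rightarrow> real list set" where
  "zar_closure n V = \<Inter>{T. alg_set n T \<and> V \<subseteq> T}"

inductive semialg :: "nat \<Rightarrow> real list set \<Rightarrow> bool" for n :: nat where
  sa_eq: "poly_fun n p \<Longrightarrow> semialg n {x \<in> Rn n. p x = 0}"
| sa_pos: "poly_fun n p \<Longrightarrow> semialg n {x \<in> Rn n. p x > 0}"
| sa_union: "semialg n A \<Longrightarrow> semialg n B \<Longrightarrow> semialg n (A \<union> B)"
| sa_inter: "semialg n A \<Longrightarrow> semialg n B \<Longrightarrow> semialg n (A \<inter> B)"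
| sa_compl: "semialg n A \<Longrightarrow> semialg n (Rn n - A)"

definition semialg_fun :: "nat \<Rightarrow> real list set \<Rightarrow> (real list \<Rightarrow> real) \<Rightarrow> bool" where
  "semialg_fun n W f \<longleftrightarrow> semialg (Suc n) {x @ [f x] | x. x \<in> W}"

text \<open>Rationality of g on V \<subseteq> R^n: g agrees with a quotient p/q of polynomials
  on V minus the zero set of q, where q does not vanish identically on any
  irreducible component of the Zariski closure Y of V (equivalently the set
  of points of V where q is nonzero is Zariski dense in Y); this is the real-point
  rendering of "regular function on a Zariski open dense Y^0 of Y".\<close>
definition rational_on :: "nat \<Rightarrow> real list set \<Rightarrow> (real list \<Rightarrow> real) \<Rightarrow> bool" where
  "rational_on n V g \<longleftrightarrow> (\<exists>p q. poly_fun n p \<and> poly_fun n q \<and>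
      zar_closure n {x \<in> V. q x \<noteq> 0} = zar_closure n V \<and>
      (\<forall>x\<in>V. q x \<noteq> 0 \<longrightarrow> g x = p x / q x))"

definition alg_irreducible :: "nat \<Rightarrow> real list set \<Rightarrow> bool" where
  "alg_irreducible n C \<longleftrightarrow> alg_set n C \<and> C \<noteq> {} \<and>
     (\<forall>A B. alg_set n A \<and> alg_set n B \<and> C = A \<union> B \<longrightarrow> C = A \<or> C = B)"

text \<open>Irreducible real algebraic curves (real loci): irreducible algebraic sets of
  dimension 1, i.e. infinite with all proper algebraic subsets finite.\<close>
definition alg_curve :: "nat \<Rightarrow> real list set \<Rightarrow> bool" where
  "alg_curve n C \<longleftrightarrow> alg_irreducible n C \<and> infinite C \<and>
     (\<forall>T. alg_set n T \<and> T \<subset> C \<longrightarrow> finite T)"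

definition hereditarily_rational ::
  "nat \<Rightarrow> real list set \<Rightarrow> real list set \<Rightarrow> (real list \<Rightarrow> real) \<Rightarrow> bool" where
  "hereditarily_rational n X W f \<longleftrightarrow>
     (\<forall>Z. alg_set n Z \<and> Z \<subseteq> X \<longrightarrow> rational_on n (W \<inter> Z) f)"

definition rational_on_curves ::
  "nat \<Rightarrow> real list set \<Rightarrow> real list set \<Rightarrow> (real list \<Rightarrow> real) \<Rightarrow> bool" where
  "rational_on_curves n X W f \<longleftrightarrow>
     (\<forall>C. alg_curve n C \<and> C \<subseteq> X \<longrightarrow> rational_on n (W \<inter> C) f)"

end

theory Submission
  imports Defs "HOL-Computational_Algebra.Polynomial" "HOL-Analysis.Continuum_Not_Denumerable"
    "HOL-Library.Landau_Symbols"
begin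

text \<open>A hereditarily rational function has a semialgebraic graph by Noetherian induction on the
  subvariety.  Conversely, Noetherian induction reduces the claim to \<open>V = W \<inter> Z\<close> with
  irreducible Zariski closure.  The graph of \<open>f\<close> over \<open>V\<close> is semialgebraic, so the value of
  \<open>f\<close> is algebraic over the coordinates, and near a generic point the graph is parametrised by
  \<open>d\<close> independent coordinates, with Taylor expansions of all orders.  Consider the pencil of lines
  through that point in these \<open>d\<close> coordinates.  The line with direction \<open>c\<close> lifts to an
  algebraic curve, on which \<open>f * q = p\<close> for some polynomials \<open>p\<close> and \<open>q\<close>.  Their
  degrees are bounded on a Zariski dense set of directions, because there are only countably many bounds.
  The Taylor coefficients along the line are polynomials in \<open>c\<close>, so \<open>p\<close> and \<open>q\<close>
  may be taken polynomial in \<open>c\<close>, and \<open>c\<close> itself is a polynomial in the point.  This yields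
  \<open>f * Q = P\<close> on one component of the graph; a second use of the pencil shows that no other
  component has a dense projection.  No Bertini theorem is needed, since passing to a base point
  replaces multisections of the pencil by Taylor coefficients.\<close>

section \<open>Polynomial functions\<close>

text \<open>On a single lifted line the relation \<open>f * q = p\<close> is linear in the
  coefficients of \<open>p\<close> and \<open>q\<close>, with one equation for each Taylor
  coefficient at the base point. The obstacle is that a nonzero solution is worthless if
  \<open>q\<close> vanishes identically, so each use of the pencil carries a side condition, tested
  at a point over the end \<open>b + c\<close> of the vector \<open>c\<close>. This is why the dense
  sets consist of vectors and not of directions: a bad end is repaired by rescaling
  \<open>c\<close>, since \<open>q\<close> has finitely many zeros on the curve. The lifted arc need
  not have an irreducible closure, so only the parameters of one component are kept. They accumulate
  at 0, which forces Taylor coefficients to vanish, and they are uncountable, which survives a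
  countable union over degree bounds. Conversely, flatness at the base point becomes an identity on
  the whole piece: a function that is not zero on an irreducible piece divides a nonzero polynomial
  in the \<open>d\<close> independent coordinates, and a polynomial flat at one point of a line
  vanishes on that line.\<close>

lemma Rn_iff [simp]: "x \<in> Rn n \<longleftrightarrow> length x = n"
  by (simp add: Rn_def)

lemma poly_fun_sum:
  assumes "\<And>i. i \<in> I \<Longrightarrow> poly_fun n (p i)"
  shows "poly_fun n (\<lambda>x. \<Sum>i\<in>I. p i x)"
  using assms by (induction I rule: infinite_finite_induct) (auto intro: poly_fun.intros)

lemma poly_fun_prod:
  assumes "\<And>i. i \<in> I \<Longrightarrow> poly_fun n (p i)"
  shows "poly_fun n (\<lambda>x. \<Prod>i\<in>I. p i x)"
  using assms by (induction I rule: infinite_finite_induct) (auto intro: poly_fun.intros)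

lemma poly_fun_power: "poly_fun n p \<Longrightarrow> poly_fun n (\<lambda>x. p x ^ k)"
  by (induction k) (auto intro: poly_fun.intros)

lemma poly_fun_uminus: "poly_fun n p \<Longrightarrow> poly_fun n (\<lambda>x. - p x)"
  using pf_mult[OF pf_const[of n "-1"], of p] by simp

lemma poly_fun_diff: "poly_fun n p \<Longrightarrow> poly_fun n q \<Longrightarrow> poly_fun n (\<lambda>x. p x - q x)"
  using pf_add[OF _ poly_fun_uminus, of n p q] by simp

lemmas poly_fun_intros =
  pf_const pf_var pf_add pf_mult poly_fun_sum poly_fun_prod poly_fun_power poly_fun_uminus poly_fun_diff

lemma poly_fun_comp:
  assumes "poly_fun m p" "\<And>i. i < m \<Longrightarrow> poly_fun n (h i)"
    and "\<And>x i. i < m \<Longrightarrow> u x ! i = h i x"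
  shows "poly_fun n (\<lambda>x. p (u x))"
  using assms(1) by induction (auto intro: poly_fun_intros simp: assms)

text \<open>A coordinate projection given by a list of indices: one \<open>L\<close> with indices
  below \<open>n\<close> projects a point \<open>x\<close> of R^n and the graph point
  \<open>x @ [f x]\<close> to the same place.\<close>

definition sel :: "nat list \<Rightarrow> real list \<Rightarrow> real list" where
  "sel L x = map ((!) x) L"

lemma length_sel [simp]: "length (sel L x) = length L"
  by (simp add: sel_def)

lemma poly_fun_sel:
  assumes "poly_fun (length L) p" "set L \<subseteq> {..<n}"
  shows "poly_fun n (\<lambda>x. p (sel L x))"
  by (rule poly_fun_comp[OF assms(1), of n "\<lambda>i x. x ! (L ! i)"])
     (use assms(2) nth_mem in \<open>auto intro!: pf_var simp: sel_def\<close>)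

lemma poly_fun_take:
  assumes "poly_fun m p" "m \<le> n"
  shows "poly_fun n (\<lambda>x. p (take m x))"
  by (rule poly_fun_comp[OF assms(1), of n "\<lambda>i x. x ! i"]) (use assms(2) in \<open>auto intro!: pf_var\<close>)

text \<open>Equality is restricted to \<open>Rn n\<close> because the place where \<open>v\<close>
  begins in \<open>x @ v\<close> depends on the length of \<open>x\<close>.\<close>

lemma poly_fun_append:
  assumes "poly_fun (n + m) p" "length v = m"
  shows "\<exists>q. poly_fun n q \<and> (\<forall>x\<in>Rn n. q x = p (x @ v))"
  using assms(1)
proof induction
  case (pf_var i)
  show ?case
  proof (cases "i < n")
    case True
    then show ?thesis
      by (intro exI[of _ "\<lambda>x. x ! i"]) (auto intro: poly_fun_intros simp: nth_append)
  next
    case False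
    then show ?thesis
      by (intro exI[of _ "\<lambda>x. v ! (i - n)"]) (auto intro: poly_fun_intros simp: nth_append)
  qed
next
  case (pf_add p q)
  then obtain p' q' where "poly_fun n p'" "poly_fun n q'" "\<forall>x\<in>Rn n. p' x = p (x @ v)" "\<forall>x\<in>Rn n. q' x = q (x @ v)" by blast
  then show ?case by (intro exI[of _ "\<lambda>x. p' x + q' x"]) (auto intro: poly_fun_intros)
next
  case (pf_mult p q)
  then obtain p' q' where "poly_fun n p'" "poly_fun n q'" "\<forall>x\<in>Rn n. p' x = p (x @ v)" "\<forall>x\<in>Rn n. q' x = q (x @ v)" by blast
  then show ?case by (intro exI[of _ "\<lambda>x. p' x * q' x"]) (auto intro: poly_fun_intros)
qed (auto intro: poly_fun_intros)

text \<open>The identification R[x,y] = R[x][y]. Coefficients from \<open>m\<close> on are zero, so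
  that sums of different lengths can be padded to a common one and multiplied by
  convolution.\<close>

lemma poly_fun_Suc_expand:
  assumes "poly_fun (Suc n) p"
  obtains m a where "\<And>i. poly_fun n (a i)" "\<And>i x. i \<ge> m \<Longrightarrow> a i x = 0"
    "\<And>x y. length x = n \<Longrightarrow> p (x @ [y]) = (\<Sum>i<m. a i x * y ^ i)"
proof -
  have "\<exists>m a. (\<forall>i. poly_fun n (a i)) \<and> (\<forall>i\<ge>m. \<forall>x. a i x = 0) \<and>
     (\<forall>x y. length x = n \<longrightarrow> p (x @ [y]) = (\<Sum>i<m. a i x * y ^ i))"
    using assms
  proof induction
    case (pf_const c)
    show ?case
      by (intro exI[of _ 1] exI[of _ "\<lambda>i x. if i = 0 then c else 0"]) (auto intro: poly_fun_intros)
  next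
    case (pf_var j)
    show ?case
    proof (cases "j < n")
      case True
      have "poly_fun n (\<lambda>x. if i = 0 then x ! j else 0)" for i :: nat
        using True by (cases "i = 0") (auto intro: poly_fun_intros)
      then show ?thesis using True
        by (intro exI[of _ 1] exI[of _ "\<lambda>i x. if i = 0 then x ! j else 0"]) (auto simp: nth_append)
    next
      case False
      then have "j = n" using pf_var by simp
      then show ?thesis
        by (intro exI[of _ 2] exI[of _ "\<lambda>i x. if i = 1 then 1 else 0"])
           (auto intro: poly_fun_intros simp: nth_append numeral_2_eq_2)
    qed
  next
    case (pf_add p q)
    obtain m a where 1: "\<And>i. poly_fun n (a i)" "\<And>i x. i \<ge> m \<Longrightarrow> a i x = 0"
      "\<And>x y. length x = n \<Longrightarrow> p (x @ [y]) = (\<Sum>i<m. a i x * y ^ i)"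
      using pf_add.IH(1) by blast
    obtain m' a' where 2: "\<And>i. poly_fun n (a' i)" "\<And>i x. i \<ge> m' \<Longrightarrow> a' i x = 0"
      "\<And>x y. length x = n \<Longrightarrow> q (x @ [y]) = (\<Sum>i<m'. a' i x * y ^ i)"
      using pf_add.IH(2) by blast
    note * = 1 2
    have 1: "(\<Sum>i<m. a i x * y ^ i) = (\<Sum>i<max m m'. a i x * y ^ i)" for x y
      by (rule sum.mono_neutral_left) (auto simp: *)
    have 2: "(\<Sum>i<m'. a' i x * y ^ i) = (\<Sum>i<max m m'. a' i x * y ^ i)" for x y
      by (rule sum.mono_neutral_left) (auto simp: *)
    show ?case
      by (intro exI[of _ "max m m'"] exI[of _ "\<lambda>i x. a i x + a' i x"])
         (auto intro!: poly_fun_intros simp: * 1 2 sum.distrib ring_distribs)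
  next
    case (pf_mult p q)
    obtain m a where 1: "\<And>i. poly_fun n (a i)" "\<And>i x. i \<ge> m \<Longrightarrow> a i x = 0"
      "\<And>x y. length x = n \<Longrightarrow> p (x @ [y]) = (\<Sum>i<m. a i x * y ^ i)"
      using pf_mult.IH(1) by blast
    obtain m' a' where 2: "\<And>i. poly_fun n (a' i)" "\<And>i x. i \<ge> m' \<Longrightarrow> a' i x = 0"
      "\<And>x y. length x = n \<Longrightarrow> q (x @ [y]) = (\<Sum>i<m'. a' i x * y ^ i)"
      using pf_mult.IH(2) by blast
    note * = 1 2
    define b where "b k x = (\<Sum>i\<le>k. a i x * a' (k - i) x)" for k x
    have z: "a i x * a' (k - i) x = 0" if "k \<ge> m + m'" "i \<le> k" for i k x
      using *(2)[of i x] *(5)[of "k - i" x] that by (cases "i \<ge> m") auto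
    have "(\<Sum>i<m. a i x * y ^ i) * (\<Sum>i<m'. a' i x * y ^ i) = (\<Sum>k<m+m'. b k x * y ^ k)" for x y
    proof -
      have "(\<Sum>i<m. a i x * y ^ i) * (\<Sum>i<m'. a' i x * y ^ i)
          = (\<Sum>(i,j)\<in>{..<m}\<times>{..<m'}. (a i x * a' j x) * y ^ (i + j))"
        by (auto simp: sum_product sum.cartesian_product power_add intro!: sum.cong)
      also have "\<dots> = (\<Sum>(i,j)\<in>{(i,j). i + j < m + m'}. (a i x * a' j x) * y ^ (i + j))"
      proof (rule sum.mono_neutral_left)
        have "{(i,j). i + j < m + m'} \<subseteq> {..<m+m'}\<times>{..<m+m'}" by auto
        then show "finite {(i,j). i + j < m + m'}" by (rule finite_subset) simp
        show "\<forall>i\<in>{(i, j). i + j < m + m'} - {..<m} \<times> {..<m'}. (case i of (i, j) \<Rightarrow> a i x * a' j x * y ^ (i + j)) = 0"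
        proof
          fix k assume k: "k \<in> {(i, j). i + j < m + m'} - {..<m} \<times> {..<m'}"
          obtain i j where "k = (i, j)" by (cases k)
          then have "i \<ge> m \<or> j \<ge> m'" using k by auto
          then show "(case k of (i, j) \<Rightarrow> a i x * a' j x * y ^ (i + j)) = 0"
            using * \<open>k = (i, j)\<close> by auto
        qed
      qed auto
      also have "\<dots> = (\<Sum>k<m+m'. \<Sum>i\<le>k. (a i x * a' (k - i) x) * y ^ (i + (k - i)))"
        by (rule sum.triangle_reindex[of "\<lambda>i j. a i x * a' j x * y ^ (i + j)"])
      also have "\<dots> = (\<Sum>k<m+m'. b k x * y ^ k)"
        by (auto simp: b_def sum_distrib_right intro!: sum.cong)
      finally show ?thesis .
    qed
    then show ?case
      by (intro exI[of _ "m + m'"] exI[of _ b]) (auto intro!: poly_fun_intros simp: * b_def z)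
  qed
  then show thesis using that by blast
qed

lemma length_SucE:
  assumes "length z = Suc n" obtains x y where "z = x @ [y]" "length x = n"
  using assms by (metis length_append_singleton nat.inject rev_exhaust list.size(3) nat.distinct(1))

lemma poly_fun_last_poly:
  assumes "poly_fun (Suc n) p" "length x = n"
  obtains r where "\<And>t. p (x @ [t]) = poly r t"
proof -
  obtain m a where a: "p (x @ [t]) = (\<Sum>i<m. a i x * t ^ i)" for t
    using poly_fun_Suc_expand[OF assms(1)] assms(2) by metis
  have "p (x @ [t]) = poly (\<Sum>i<m. monom (a i x) i) t" for t
    by (simp add: a poly_sum poly_monom)
  then show thesis using that by blast
qed

lemma finite_zeros_last:
  assumes "poly_fun (Suc n) p" "length x = n" "p (x @ [t0]) \<noteq> 0"
  shows "finite {t. p (x @ [t]) = 0}"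
proof -
  obtain r where r: "\<And>t. p (x @ [t]) = poly r t" using poly_fun_last_poly assms by blast
  then show ?thesis using poly_roots_finite[of r] assms(3) by (cases "r = 0") auto
qed

lemma uncountable_box:
  fixes c :: real assumes "\<epsilon> > 0"
  shows "uncountable {y. \<bar>y - c\<bar> < \<epsilon>}"
proof -
  have "{y. \<bar>y - c\<bar> < \<epsilon>} = {c-\<epsilon><..<c+\<epsilon>}" by (auto simp: abs_less_iff)
  then show ?thesis using assms uncountable_open_interval by simp
qed

text \<open>A Baire-type argument by induction on the dimension: choose \<open>w\<close> off the
  zeros of one nontrivial coefficient of each \<open>g k\<close>; then each
  \<open>g k (w @ [t])\<close> has finitely many zeros \<open>t\<close>, and countably many finite
  sets do not fill an interval.\<close>

lemma avoid_countable:
  fixes g :: "nat \<Rightarrow> real list \<Rightarrow> real"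
  assumes "\<And>k. poly_fun d (g k)" "\<And>k. \<exists>w\<in>Rn d. g k w \<noteq> 0" "length c = d" "\<epsilon> > 0"
  shows "\<exists>w\<in>Rn d. (\<forall>i<d. \<bar>w ! i - c ! i\<bar> < \<epsilon>) \<and> (\<forall>k. g k w \<noteq> 0)"
  using assms(1-3)
proof (induction d arbitrary: g c)
  case 0
  then have "g k [] \<noteq> 0" for k using 0(2)[of k] by (auto simp: Rn_def)
  then show ?case by (intro bexI[of _ "[]"]) auto
next
  case (Suc d)
  obtain c' c0 where c: "c = c' @ [c0]" "length c' = d" using Suc.prems(3) by (rule length_SucE)
  have "\<exists>a. poly_fun d a \<and> (\<exists>w\<in>Rn d. a w \<noteq> 0) \<and> (\<forall>w\<in>Rn d. a w \<noteq> 0 \<longrightarrow> (\<exists>t. g k (w @ [t]) \<noteq> 0))" for k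
  proof -
    obtain m b where b: "\<And>i. poly_fun d (b i)" "\<And>i x. i \<ge> m \<Longrightarrow> b i x = 0"
      "\<And>x y. length x = d \<Longrightarrow> g k (x @ [y]) = (\<Sum>i<m. b i x * y ^ i)"
      using poly_fun_Suc_expand[OF Suc.prems(1)[of k]] by metis
    obtain w t where wt: "length w = d" "g k (w @ [t]) \<noteq> 0"
      using Suc.prems(2)[of k] by (metis Rn_iff length_SucE)
    then obtain i where i: "i < m" "b i w \<noteq> 0" using b(3)[of w t]
      by (metis (no_types, lifting) lessThan_iff mult_eq_0_iff sum.neutral)
    have "\<exists>t. g k (w @ [t]) \<noteq> 0" if "length w = d" "b i w \<noteq> 0" for w
    proof -
      have "coeff (\<Sum>i<m. monom (b i w) i) i \<noteq> 0" using that i by (simp add: coeff_sum sum.delta' if_distrib)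
      then have "(\<Sum>i<m. monom (b i w) i) \<noteq> 0" by auto
      then obtain t where "poly (\<Sum>i<m. monom (b i w) i) t \<noteq> 0" using poly_all_0_iff_0 by blast
      then have "g k (w @ [t]) \<noteq> 0" by (simp add: b(3)[OF that(1)] poly_sum poly_monom)
      then show ?thesis by blast
    qed
    then show ?thesis using b(1)[of i] wt(1) i(2) by (intro exI[of _ "b i"]) auto
  qed
  then obtain a where a: "\<And>k. poly_fun d (a k)" "\<And>k. \<exists>w\<in>Rn d. a k w \<noteq> 0"
    "\<And>k w. length w = d \<Longrightarrow> a k w \<noteq> 0 \<Longrightarrow> \<exists>t. g k (w @ [t]) \<noteq> 0" by (metis Rn_iff)
  obtain w where w: "length w = d" "\<forall>i<d. \<bar>w ! i - c' ! i\<bar> < \<epsilon>" "\<And>k. a k w \<noteq> 0"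
    using Suc.IH[of a c', OF a(1) a(2) c(2)] by auto
  have "finite {t. g k (w @ [t]) = 0}" for k
    using finite_zeros_last[OF Suc.prems(1) w(1)] a(3)[OF w(1) w(3)] by blast
  then have "countable (\<Union>k. {t. g k (w @ [t]) = 0})"
    by (intro countable_UN) (auto intro!: countable_finite)
  then obtain t where "\<bar>t - c0\<bar> < \<epsilon>" "t \<notin> (\<Union>k. {t. g k (w @ [t]) = 0})"
    using uncountable_box[OF \<open>\<epsilon> > 0\<close>, of c0] by (metis (no_types, lifting) countable_subset mem_Collect_eq subsetI)
  then show ?case using w c by (intro bexI[of _ "w @ [t]"]) (auto simp: nth_append less_Suc_eq)
qed

text \<open>Polynomials over an infinite field form a domain. The finite family is enumerated with
  repetitions to fit the countable case.\<close>

lemma poly_fun_domain: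
  assumes "finite I" "\<And>i. i \<in> I \<Longrightarrow> poly_fun d (g i)" "\<And>i. i \<in> I \<Longrightarrow> \<exists>w\<in>Rn d. g i w \<noteq> 0"
  shows "\<exists>w\<in>Rn d. \<forall>i\<in>I. g i w \<noteq> 0"
proof (cases "I = {}")
  case True
  then show ?thesis by (auto intro: exI[of _ "replicate d 0"])
next
  case False
  then have r: "range (from_nat_into I) = I" using assms(1) by (simp add: countable_finite)
  have "from_nat_into I k \<in> I" for k using False by (rule from_nat_into)
  then have "\<exists>w\<in>Rn d. (\<forall>i<d. \<bar>w ! i - replicate d 0 ! i\<bar> < 1) \<and> (\<forall>k. g (from_nat_into I k) w \<noteq> 0)"
    by (intro avoid_countable assms) auto
  then show ?thesis by (metis r rangeE)
qed

lemma poly_fun_mult_nonzero: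
  assumes "poly_fun d a" "poly_fun d b" "\<exists>w\<in>Rn d. a w \<noteq> 0" "\<exists>w\<in>Rn d. b w \<noteq> 0"
  shows "\<exists>w\<in>Rn d. a w * b w \<noteq> 0"
proof -
  have "\<exists>w\<in>Rn d. \<forall>i\<in>{False,True}. (if i then a else b) w \<noteq> 0"
    by (rule poly_fun_domain) (use assms in auto)
  then show ?thesis by auto
qed

section \<open>Zariski topology\<close>

lemma poly_fun_if: "poly_fun n p \<Longrightarrow> poly_fun n q \<Longrightarrow> poly_fun n (\<lambda>x. if b then p x else q x)"
  by (cases b) simp_all

text \<open>Membership of \<open>g\<close> in the ideal generated by
  \<open>a 0, ..., a (m - 1)\<close>, tested on \<open>Rn n\<close> since lists of other lengths are
  not points.\<close>

definition ideal_comb :: "nat \<Rightarrow> nat \<Rightarrow> (nat \<Rightarrow> real list \<Rightarrow> real) \<Rightarrow> (real list \<Rightarrow> real) \<Rightarrow> bool" where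
  "ideal_comb n m a g \<longleftrightarrow>
     (\<exists>r. (\<forall>i<m. poly_fun n (r i)) \<and> (\<forall>x\<in>Rn n. g x = (\<Sum>i<m. r i x * a i x)))"

lemma ideal_comb_zero: "ideal_comb n m a (\<lambda>x. 0)"
  unfolding ideal_comb_def by (rule exI[of _ "\<lambda>i x. 0"]) (auto intro: poly_fun_intros)

lemma ideal_comb_gen: "i < m \<Longrightarrow> ideal_comb n m a (a i)"
proof -
  assume i: "i < m"
  have "(\<Sum>j<m. (if j = i then 1 else 0) * a j x) = (\<Sum>j<m. if j = i then a j x else 0)" for x
    by (rule sum.cong) auto
  then show ?thesis
    unfolding ideal_comb_def using i
    by (intro exI[of _ "\<lambda>j x. if j = i then 1 else 0"]) (auto intro: poly_fun_intros)
qed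

lemma ideal_comb_add: "ideal_comb n m a g \<Longrightarrow> ideal_comb n m a h \<Longrightarrow> ideal_comb n m a (\<lambda>x. g x + h x)"
proof -
  assume gh: "ideal_comb n m a g" "ideal_comb n m a h"
  obtain r where "\<forall>i<m. poly_fun n (r i)" "\<forall>x\<in>Rn n. g x = (\<Sum>i<m. r i x * a i x)"
    using gh(1) unfolding ideal_comb_def by blast
  moreover obtain s where "\<forall>i<m. poly_fun n (s i)" "\<forall>x\<in>Rn n. h x = (\<Sum>i<m. s i x * a i x)"
    using gh(2) unfolding ideal_comb_def by blast
  ultimately show ?thesis unfolding ideal_comb_def
    by (intro exI[of _ "\<lambda>i x. r i x + s i x"]) (auto intro: poly_fun_intros simp: sum.distrib ring_distribs)
qed

lemma ideal_comb_mult: "poly_fun n q \<Longrightarrow> ideal_comb n m a g \<Longrightarrow> ideal_comb n m a (\<lambda>x. q x * g x)"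
proof -
  assume q: "poly_fun n q" and "ideal_comb n m a g"
  then obtain r where "\<forall>i<m. poly_fun n (r i)" "\<forall>x\<in>Rn n. g x = (\<Sum>i<m. r i x * a i x)"
    unfolding ideal_comb_def by blast
  then show ?thesis using q unfolding ideal_comb_def
    by (intro exI[of _ "\<lambda>i x. q x * r i x"]) (auto intro: poly_fun_intros simp: sum_distrib_left mult_ac)
qed

lemma ideal_comb_sum:
  "(\<And>i. i \<in> I \<Longrightarrow> ideal_comb n m a (g i)) \<Longrightarrow> ideal_comb n m a (\<lambda>x. \<Sum>i\<in>I. g i x)"
  by (induction I rule: infinite_finite_induct) (auto intro: ideal_comb_add ideal_comb_zero)

lemma ideal_comb_cong: "ideal_comb n m a g \<Longrightarrow> (\<And>x. length x = n \<Longrightarrow> g x = h x) \<Longrightarrow> ideal_comb n m a h"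
  unfolding ideal_comb_def by simp

lemma ideal_comb_trans:
  assumes "ideal_comb n k f g" "\<And>i. i < k \<Longrightarrow> ideal_comb n m a (f i)"
  shows "ideal_comb n m a g"
proof -
  obtain r where r: "\<forall>i<k. poly_fun n (r i)" "\<forall>x\<in>Rn n. g x = (\<Sum>i<k. r i x * f i x)"
    using assms(1) unfolding ideal_comb_def by blast
  have "ideal_comb n m a (\<lambda>x. \<Sum>i<k. r i x * f i x)"
    using r assms(2) by (intro ideal_comb_sum ideal_comb_mult) auto
  then show ?thesis using r(2) by (auto elim: ideal_comb_cong)
qed

lemma ideal_comb_mono: "ideal_comb n k a g \<Longrightarrow> k \<le> m \<Longrightarrow> ideal_comb n m a g"
  by (erule ideal_comb_trans) (auto intro: ideal_comb_gen)

text \<open>\<open>l\<close> is only a bound; when minimal, it is the degree in the last variable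
  plus one, or 0 for the zero function.\<close>

definition expands :: "nat \<Rightarrow> (real list \<Rightarrow> real) \<Rightarrow> nat \<Rightarrow> (nat \<Rightarrow> real list \<Rightarrow> real) \<Rightarrow> bool" where
  "expands n p l a \<longleftrightarrow> (\<forall>i. poly_fun n (a i)) \<and>
     (\<forall>x y. length x = n \<longrightarrow> p (x @ [y]) = (\<Sum>i<l. a i x * y ^ i))"

lemma ex_expands: "poly_fun (Suc n) p \<Longrightarrow> \<exists>l a. expands n p l a"
  by (rule poly_fun_Suc_expand[of n p]) (auto simp: expands_def)

text \<open>The induction step picks a sequence \<open>f\<close> of elements of minimal degree outside the ideal
  of the previous ones and compares leading coefficients.\<close>
theorem hilbert_basis:
  fixes g :: "nat \<Rightarrow> real list \<Rightarrow> real"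
  assumes "\<And>k. poly_fun n (g k)"
  shows "\<exists>m. ideal_comb n m g (g m)"
  using assms
proof (induction n arbitrary: g)
  case 0
  show ?case
  proof (cases "g 0 [] = 0")
    case True
    then have "ideal_comb 0 0 g (g 0)" by (auto simp: ideal_comb_def)
    then show ?thesis by blast
  next
    case False
    then have "ideal_comb 0 1 g (g 1)" unfolding ideal_comb_def
      by (intro exI[of _ "\<lambda>i x. g 1 [] / g 0 []"]) (auto intro: poly_fun_intros)
    then show ?thesis by blast
  qed
next
  case (Suc n)
  show ?case
  proof (rule ccontr)
    assume no: "\<not> (\<exists>m. ideal_comb (Suc n) m g (g m))"
    define J where "J h \<longleftrightarrow> poly_fun (Suc n) h \<and> (\<exists>M. ideal_comb (Suc n) M g h)" for h
    define cand where "cand k f h \<longleftrightarrow> J h \<and> \<not> ideal_comb (Suc n) k f h" for k f h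
    \<comment> \<open>The relation for choosing the \<open>k\<close>-th triple (element, length,
      coefficients): an element of the ideal of all \<open>g\<close> outside the ideal of its
      predecessors, of minimal length. The premise on the predecessors makes the relation total, so
      that dependent choice applies.\<close>
    define P where "P f k r \<longleftrightarrow> ((\<forall>i<k. J (fst (f i))) \<longrightarrow>
        (case r of (h, l, a) \<Rightarrow> cand k (\<lambda>i. fst (f i)) h \<and> expands n h l a \<and>
          (\<forall>h' l' a'. cand k (\<lambda>i. fst (f i)) h' \<and> expands n h' l' a' \<longrightarrow> l \<le> l')))"
      for f :: "nat \<Rightarrow> (real list \<Rightarrow> real) \<times> nat \<times> (nat \<Rightarrow> real list \<Rightarrow> real)" and k r
    have ex: "\<exists>r. P f k r" for f k
    proof (cases "\<forall>i<k. J (fst (f i))")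
      case True
      then have "\<exists>M. \<forall>i<k. ideal_comb (Suc n) M g (fst (f i))"
      proof (induction k)
        case (Suc k)
        then obtain M where "\<forall>i<k. ideal_comb (Suc n) M g (fst (f i))" by auto
        moreover obtain M' where "ideal_comb (Suc n) M' g (fst (f k))" using Suc.prems J_def by auto
        ultimately show ?case
          by (intro exI[of _ "max M M'"]) (auto simp: less_Suc_eq intro: ideal_comb_mono)
      qed auto
      then obtain M where M: "\<forall>i<k. ideal_comb (Suc n) M g (fst (f i))" by blast
      \<comment> \<open>The predecessors lie in the ideal of \<open>g 0, ..., g (M - 1)\<close>; if
        \<open>g M\<close> were a combination of them, it would lie there too, against
        \<open>no\<close>.\<close>
      have "cand k (\<lambda>i. fst (f i)) (g M)"
      proof -
        have "ideal_comb (Suc n) (Suc M) g (g M)" by (rule ideal_comb_gen) simp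
        then have "J (g M)" unfolding J_def using Suc.prems[of M] by blast
        moreover have "\<not> ideal_comb (Suc n) k (\<lambda>i. fst (f i)) (g M)"
          using no ideal_comb_trans[of "Suc n" k "\<lambda>i. fst (f i)" "g M" M g] M by blast
        ultimately show ?thesis unfolding cand_def by blast
      qed
      moreover obtain l a where "expands n (g M) l a"
        using ex_expands[OF Suc.prems[of M]] by blast
      ultimately have "\<exists>l h a. cand k (\<lambda>i. fst (f i)) h \<and> expands n h l a" by blast
      then have "\<exists>h a. cand k (\<lambda>i. fst (f i)) h \<and> expands n h (LEAST l. \<exists>h a. cand k (\<lambda>i. fst (f i)) h \<and> expands n h l a) a"
        by (rule LeastI_ex)
      then obtain h a where ha: "cand k (\<lambda>i. fst (f i)) h" 
        "expands n h (LEAST l. \<exists>h a. cand k (\<lambda>i. fst (f i)) h \<and> expands n h l a) a" by blast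
      have "P f k (h, (LEAST l. \<exists>h a. cand k (\<lambda>i. fst (f i)) h \<and> expands n h l a), a)"
        unfolding P_def using ha by (auto intro: Least_le)
      then show ?thesis by blast
    qed (auto simp: P_def)
    have "\<exists>f. \<forall>k. P f k (f k)"
    proof (rule dependent_wf_choice[of "{(i,j::nat). i < j}"])
      show "wf {(i,j::nat). i < j}" by (rule wf)
      fix f g :: "nat \<Rightarrow> (real list \<Rightarrow> real) \<times> nat \<times> (nat \<Rightarrow> real list \<Rightarrow> real)" and x r
      assume "\<And>z. (z, x) \<in> {(i, j). i < j} \<Longrightarrow> f z = g z"
      then have eq: "f z = g z" if "z < x" for z using that by auto
      have "ideal_comb (Suc n) x (\<lambda>i. fst (f i)) h = ideal_comb (Suc n) x (\<lambda>i. fst (g i)) h" for h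
        unfolding ideal_comb_def by (simp add: eq)
      then show "P f x r = P g x r" unfolding P_def cand_def by (simp add: eq)
    qed (use ex in auto)
    then obtain F where F: "\<And>k. P F k (F k)" by blast
    define f where "f k = fst (F k)" for k
    define l where "l k = fst (snd (F k))" for k
    define a where "a k = snd (snd (F k))" for k
    have Jf: "J (f k)" for k
    proof (induction k rule: less_induct)
      case (less k)
      then show ?case using F[of k] unfolding P_def f_def cand_def by (auto split: prod.splits)
    qed
    have fc: "cand k f (f k)" "expands n (f k) (l k) (a k)"
      "\<And>h' l' a'. cand k f h' \<Longrightarrow> expands n h' l' a' \<Longrightarrow> l k \<le> l'" for k
      using F[of k] Jf unfolding P_def f_def l_def a_def by (auto split: prod.splits)
    have pos: "l k > 0" for k
    proof (rule ccontr)
      assume "\<not> l k > 0"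
      then have "f k (x @ [y]) = 0" if "length x = n" for x y using fc(2)[of k] that by (auto simp: expands_def)
      then have "f k z = 0" if "length z = Suc n" for z using that by (metis length_SucE)
      then have "ideal_comb (Suc n) k f (f k)" using ideal_comb_cong[OF ideal_comb_zero] by metis
      then show False using fc(1)[of k] by (auto simp: cand_def)
    qed
    have mono: "l i \<le> l k" if "i \<le> k" for i k
      using fc(1)[of k] fc(2)[of k] fc(3)[of i "f k" "l k" "a k"] that
      by (auto simp: cand_def intro: ideal_comb_mono)
    \<comment> \<open>The leading coefficients, to which the induction hypothesis in
      \<open>n\<close> variables applies.\<close>
    define b where "b k = a k (l k - 1)" for k
    have "poly_fun n (b k)" for k using fc(2)[of k] by (auto simp: b_def expands_def)
    then obtain m where "ideal_comb n m b (b m)" using Suc.IH by blast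
    then obtain r where r: "\<forall>i<m. poly_fun n (r i)" "\<forall>x\<in>Rn n. b m x = (\<Sum>i<m. r i x * b i x)"
      unfolding ideal_comb_def by blast
    \<comment> \<open>The power of the last variable lifts \<open>f i\<close> to the length of
      \<open>f m\<close>, so that the leading terms cancel in \<open>h\<close>. Then
      \<open>h\<close> is a candidate shorter than \<open>f m\<close>.\<close>
    define s where "s i z = r i (take n z) * z ! n ^ (l m - l i)" for i and z :: "real list"
    have s: "poly_fun (Suc n) (s i)" if "i < m" for i
      unfolding s_def using r(1) that by (intro poly_fun_intros poly_fun_take) auto
    define h where "h z = f m z - (\<Sum>i<m. s i z * f i z)" for z
    have "ideal_comb (Suc n) m f (\<lambda>z. \<Sum>i<m. s i z * f i z)"
      using s unfolding ideal_comb_def by blast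
    then have "\<not> ideal_comb (Suc n) m f h"
      using fc(1)[of m] ideal_comb_add[of "Suc n" m f h] unfolding cand_def h_def by fastforce
    moreover have "poly_fun (Suc n) h"
      unfolding h_def using s Jf by (intro poly_fun_intros) (auto simp: J_def)
    moreover have "\<exists>M. ideal_comb (Suc n) M g h"
    proof -
      have "\<exists>M. \<forall>i<k. ideal_comb (Suc n) M g (f i)" for k
      proof (induction k)
        case (Suc k)
        then obtain M where "\<forall>i<k. ideal_comb (Suc n) M g (f i)" by auto
        moreover obtain M' where "ideal_comb (Suc n) M' g (f k)" using Jf[of k] J_def by auto
        ultimately show ?case
          by (intro exI[of _ "max M M'"]) (auto simp: less_Suc_eq intro: ideal_comb_mono)
      qed auto
      then obtain M where M: "\<forall>i<Suc m. ideal_comb (Suc n) M g (f i)" by blast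
      have "ideal_comb (Suc n) M g (\<lambda>z. f m z + (\<Sum>i<m. (- s i z) * f i z))"
        using M s by (intro ideal_comb_add ideal_comb_sum ideal_comb_mult poly_fun_intros) auto
      moreover have "h = (\<lambda>z. f m z + (\<Sum>i<m. (- s i z) * f i z))" by (rule ext) (simp add: h_def sum_negf)
      ultimately show ?thesis by auto
    qed
    ultimately have ch: "cand m f h" by (simp add: cand_def J_def)
    define c where "c j x = a m j x - (\<Sum>i<m. r i x * (if j \<ge> l m - l i then a i (j - (l m - l i)) x else 0))" for j x
    have c: "poly_fun n (c j)" for j
      unfolding c_def using r(1) fc(2)
      by (intro poly_fun_intros poly_fun_if) (auto simp: expands_def)
    have hx: "h (x @ [y]) = (\<Sum>j<l m. c j x * y ^ j)" if x: "length x = n" for x y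
    proof -
      have 1: "y ^ (l m - l i) * f i (x @ [y]) = (\<Sum>j<l m. (if j \<ge> l m - l i then a i (j - (l m - l i)) x else 0) * y ^ j)"
        if "i < m" for i
      proof -
        have le: "l i \<le> l m" using mono that by simp
        have "y ^ (l m - l i) * f i (x @ [y]) = (\<Sum>j<l i. a i j x * y ^ (j + (l m - l i)))"
          using fc(2)[of i] x by (auto simp: expands_def sum_distrib_left power_add mult_ac)
        also have "\<dots> = (\<Sum>j\<in>{l m - l i..<l m}. a i (j - (l m - l i)) x * y ^ j)"
          by (rule sum.reindex_bij_witness[of _ "\<lambda>j. j - (l m - l i)" "\<lambda>j. j + (l m - l i)"]) (use le in auto)
        also have "\<dots> = (\<Sum>j<l m. (if j \<ge> l m - l i then a i (j - (l m - l i)) x else 0) * y ^ j)"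
          by (rule sum.mono_neutral_cong_left) auto
        finally show ?thesis .
      qed
      have "(\<Sum>i<m. s i (x @ [y]) * f i (x @ [y])) = (\<Sum>i<m. r i x * (y ^ (l m - l i) * f i (x @ [y])))"
        using x by (simp add: s_def mult_ac nth_append)
      also have "\<dots> = (\<Sum>i<m. \<Sum>j<l m. r i x * (if j \<ge> l m - l i then a i (j - (l m - l i)) x else 0) * y ^ j)"
        by (simp add: 1 sum_distrib_left mult_ac)
      also have "\<dots> = (\<Sum>j<l m. (\<Sum>i<m. r i x * (if j \<ge> l m - l i then a i (j - (l m - l i)) x else 0)) * y ^ j)"
        by (subst sum.swap) (simp add: sum_distrib_right)
      finally show ?thesis using fc(2)[of m] x
        by (simp add: h_def c_def expands_def left_diff_distrib sum_subtractf)
    qed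
    have "c (l m - 1) x = 0" if x: "length x = n" for x
    proof -
      have eq: "(\<Sum>i<m. r i x * (if l m - 1 \<ge> l m - l i then a i (l m - 1 - (l m - l i)) x else 0)) = (\<Sum>i<m. r i x * b i x)"
      proof (rule sum.cong[OF refl])
        fix i assume "i \<in> {..<m}"
        then have "l i \<le> l m" using mono by simp
        then have "l m - 1 - (l m - l i) = l i - 1" "l m - 1 \<ge> l m - l i" using pos[of i] by auto
        then show "r i x * (if l m - 1 \<ge> l m - l i then a i (l m - 1 - (l m - l i)) x else 0) = r i x * b i x"
          by (simp add: b_def)
      qed
      show ?thesis unfolding c_def eq using r(2) x by (simp add: b_def)
    qed
    then have "h (x @ [y]) = (\<Sum>j<l m - 1. c j x * y ^ j)" if "length x = n" for x y
      using hx[OF that] that pos[of m] by (cases "l m") auto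
    then have "expands n h (l m - 1) c" using c by (simp add: expands_def)
    then show False using fc(3)[OF ch] pos[of m] by fastforce
  qed
qed

section \<open>Algebraic sets, Zariski closure and irreducibility\<close>

lemma alg_set_zeroI: "poly_fun n p \<Longrightarrow> alg_set n {x\<in>Rn n. p x = 0}"
  unfolding alg_set_def by (rule exI[of _ "{p}"]) auto

text \<open>Over the reals a sum of squares merges finitely many equations into one.\<close>

lemma alg_set_zeroE:
  assumes "alg_set n T" obtains h where "poly_fun n h" "T = {x\<in>Rn n. h x = 0}"
proof -
  obtain P where P: "finite P" "\<forall>p\<in>P. poly_fun n p" "T = {x \<in> Rn n. \<forall>p\<in>P. p x = 0}"
    using assms unfolding alg_set_def by blast
  have "poly_fun n (\<lambda>x. \<Sum>p\<in>P. (p x)\<^sup>2)" using P by (intro poly_fun_intros) auto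
  moreover have "T = {x\<in>Rn n. (\<Sum>p\<in>P. (p x)\<^sup>2) = 0}" using P by (auto simp: sum_nonneg_eq_0_iff)
  ultimately show thesis by (rule that)
qed

lemma alg_set_Rn: "alg_set n (Rn n)"
  unfolding alg_set_def by (rule exI[of _ "{}"]) auto

lemma alg_set_subset: "alg_set n T \<Longrightarrow> T \<subseteq> Rn n"
  by (auto simp: alg_set_def)

lemma alg_set_Int: "alg_set n A \<Longrightarrow> alg_set n B \<Longrightarrow> alg_set n (A \<inter> B)"
proof -
  assume AB: "alg_set n A" "alg_set n B"
  obtain P where "finite P" "\<forall>p\<in>P. poly_fun n p" "A = {x \<in> Rn n. \<forall>p\<in>P. p x = 0}"
    using AB(1) unfolding alg_set_def by blast
  moreover obtain Q where "finite Q" "\<forall>p\<in>Q. poly_fun n p" "B = {x \<in> Rn n. \<forall>p\<in>Q. p x = 0}"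
    using AB(2) unfolding alg_set_def by blast
  ultimately show ?thesis unfolding alg_set_def by (intro exI[of _ "P \<union> Q"]) auto
qed

text \<open>In an infinite descending chain \<open>T\<close> the basis theorem writes the equation
  of some \<open>T (Suc m)\<close> as a combination of those of \<open>T 1, ..., T m\<close>, all of
  which vanish on \<open>T m\<close>.\<close>

lemma wf_alg_set: "wf {(T', T). alg_set n T' \<and> alg_set n T \<and> T' \<subset> T}"
proof (subst wf_iff_no_infinite_down_chain, rule notI, elim exE)
  fix T assume "\<forall>i. (T (Suc i), T i) \<in> {(T', T). alg_set n T' \<and> alg_set n T \<and> T' \<subset> T}"
  then have T: "\<And>i. alg_set n (T i)" "\<And>i. T (Suc i) \<subset> T i" by auto
  have dec: "T j \<subseteq> T i" if "i \<le> j" for i j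
    using that by (rule lift_Suc_antimono_le[rotated]) (use T(2) in auto)
  have "\<exists>h. poly_fun n h \<and> T i = {x\<in>Rn n. h x = 0}" for i using T(1)[of i] by (metis alg_set_zeroE)
  then obtain h where h: "\<And>i. poly_fun n (h i)" "\<And>i. T i = {x\<in>Rn n. h i x = 0}" by metis
  obtain m where "ideal_comb n m (\<lambda>i. h (Suc i)) (h (Suc m))" using hilbert_basis[of n "\<lambda>i. h (Suc i)"] h by blast
  then obtain r where r: "\<forall>x\<in>Rn n. h (Suc m) x = (\<Sum>i<m. r i x * h (Suc i) x)" unfolding ideal_comb_def by blast
  have "T m \<subseteq> T (Suc m)"
  proof
    fix x assume x: "x \<in> T m"
    then have xn: "x \<in> Rn n" using h by blast
    have "h (Suc i) x = 0" if "i < m" for i using dec[of "Suc i" m] x that h by auto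
    then have "h (Suc m) x = 0" using r xn by simp
    then show "x \<in> T (Suc m)" using h xn by blast
  qed
  then show False using T(2)[of m] by blast
qed

lemma zar_closure_eq:
  assumes "V \<subseteq> Rn n"
  shows "zar_closure n V = {x\<in>Rn n. \<forall>p. poly_fun n p \<longrightarrow> (\<forall>v\<in>V. p v = 0) \<longrightarrow> p x = 0}"
proof (intro set_eqI iffI)
  fix x assume x: "x \<in> zar_closure n V"
  have "p x = 0" if "poly_fun n p" "\<forall>v\<in>V. p v = 0" for p
    using x alg_set_zeroI[OF that(1)] that(2) assms unfolding zar_closure_def by blast
  moreover have "x \<in> Rn n" using x alg_set_Rn[of n] assms unfolding zar_closure_def by (metis (mono_tags, lifting) Inter_iff mem_Collect_eq)
  ultimately show "x \<in> {x\<in>Rn n. \<forall>p. poly_fun n p \<longrightarrow> (\<forall>v\<in>V. p v = 0) \<longrightarrow> p x = 0}" by blast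
next
  fix x assume x: "x \<in> {x\<in>Rn n. \<forall>p. poly_fun n p \<longrightarrow> (\<forall>v\<in>V. p v = 0) \<longrightarrow> p x = 0}"
  have "x \<in> T" if "alg_set n T" "V \<subseteq> T" for T
    using that x by (elim alg_set_zeroE) auto
  then show "x \<in> zar_closure n V" unfolding zar_closure_def by blast
qed

lemma subset_zar_closure: "V \<subseteq> zar_closure n V"
  by (auto simp: zar_closure_def)

text \<open>The infinite intersection is algebraic because a minimal algebraic set containing
  \<open>V\<close> exists and, by minimality, lies in every other one.\<close>

lemma alg_set_zar_closure:
  assumes "V \<subseteq> Rn n" shows "alg_set n (zar_closure n V)"
proof -
  define \<C> where "\<C> = {T. alg_set n T \<and> V \<subseteq> T}"
  have "Rn n \<in> \<C>" using assms alg_set_Rn by (auto simp: \<C>_def)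
  then obtain T where TC: "T \<in> \<C>"
    "\<And>T'. (T', T) \<in> {(T', T). alg_set n T' \<and> alg_set n T \<and> T' \<subset> T} \<Longrightarrow> T' \<notin> \<C>"
    by (rule wfE_min[OF wf_alg_set[of n]]) blast
  then have T: "alg_set n T" "V \<subseteq> T" "\<And>T'. alg_set n T' \<Longrightarrow> V \<subseteq> T' \<Longrightarrow> \<not> T' \<subset> T"
    by (auto simp: \<C>_def)
  have "T \<subseteq> T'" if "alg_set n T'" "V \<subseteq> T'" for T'
    using T(3)[of "T \<inter> T'"] that T(1,2) alg_set_Int[of n T T'] by blast
  then have "zar_closure n V = T" using T(1,2) unfolding zar_closure_def by blast
  then show ?thesis using T(1) by simp
qed

lemma zar_closure_minimal: "alg_set n T \<Longrightarrow> V \<subseteq> T \<Longrightarrow> zar_closure n V \<subseteq> T"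
  by (auto simp: zar_closure_def)

lemma zar_closure_dense_iff:
  assumes "A \<subseteq> V" "V \<subseteq> Rn n"
  shows "zar_closure n A = zar_closure n V \<longleftrightarrow>
    (\<forall>r. poly_fun n r \<longrightarrow> (\<forall>x\<in>A. r x = 0) \<longrightarrow> (\<forall>x\<in>V. r x = 0))" (is "_ \<longleftrightarrow> ?R")
proof
  assume "zar_closure n A = zar_closure n V"
  then show ?R using subset_zar_closure[of V n] zar_closure_eq[of A n] assms by auto
next
  assume ?R
  moreover have "A \<subseteq> Rn n" using assms by blast
  ultimately show "zar_closure n A = zar_closure n V"
    using assms by (auto simp: zar_closure_eq subset_iff)
qed

text \<open>The form used from here on: free of division, with density expressed through vanishing
  polynomials.\<close>

lemma rational_on_iff:
  assumes "V \<subseteq> Rn n"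
  shows "rational_on n V g \<longleftrightarrow> (\<exists>p q. poly_fun n p \<and> poly_fun n q \<and>
    (\<forall>r. poly_fun n r \<longrightarrow> (\<forall>x\<in>V. q x \<noteq> 0 \<longrightarrow> r x = 0) \<longrightarrow> (\<forall>x\<in>V. r x = 0)) \<and>
    (\<forall>x\<in>V. q x \<noteq> 0 \<longrightarrow> g x * q x = p x))"
proof -
  have 1: "zar_closure n {x \<in> V. q x \<noteq> 0} = zar_closure n V \<longleftrightarrow>
    (\<forall>r. poly_fun n r \<longrightarrow> (\<forall>x\<in>V. q x \<noteq> 0 \<longrightarrow> r x = 0) \<longrightarrow> (\<forall>x\<in>V. r x = 0))" for q
    by (subst zar_closure_dense_iff[OF _ assms]) auto
  have 2: "(\<forall>x\<in>V. q x \<noteq> 0 \<longrightarrow> g x = p x / q x) \<longleftrightarrow> (\<forall>x\<in>V. q x \<noteq> 0 \<longrightarrow> g x * q x = p x)" for p q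
    by (auto simp: field_simps)
  show ?thesis unfolding rational_on_def 1 2 ..
qed

text \<open>The vanishing ideal of \<open>S\<close> is prime, that is, the Zariski closure of
  \<open>S\<close> is irreducible. \<open>S\<close> itself may be any set: it will be a part of
  \<open>W\<close>, a piece of the graph or a set of points on an arc.\<close>

definition zar_irred :: "nat \<Rightarrow> real list set \<Rightarrow> bool" where
  "zar_irred n S \<longleftrightarrow> S \<noteq> {} \<and> S \<subseteq> Rn n \<and>
     (\<forall>p q. poly_fun n p \<longrightarrow> poly_fun n q \<longrightarrow> (\<forall>x\<in>S. p x * q x = 0) \<longrightarrow>
        (\<forall>x\<in>S. p x = 0) \<or> (\<forall>x\<in>S. q x = 0))"

lemma zar_irredD:
  "zar_irred n S \<Longrightarrow> poly_fun n p \<Longrightarrow> poly_fun n q \<Longrightarrow> x \<in> S \<Longrightarrow> p x \<noteq> 0 \<Longrightarrow>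
    (\<And>x. x \<in> S \<Longrightarrow> p x * q x = 0) \<Longrightarrow> y \<in> S \<Longrightarrow> q y = 0"
  unfolding zar_irred_def by blast

lemma zar_irred_prod:
  assumes "zar_irred n S" "finite I" "\<And>i. i \<in> I \<Longrightarrow> poly_fun n (p i)" "\<And>i. i \<in> I \<Longrightarrow> \<exists>x\<in>S. p i x \<noteq> 0"
  shows "\<exists>x\<in>S. \<forall>i\<in>I. p i x \<noteq> 0"
proof -
  have "\<exists>x\<in>S. (\<Prod>i\<in>I. p i x) \<noteq> 0"
    using assms(2-4)
  proof (induction I)
    case empty
    then show ?case using assms(1) by (auto simp: zar_irred_def)
  next
    case (insert i I)
    then obtain x y where xy: "x \<in> S" "p i x \<noteq> 0" "y \<in> S" "(\<Prod>i\<in>I. p i y) \<noteq> 0" by (metis insertCI)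
    have "poly_fun n (p i)" "poly_fun n (\<lambda>x. \<Prod>i\<in>I. p i x)" using insert.prems by (auto intro: poly_fun_intros)
    then obtain z where "z \<in> S" "p i z * (\<Prod>i\<in>I. p i z) \<noteq> 0"
      using zar_irredD[OF assms(1), of "p i" "\<lambda>x. \<Prod>i\<in>I. p i x" x y] xy by blast
    then show ?case using insert by auto
  qed
  then show ?thesis using assms(2) by auto
qed

text \<open>Noetherian induction on an algebraic set \<open>Z\<close>: if \<open>p * q\<close>
  vanishes on \<open>S \<inter> Z\<close> but neither factor does so identically, the zero sets of
  \<open>p\<close> and \<open>q\<close> cut \<open>Z\<close> into two smaller sets that still cover
  \<open>S \<inter> Z\<close>.\<close>

lemma zar_irred_decomp:
  assumes "S \<subseteq> Rn n"
  shows "\<exists>\<T>. finite \<T> \<and> (\<forall>T\<in>\<T>. alg_set n T \<and> zar_irred n (S \<inter> T)) \<and> S \<subseteq> \<Union>\<T>"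
proof -
  have "\<exists>\<T>. finite \<T> \<and> (\<forall>T\<in>\<T>. alg_set n T \<and> zar_irred n (S \<inter> T)) \<and> S \<inter> Z \<subseteq> \<Union>\<T>" if "alg_set n Z" for Z
    using that
  proof (induction Z rule: wf_induct_rule[OF wf_alg_set[of n]])
    case (1 Z)
    show ?case
    proof (cases "S \<inter> Z = {} \<or> zar_irred n (S \<inter> Z)")
      case True
      then show ?thesis
      proof
        assume "S \<inter> Z = {}"
        then show ?thesis by (intro exI[of _ "{}"]) auto
      next
        assume "zar_irred n (S \<inter> Z)"
        then show ?thesis using 1(2) by (intro exI[of _ "{Z}"]) auto
      qed
    next
      case False
      then obtain p q where pq: "poly_fun n p" "poly_fun n q" "\<forall>x\<in>S \<inter> Z. p x * q x = 0"
        "\<exists>x\<in>S \<inter> Z. p x \<noteq> 0" "\<exists>x\<in>S \<inter> Z. q x \<noteq> 0" using assms unfolding zar_irred_def by blast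
      have "alg_set n (Z \<inter> {x\<in>Rn n. p x = 0})" "alg_set n (Z \<inter> {x\<in>Rn n. q x = 0})"
        using 1(2) pq by (blast intro: alg_set_Int alg_set_zeroI)+
      moreover have "Z \<inter> {x\<in>Rn n. p x = 0} \<subset> Z" "Z \<inter> {x\<in>Rn n. q x = 0} \<subset> Z" using pq by auto
      ultimately obtain \<T>1 \<T>2 where
        "finite \<T>1 \<and> (\<forall>T\<in>\<T>1. alg_set n T \<and> zar_irred n (S \<inter> T)) \<and> S \<inter> (Z \<inter> {x\<in>Rn n. p x = 0}) \<subseteq> \<Union>\<T>1"
        "finite \<T>2 \<and> (\<forall>T\<in>\<T>2. alg_set n T \<and> zar_irred n (S \<inter> T)) \<and> S \<inter> (Z \<inter> {x\<in>Rn n. q x = 0}) \<subseteq> \<Union>\<T>2"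
        using 1(1)[of "Z \<inter> {x\<in>Rn n. p x = 0}"] 1(1)[of "Z \<inter> {x\<in>Rn n. q x = 0}"] 1(2) by auto
      moreover from this have "S \<inter> Z \<subseteq> \<Union>(\<T>1 \<union> \<T>2)"
        using pq(3) assms by fastforce
      ultimately show ?thesis by (intro exI[of _ "\<T>1 \<union> \<T>2"]) auto
    qed
  qed
  from this[of "Rn n"] show ?thesis using assms alg_set_Rn by (auto simp: Int_absorb2)
qed

section \<open>Algebraic dependence\<close>

text \<open>Elimination of the unknown \<open>k\<close> by the row \<open>m\<close>, multiplying by
  the pivot \<open>m k\<close> instead of dividing. This identity lifts a solution \<open>v\<close>
  of the reduced system; for \<open>r = m\<close> the right-hand side is zero.\<close>

lemma pivot_sum:
  fixes m r v :: "'i \<Rightarrow> real"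
  assumes "finite I" "k \<in> I"
  shows "(\<Sum>i\<in>I. r i * (if i = k then - (\<Sum>i\<in>I-{k}. m i * v i) else m k * v i))
       = (\<Sum>i\<in>I-{k}. (m k * r i - r k * m i) * v i)"
proof -
  have "(\<Sum>i\<in>I. r i * (if i = k then - (\<Sum>i\<in>I-{k}. m i * v i) else m k * v i))
    = r k * - (\<Sum>i\<in>I-{k}. m i * v i) + (\<Sum>i\<in>I-{k}. r i * (m k * v i))"
    using assms by (subst sum.remove[of _ k]) auto
  then show ?thesis
    by (simp add: sum_subtractf sum_distrib_left algebra_simps)
qed

text \<open>The opposite direction: a solution of the full system restricts to one of the reduced
  system.\<close>

lemma pivot_sum':
  fixes m r v :: "'i \<Rightarrow> real"
  assumes "finite I" "k \<in> I"
  shows "(\<Sum>i\<in>I-{k}. (m k * r i - r k * m i) * v i)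
       = m k * (\<Sum>i\<in>I. r i * v i) - r k * (\<Sum>i\<in>I. m i * v i)"
  using assms
  by (simp add: sum.remove[of _ k] left_diff_distrib sum_subtractf sum_distrib_left algebra_simps)

text \<open>Linear algebra over a domain: induction over the equations, each nontrivial one
  eliminating one unknown.\<close>

lemma poly_kernel_exists:
  fixes M :: "'r \<Rightarrow> 'i \<Rightarrow> real list \<Rightarrow> real"
  assumes "finite R" "finite I" "card I > card R" "\<And>j i. j \<in> R \<Longrightarrow> i \<in> I \<Longrightarrow> poly_fun d (M j i)"
  shows "\<exists>v. (\<forall>i\<in>I. poly_fun d (v i)) \<and> (\<exists>i\<in>I. \<exists>w\<in>Rn d. v i w \<noteq> 0) \<and>
    (\<forall>j\<in>R. \<forall>w\<in>Rn d. (\<Sum>i\<in>I. M j i w * v i w) = 0)"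
  using assms
proof (induction R arbitrary: I M)
  case empty
  then obtain i where "i \<in> I" by fastforce
  then show ?case
    by (intro exI[of _ "\<lambda>_ _. 1"]) (auto intro: poly_fun_intros exI[of _ "replicate d 0"])
next
  case (insert r R)
  show ?case
  proof (cases "\<forall>i\<in>I. \<forall>w\<in>Rn d. M r i w = 0")
    case True
    have "\<exists>v. (\<forall>i\<in>I. poly_fun d (v i)) \<and> (\<exists>i\<in>I. \<exists>w\<in>Rn d. v i w \<noteq> 0) \<and>
        (\<forall>j\<in>R. \<forall>w\<in>Rn d. (\<Sum>i\<in>I. M j i w * v i w) = 0)"
      using insert by (intro insert.IH) auto
    then show ?thesis using True by auto
  next
    case False
    then obtain k where k: "k \<in> I" "\<exists>w\<in>Rn d. M r k w \<noteq> 0" by blast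
    have "\<exists>v. (\<forall>i\<in>I-{k}. poly_fun d (v i)) \<and> (\<exists>i\<in>I-{k}. \<exists>w\<in>Rn d. v i w \<noteq> 0) \<and>
        (\<forall>j\<in>R. \<forall>w\<in>Rn d. (\<Sum>i\<in>I-{k}. (M r k w * M j i w - M j k w * M r i w) * v i w) = 0)"
    proof (rule insert.IH)
      show "card R < card (I - {k})" using insert k by auto
      show "poly_fun d (\<lambda>w. M r k w * M j i w - M j k w * M r i w)" if "j \<in> R" "i \<in> I - {k}" for j i
        using insert.prems(3) k that by (intro poly_fun_intros) auto
    qed (use insert in auto)
    then obtain v where v: "\<forall>i\<in>I-{k}. poly_fun d (v i)" "\<exists>i\<in>I-{k}. \<exists>w\<in>Rn d. v i w \<noteq> 0"
      "\<forall>j\<in>R. \<forall>w\<in>Rn d. (\<Sum>i\<in>I-{k}. (M r k w * M j i w - M j k w * M r i w) * v i w) = 0" by blast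
    define u where "u i w = (if i = k then - (\<Sum>i\<in>I-{k}. M r i w * v i w) else M r k w * v i w)" for i w
    have "poly_fun d (u i)" if "i \<in> I" for i
      unfolding u_def using that k v(1) insert.prems(3)
      by (cases "i = k") (auto intro!: poly_fun_intros)
    moreover have "\<exists>i\<in>I. \<exists>w\<in>Rn d. u i w \<noteq> 0"
    proof -
      obtain i where i: "i \<in> I - {k}" "\<exists>w\<in>Rn d. v i w \<noteq> 0" using v(2) by blast
      have "poly_fun d (M r k)" "poly_fun d (v i)" using insert.prems(3) k(1) v(1) i(1) by auto
      then obtain w where "w \<in> Rn d" "M r k w * v i w \<noteq> 0"
        using poly_fun_mult_nonzero k(2) i(2) by blast
      then have "u i w \<noteq> 0" using i by (simp add: u_def)
      then show ?thesis using i \<open>w \<in> Rn d\<close> by blast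
    qed
    moreover have "(\<Sum>i\<in>I. M j i w * u i w) = 0" if "j \<in> insert r R" "w \<in> Rn d" for j w
      unfolding u_def using pivot_sum[OF insert.prems(1) k(1), of "\<lambda>i. M j i w" "\<lambda>i. M r i w" "\<lambda>i. v i w"] v(3) that
      by (auto simp: mult.commute)
    ultimately show ?thesis by blast
  qed
qed

definition zar_dense :: "nat \<Rightarrow> real list set \<Rightarrow> bool" where
  "zar_dense d A \<longleftrightarrow> A \<subseteq> Rn d \<and> (\<forall>g. poly_fun d g \<longrightarrow> (\<forall>c\<in>A. g c = 0) \<longrightarrow> (\<forall>c\<in>Rn d. g c = 0))"

text \<open>Fraction-free elimination.  Only the equations have to depend polynomially on the point, the
  side condition \<open>L\<close> may be arbitrary.\<close>
lemma poly_kernel_lift: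
  fixes M :: "'r \<Rightarrow> 'i \<Rightarrow> real list \<Rightarrow> real" and L :: "'i \<Rightarrow> real list \<Rightarrow> real"
  assumes "finite I" "\<And>r i. i \<in> I \<Longrightarrow> poly_fun d (M r i)" "zar_dense d A"
    and "\<And>c. c \<in> A \<Longrightarrow> \<exists>v. (\<forall>r. (\<Sum>i\<in>I. M r i c * v i) = 0) \<and> (\<Sum>i\<in>I. L i c * v i) \<noteq> 0"
  shows "\<exists>v. (\<forall>i\<in>I. poly_fun d (v i)) \<and> (\<forall>r. \<forall>c\<in>Rn d. (\<Sum>i\<in>I. M r i c * v i c) = 0) \<and>
    (\<exists>c\<in>A. (\<Sum>i\<in>I. L i c * v i c) \<noteq> 0)"
  using assms
\<comment> \<open>The induction runs over the unknowns because there may be infinitely many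
  equations.\<close>
proof (induction "card I" arbitrary: I M L A)
  case (0 I)
  have "A \<noteq> {}"
  proof
    assume "A = {}"
    then have "\<forall>c\<in>Rn d. (1::real) = 0" using 0(4) pf_const[of d 1] unfolding zar_dense_def by blast
    then show False by (auto dest: spec[of _ "replicate d 0"])
  qed
  then show ?case using 0 by fastforce
next
  case (Suc n I)
  show ?case
  proof (cases "\<forall>r. \<forall>i\<in>I. \<forall>w\<in>Rn d. M r i w = 0")
    case True
    have "A \<noteq> {}"
    proof
      assume "A = {}"
      then have "\<forall>c\<in>Rn d. (1::real) = 0" using Suc.prems(3) pf_const[of d 1] unfolding zar_dense_def by blast
      then show False by (auto dest: spec[of _ "replicate d 0"])
    qed
    then obtain c where c: "c \<in> A" by blast
    then obtain v where v: "(\<Sum>i\<in>I. L i c * v i) \<noteq> 0" using Suc.prems(4) by blast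
    show ?thesis using True c v
      by (intro exI[of _ "\<lambda>i c. v i"]) (auto intro: poly_fun_intros)
  next
    case False
    then obtain r k where k: "k \<in> I" "\<exists>w\<in>Rn d. M r k w \<noteq> 0" by blast
    \<comment> \<open>Where the pivot is nonzero, solutions pass to the reduced system and keep the
      side condition. \<open>B\<close> is still dense because polynomials form a domain.\<close>
    define B where "B = {c\<in>A. M r k c \<noteq> 0}"
    define M' where "M' s i c = M r k c * M s i c - M s k c * M r i c" for s i c
    define L' where "L' i c = M r k c * L i c - L k c * M r i c" for i c
    have "\<exists>v. (\<forall>i\<in>I-{k}. poly_fun d (v i)) \<and> (\<forall>r. \<forall>c\<in>Rn d. (\<Sum>i\<in>I-{k}. M' r i c * v i c) = 0) \<and>
      (\<exists>c\<in>B. (\<Sum>i\<in>I-{k}. L' i c * v i c) \<noteq> 0)"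
    proof (rule Suc.hyps(1))
      show "n = card (I - {k})" using Suc.hyps(2) k Suc.prems(1) by simp
      show "poly_fun d (M' r i)" if "i \<in> I - {k}" for r i
        unfolding M'_def using Suc.prems(2) k that by (intro poly_fun_intros) auto
      show "zar_dense d B"
        unfolding zar_dense_def
      proof (intro conjI allI impI)
        show "B \<subseteq> Rn d" using Suc.prems(3) by (auto simp: B_def zar_dense_def)
        fix g assume g: "poly_fun d g" "\<forall>c\<in>B. g c = 0"
        have p: "poly_fun d (M r k)" using Suc.prems(2) k by blast
        have "\<forall>c\<in>A. M r k c * g c = 0" using g by (auto simp: B_def)
        then have "\<forall>c\<in>Rn d. M r k c * g c = 0"
          using Suc.prems(3) pf_mult[OF p g(1)] unfolding zar_dense_def by blast
        then show "\<forall>c\<in>Rn d. g c = 0" using poly_fun_mult_nonzero[OF p g(1) k(2)] by blast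
      qed
      fix c assume c: "c \<in> B"
      then obtain v where v: "\<forall>r. (\<Sum>i\<in>I. M r i c * v i) = 0" "(\<Sum>i\<in>I. L i c * v i) \<noteq> 0"
        using Suc.prems(4)[of c] by (auto simp: B_def)
      have "(\<Sum>i\<in>I-{k}. M' s i c * v i) = 0" for s
        unfolding M'_def using pivot_sum'[OF Suc.prems(1) k(1), of "\<lambda>i. M r i c" "\<lambda>i. M s i c" v] v by simp
      moreover have "(\<Sum>i\<in>I-{k}. L' i c * v i) \<noteq> 0"
        unfolding L'_def using pivot_sum'[OF Suc.prems(1) k(1), of "\<lambda>i. M r i c" "\<lambda>i. L i c" v] v c
        by (simp add: B_def)
      ultimately show "\<exists>v. (\<forall>r. (\<Sum>i\<in>I-{k}. M' r i c * v i) = 0) \<and> (\<Sum>i\<in>I-{k}. L' i c * v i) \<noteq> 0" by blast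
    qed (use Suc.prems in auto)
    then obtain v where v: "\<forall>i\<in>I-{k}. poly_fun d (v i)"
      "\<forall>r. \<forall>c\<in>Rn d. (\<Sum>i\<in>I-{k}. M' r i c * v i c) = 0" "\<exists>c\<in>B. (\<Sum>i\<in>I-{k}. L' i c * v i c) \<noteq> 0" by blast
    define u where "u i w = (if i = k then - (\<Sum>i\<in>I-{k}. M r i w * v i w) else M r k w * v i w)" for i w
    have "poly_fun d (u i)" if "i \<in> I" for i
      unfolding u_def using that k v(1) Suc.prems(2)
      by (cases "i = k") (auto intro!: poly_fun_intros)
    moreover have "(\<Sum>i\<in>I. M s i c * u i c) = 0" if "c \<in> Rn d" for s c
      unfolding u_def using pivot_sum[OF Suc.prems(1) k(1), of "\<lambda>i. M s i c" "\<lambda>i. M r i c" "\<lambda>i. v i c"] v(2) that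
      by (auto simp: M'_def)
    moreover have "(\<Sum>i\<in>I. L i c * u i c) = (\<Sum>i\<in>I-{k}. L' i c * v i c)" for c
      unfolding u_def L'_def using pivot_sum[OF Suc.prems(1) k(1), of "\<lambda>i. L i c" "\<lambda>i. M r i c" "\<lambda>i. v i c"] by simp
    ultimately show ?thesis using v(3) by (intro exI[of _ u]) (auto simp: B_def)
  qed
qed

text \<open>Nontriviality is asked of the coefficients as polynomials on R^d, not on the image of
  \<open>\<pi>\<close>. The relation may thus be vacuous unless that image is Zariski dense, which
  is what \<open>indep_on\<close> provides.\<close>

definition alg_over :: "nat \<Rightarrow> ('a \<Rightarrow> real list) \<Rightarrow> 'a set \<Rightarrow> ('a \<Rightarrow> real) \<Rightarrow> bool" where
  "alg_over d \<pi> E h \<longleftrightarrow> (\<exists>m a. (\<forall>i. poly_fun d (a i)) \<and> (\<exists>i\<le>m. \<exists>w\<in>Rn d. a i w \<noteq> 0) \<and>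
      (\<forall>e\<in>E. (\<Sum>i\<le>m. a i (\<pi> e) * h e ^ i) = 0))"

lemma alg_overE:
  assumes "alg_over d \<pi> E h" "\<And>e. e \<in> E \<Longrightarrow> length (\<pi> e) = d"
  obtains m a where "m > 0" "\<And>i. poly_fun d (a i)" "\<exists>w\<in>Rn d. a m w \<noteq> 0"
    "\<And>e. e \<in> E \<Longrightarrow> (\<Sum>i\<le>m. a i (\<pi> e) * h e ^ i) = 0"
proof -
  obtain m a where a: "\<forall>i. poly_fun d (a i)" "\<exists>i\<le>m. \<exists>w\<in>Rn d. a i w \<noteq> 0"
    "\<forall>e\<in>E. (\<Sum>i\<le>m. a i (\<pi> e) * h e ^ i) = 0" using assms(1) unfolding alg_over_def by blast
  \<comment> \<open>The relation multiplied by \<open>h e\<close>, which makes the degree positive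
    even if the given relation involves \<open>\<pi> e\<close> alone.\<close>
  define b where "b i = (if i = 0 then (\<lambda>w. 0) else a (i - 1))" for i
  define K where "K = {i. i \<le> Suc m \<and> (\<exists>w\<in>Rn d. b i w \<noteq> 0)}"
  obtain i w where "i \<le> m" "w \<in> Rn d" "a i w \<noteq> 0" using a(2) by blast
  then have iK: "Suc i \<in> K" by (auto simp: K_def b_def)
  have fin: "finite K" by (auto simp: K_def)
  define k where "k = Max K"
  have k: "k \<in> K" unfolding k_def using iK fin by (intro Max_in) auto
  have k0: "k > 0" using Max_ge[OF fin iK] by (simp add: k_def)
  show thesis
  proof
    show "k > 0" by (rule k0)
    show "poly_fun d (b i)" for i using a(1) by (auto simp: b_def intro: poly_fun_intros)
    show "\<exists>w\<in>Rn d. b k w \<noteq> 0" using k by (auto simp: K_def)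
    fix e assume e: "e \<in> E"
    have "(\<Sum>i\<le>k. b i (\<pi> e) * h e ^ i) = (\<Sum>i\<le>Suc m. b i (\<pi> e) * h e ^ i)"
    proof (rule sum.mono_neutral_left)
      show "\<forall>i\<in>{..Suc m} - {..k}. b i (\<pi> e) * h e ^ i = 0"
      proof
        fix i assume i: "i \<in> {..Suc m} - {..k}"
        then have "i \<notin> K" using Max_ge[OF fin, of i] by (auto simp: k_def)
        then show "b i (\<pi> e) * h e ^ i = 0" using i assms(2)[OF e] by (auto simp: K_def)
      qed
    qed (use k in \<open>auto simp: K_def\<close>)
    also have "\<dots> = h e * (\<Sum>i\<le>m. a i (\<pi> e) * h e ^ i)"
      by (subst sum.atMost_Suc_shift) (simp add: b_def sum_distrib_left mult_ac)
    finally show "(\<Sum>i\<le>k. b i (\<pi> e) * h e ^ i) = 0" using a(3) e by simp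
  qed
qed

text \<open>Splitting off the largest possible power of \<open>h\<close> leaves a constant term that
  is not the zero polynomial. Where \<open>h ^ k\<close> can be cancelled, \<open>h\<close> divides
  \<open>a 0 (\<pi> e)\<close>, a substitute for its norm.\<close>

lemma alg_over_factor:
  assumes "alg_over d \<pi> E h" "\<And>e. e \<in> E \<Longrightarrow> length (\<pi> e) = d"
  obtains k m a where "\<And>i. poly_fun d (a i)" "\<exists>w\<in>Rn d. a 0 w \<noteq> 0"
    "\<And>e. e \<in> E \<Longrightarrow> h e ^ k * (a 0 (\<pi> e) + h e * (\<Sum>i<m. a (Suc i) (\<pi> e) * h e ^ i)) = 0"
proof -
  obtain m a where a: "\<forall>i. poly_fun d (a i)" "\<exists>i\<le>m. \<exists>w\<in>Rn d. a i w \<noteq> 0"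
    "\<forall>e\<in>E. (\<Sum>i\<le>m. a i (\<pi> e) * h e ^ i) = 0" using assms(1) unfolding alg_over_def by blast
  define k where "k = (LEAST i. \<exists>w\<in>Rn d. a i w \<noteq> 0)"
  obtain i where i: "i \<le> m" "\<exists>w\<in>Rn d. a i w \<noteq> 0" using a(2) by blast
  have k: "\<exists>w\<in>Rn d. a k w \<noteq> 0" unfolding k_def by (rule LeastI[of "\<lambda>i. \<exists>w\<in>Rn d. a i w \<noteq> 0"]) (rule i(2))
  have "k \<le> i" unfolding k_def by (rule Least_le[of "\<lambda>i. \<exists>w\<in>Rn d. a i w \<noteq> 0"]) (rule i(2))
  then have "k \<le> m" using i(1) by simp
  then obtain l where l: "m = k + l" using le_Suc_ex by blast
  show thesis
  proof
    show "poly_fun d (a (i + k))" for i using a(1) by blast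
    show "\<exists>w\<in>Rn d. a (0 + k) w \<noteq> 0" using k by simp
    fix e assume e: "e \<in> E"
    have z: "a i (\<pi> e) = 0" if "i < k" for i
      using not_less_Least[of i "\<lambda>i. \<exists>w\<in>Rn d. a i w \<noteq> 0"] that assms(2)[OF e] by (auto simp: k_def)
    have "0 = (\<Sum>i\<le>k + l. a i (\<pi> e) * h e ^ i)" using a(3) e l by simp
    also have "\<dots> = (\<Sum>i\<in>{k..k + l}. a i (\<pi> e) * h e ^ i)"
      by (rule sum.mono_neutral_right) (auto simp: z)
    also have "\<dots> = (\<Sum>i\<le>l. a (i + k) (\<pi> e) * h e ^ (i + k))"
      by (rule sum.reindex_bij_witness[of _ "\<lambda>i. i + k" "\<lambda>i. i - k"]) auto
    also have "\<dots> = h e ^ k * (\<Sum>i\<le>l. a (i + k) (\<pi> e) * h e ^ i)"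
      by (simp add: sum_distrib_left power_add mult_ac)
    also have "(\<Sum>i\<le>l. a (i + k) (\<pi> e) * h e ^ i) = a (0 + k) (\<pi> e) + h e * (\<Sum>i<l. a (Suc i + k) (\<pi> e) * h e ^ i)"
      by (simp add: lessThan_Suc_atMost[symmetric] sum.lessThan_Suc_shift sum_distrib_left mult_ac del: sum.lessThan_Suc)
    finally show "h e ^ k * (a (0 + k) (\<pi> e) + h e * (\<Sum>i<l. a (Suc i + k) (\<pi> e) * h e ^ i)) = 0" by simp
  qed
qed

section \<open>Finitely generated modules over the polynomials in a projection\<close>

definition span_over :: "nat \<Rightarrow> ('a \<Rightarrow> real list) \<Rightarrow> 'a set \<Rightarrow> 'j set \<Rightarrow> ('j \<Rightarrow> 'a \<Rightarrow> real) \<Rightarrow> ('a \<Rightarrow> real) \<Rightarrow> bool" where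
  "span_over d \<pi> E J F g \<longleftrightarrow> (\<exists>b. (\<forall>j. poly_fun d (b j)) \<and> (\<forall>e\<in>E. g e = (\<Sum>j\<in>J. b j (\<pi> e) * F j e)))"

lemma span_over_add:
  assumes "span_over d \<pi> E J F g" "span_over d \<pi> E J F h"
  shows "span_over d \<pi> E J F (\<lambda>e. g e + h e)"
proof -
  obtain b where "\<forall>j. poly_fun d (b j)" "\<forall>e\<in>E. g e = (\<Sum>j\<in>J. b j (\<pi> e) * F j e)"
    using assms(1) unfolding span_over_def by blast
  moreover obtain b' where "\<forall>j. poly_fun d (b' j)" "\<forall>e\<in>E. h e = (\<Sum>j\<in>J. b' j (\<pi> e) * F j e)"
    using assms(2) unfolding span_over_def by blast
  ultimately show ?thesis unfolding span_over_def
    by (intro exI[of _ "\<lambda>j w. b j w + b' j w"]) (auto intro: poly_fun_intros simp: sum.distrib ring_distribs)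
qed

lemma span_over_scale:
  assumes "poly_fun d l" "span_over d \<pi> E J F g"
  shows "span_over d \<pi> E J F (\<lambda>e. l (\<pi> e) * g e)"
proof -
  obtain b where "\<forall>j. poly_fun d (b j)" "\<forall>e\<in>E. g e = (\<Sum>j\<in>J. b j (\<pi> e) * F j e)"
    using assms(2) unfolding span_over_def by blast
  then show ?thesis unfolding span_over_def using assms(1)
    by (intro exI[of _ "\<lambda>j w. l w * b j w"]) (auto intro: poly_fun_intros simp: sum_distrib_left mult_ac)
qed

lemma span_over_sum:
  assumes "\<And>i. i \<in> I \<Longrightarrow> span_over d \<pi> E J F (g i)"
  shows "span_over d \<pi> E J F (\<lambda>e. \<Sum>i\<in>I. g i e)"
proof -
  have "span_over d \<pi> E J F (\<lambda>e. 0)" unfolding span_over_def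
    by (intro exI[of _ "\<lambda>_ _. 0"]) (auto intro: poly_fun_intros)
  then show ?thesis using assms
    by (induction I rule: infinite_finite_induct) (auto intro: span_over_add)
qed

lemma span_over_gen:
  assumes "finite J" "j \<in> J" shows "span_over d \<pi> E J F (F j)"
proof -
  have "(\<Sum>i\<in>J. (if i = j then 1 else 0) * F i e) = (\<Sum>i\<in>J. if i = j then F i e else 0)" for e
    by (rule sum.cong) auto
  then show ?thesis unfolding span_over_def using assms
    by (intro exI[of _ "\<lambda>i w. if i = j then 1 else 0"]) (auto intro: poly_fun_intros)
qed

lemma span_over_cong:
  "span_over d \<pi> E J F g \<Longrightarrow> (\<And>e. e \<in> E \<Longrightarrow> g e = h e) \<Longrightarrow> span_over d \<pi> E J F h"
  unfolding span_over_def by simp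

lemma span_over_mult:
  assumes "\<And>j. j \<in> J \<Longrightarrow> span_over d \<pi> E J F (\<lambda>e. h e * F j e)" "span_over d \<pi> E J F g"
  shows "span_over d \<pi> E J F (\<lambda>e. h e * g e)"
proof -
  obtain b where b: "\<forall>j. poly_fun d (b j)" "\<forall>e\<in>E. g e = (\<Sum>j\<in>J. b j (\<pi> e) * F j e)"
    using assms(2) unfolding span_over_def by blast
  have "span_over d \<pi> E J F (\<lambda>e. \<Sum>j\<in>J. b j (\<pi> e) * (h e * F j e))"
    using b(1) assms(1) by (intro span_over_sum span_over_scale) auto
  then show ?thesis by (rule span_over_cong) (simp add: b(2) sum_distrib_left mult_ac)
qed

text \<open>The integrality argument: the module contains all powers of \<open>l * h\<close>, and
  \<open>card J\<close> generators force a relation among the first \<open>card J + 1\<close> of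
  them. The factor \<open>l\<close> clears denominators.\<close>

lemma alg_over_span:
  assumes "finite J" "span_over d \<pi> E J F (\<lambda>e. 1)" "poly_fun d l" "\<exists>w\<in>Rn d. l w \<noteq> 0"
    and "\<And>j. j \<in> J \<Longrightarrow> span_over d \<pi> E J F (\<lambda>e. (l (\<pi> e) * h e) * F j e)"
    and "\<And>e. e \<in> E \<Longrightarrow> length (\<pi> e) = d"
  shows "alg_over d \<pi> E h"
proof -
  have "span_over d \<pi> E J F (\<lambda>e. (l (\<pi> e) * h e) ^ i)" for i
    by (induction i) (use assms(2) span_over_mult[OF assms(5)] in auto)
  then have "\<forall>i. \<exists>b. (\<forall>j. poly_fun d (b j)) \<and> (\<forall>e\<in>E. (l (\<pi> e) * h e) ^ i = (\<Sum>j\<in>J. b j (\<pi> e) * F j e))"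
    unfolding span_over_def by blast
  from choice[OF this] obtain b where b: "\<And>i j. poly_fun d (b i j)"
    "\<And>i e. e \<in> E \<Longrightarrow> (l (\<pi> e) * h e) ^ i = (\<Sum>j\<in>J. b i j (\<pi> e) * F j e)" by blast
  have "\<exists>v. (\<forall>i\<in>{..card J}. poly_fun d (v i)) \<and> (\<exists>i\<in>{..card J}. \<exists>w\<in>Rn d. v i w \<noteq> 0) \<and>
    (\<forall>j\<in>J. \<forall>w\<in>Rn d. (\<Sum>i\<in>{..card J}. b i j w * v i w) = 0)"
    by (rule poly_kernel_exists) (use assms(1) b(1) in auto)
  then obtain v where v: "\<forall>i\<in>{..card J}. poly_fun d (v i)" "\<exists>i\<in>{..card J}. \<exists>w\<in>Rn d. v i w \<noteq> 0"
    "\<forall>j\<in>J. \<forall>w\<in>Rn d. (\<Sum>i\<in>{..card J}. b i j w * v i w) = 0" by blast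
  \<comment> \<open>Absorbing \<open>l w ^ i\<close> turns the relation for \<open>l * h\<close>
    into one for \<open>h\<close>.\<close>
  define a where "a i w = (if i \<le> card J then v i w * l w ^ i else 0)" for i w
  have "poly_fun d (a i)" for i
    unfolding a_def using v(1) assms(3) by (cases "i \<le> card J") (auto intro!: poly_fun_intros)
  moreover have "\<exists>i\<le>card J. \<exists>w\<in>Rn d. a i w \<noteq> 0"
  proof -
    obtain i where i: "i \<le> card J" "\<exists>w\<in>Rn d. v i w \<noteq> 0" using v(2) by auto
    moreover have "poly_fun d (v i)" using v(1) i by auto
    moreover have "\<exists>w\<in>Rn d. l w ^ i \<noteq> 0" using assms(4) by auto
    ultimately have "\<exists>w\<in>Rn d. v i w * l w ^ i \<noteq> 0"
      using poly_fun_mult_nonzero[OF _ poly_fun_power[OF assms(3)]] by blast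
    then show ?thesis using i by (auto simp: a_def)
  qed
  moreover have "(\<Sum>i\<le>card J. a i (\<pi> e) * h e ^ i) = 0" if e: "e \<in> E" for e
  proof -
    have "(\<Sum>i\<le>card J. a i (\<pi> e) * h e ^ i) = (\<Sum>i\<le>card J. v i (\<pi> e) * (\<Sum>j\<in>J. b i j (\<pi> e) * F j e))"
      by (rule sum.cong) (auto simp: a_def b(2)[OF e, symmetric] power_mult_distrib)
    also have "\<dots> = (\<Sum>j\<in>J. F j e * (\<Sum>i\<le>card J. b i j (\<pi> e) * v i (\<pi> e)))"
      by (simp add: sum_distrib_left) (subst sum.swap, simp add: mult_ac)
    also have "\<dots> = 0" using v(3) assms(6)[OF e] by simp
    finally show ?thesis .
  qed
  ultimately show ?thesis unfolding alg_over_def by blast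
qed

text \<open>Stability under \<open>a m * u\<close>: the next power is again among the given ones, or
  it is the top power and the relation for \<open>u\<close> rewrites it.\<close>

lemma span_over_power_shift:
  assumes a: "\<And>i. poly_fun d (a i)" "\<And>e. e \<in> E \<Longrightarrow> (\<Sum>i\<le>m. a i (\<pi> e) * u e ^ i) = 0"
    and F: "\<And>i. i < m \<Longrightarrow> span_over d \<pi> E J F (\<lambda>e. u e ^ i * g e)" and "i < m"
  shows "span_over d \<pi> E J F (\<lambda>e. (a m (\<pi> e) * u e) * (u e ^ i * g e))"
proof (cases "Suc i < m")
  case True
  have "span_over d \<pi> E J F (\<lambda>e. a m (\<pi> e) * (u e ^ Suc i * g e))"
    by (intro span_over_scale F a True)
  then show ?thesis by (rule span_over_cong) simp
next
  case False
  then have m: "m = Suc i" using \<open>i < m\<close> by simp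
  have "span_over d \<pi> E J F (\<lambda>e. \<Sum>l<m. (- a l (\<pi> e)) * (u e ^ l * g e))"
    using F a by (intro span_over_sum span_over_scale[of d "\<lambda>w. - a _ w"] poly_fun_intros) auto
  then show ?thesis
  proof (rule span_over_cong)
    fix e assume "e \<in> E"
    then have "(\<Sum>l<m. a l (\<pi> e) * u e ^ l) = - a m (\<pi> e) * u e ^ m"
      using a(2)[of e] by (simp add: lessThan_Suc_atMost[symmetric])
    moreover have "(\<Sum>l<m. (- a l (\<pi> e)) * (u e ^ l * g e)) = - (\<Sum>l<m. a l (\<pi> e) * u e ^ l) * g e"
      by (simp add: sum_distrib_left sum_distrib_right sum_negf mult_ac)
    ultimately show "(\<Sum>l<m. (- a l (\<pi> e)) * (u e ^ l * g e)) = (a m (\<pi> e) * u e) * (u e ^ i * g e)"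
      by (simp add: m)
  qed
qed

text \<open>The products \<open>u ^ i * v ^ j\<close> with exponents below the two degrees span a
  module that is stable under \<open>u\<close> and \<open>v\<close> up to the leading coefficients;
  the product of these serves as \<open>l\<close>.\<close>

lemma alg_over_add_mult:
  assumes u: "alg_over d \<pi> E u" and v: "alg_over d \<pi> E v" and \<pi>: "\<And>e. e \<in> E \<Longrightarrow> length (\<pi> e) = d"
  shows "alg_over d \<pi> E (\<lambda>e. u e + v e)" "alg_over d \<pi> E (\<lambda>e. u e * v e)"
proof -
  obtain m a where a: "m > 0" "\<And>i. poly_fun d (a i)" "\<exists>w\<in>Rn d. a m w \<noteq> 0"
    "\<And>e. e \<in> E \<Longrightarrow> (\<Sum>i\<le>m. a i (\<pi> e) * u e ^ i) = 0" using alg_overE[OF u \<pi>] by blast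
  obtain n b where b: "n > 0" "\<And>i. poly_fun d (b i)" "\<exists>w\<in>Rn d. b n w \<noteq> 0"
    "\<And>e. e \<in> E \<Longrightarrow> (\<Sum>i\<le>n. b i (\<pi> e) * v e ^ i) = 0" using alg_overE[OF v \<pi>] by blast
  define J where "J = {..<m} \<times> {..<n}"
  define F where "F = (\<lambda>(i,j) e. u e ^ i * v e ^ j)"
  have fin: "finite J" by (simp add: J_def)
  note gen = span_over_gen[OF fin, of _ d \<pi> E F]
  have U: "span_over d \<pi> E J F (\<lambda>e. (a m (\<pi> e) * u e) * F j e)" if j: "j \<in> J" for j
  proof -
    obtain i k where ik: "j = (i, k)" "i < m" "k < n" using j by (auto simp: J_def)
    have "span_over d \<pi> E J F (\<lambda>e. u e ^ i * v e ^ k)" if "i < m" for i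
      using gen[of "(i, k)"] that ik(3) by (simp add: J_def F_def)
    from span_over_power_shift[OF a(2,4) this ik(2)] show ?thesis by (simp add: ik(1) F_def)
  qed
  have V: "span_over d \<pi> E J F (\<lambda>e. (b n (\<pi> e) * v e) * F j e)" if j: "j \<in> J" for j
  proof -
    obtain i k where ik: "j = (i, k)" "i < m" "k < n" using j by (auto simp: J_def)
    have "span_over d \<pi> E J F (\<lambda>e. v e ^ k * u e ^ i)" if "k < n" for k
      using gen[of "(i, k)"] that ik(2) by (simp add: J_def F_def mult.commute)
    from span_over_power_shift[OF b(2,4) this ik(3)] show ?thesis
      by (simp add: ik(1) F_def mult.commute[of "u _ ^ i"])
  qed
  have one: "span_over d \<pi> E J F (\<lambda>e. 1)"
    using gen[of "(0,0)"] a(1) b(1) by (auto simp: J_def F_def)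
  define l where "l w = a m w * b n w" for w
  have l: "poly_fun d l" "\<exists>w\<in>Rn d. l w \<noteq> 0"
    using a b poly_fun_mult_nonzero[of d "a m" "b n"] by (auto simp: l_def[abs_def] intro: poly_fun_intros)
  have "span_over d \<pi> E J F (\<lambda>e. (l (\<pi> e) * (u e * v e)) * F j e)" if j: "j \<in> J" for j
    by (rule span_over_cong[OF span_over_mult[OF U V[OF j]]]) (simp_all add: l_def mult_ac)
  then show "alg_over d \<pi> E (\<lambda>e. u e * v e)"
    by (intro alg_over_span[OF fin one l]) (auto simp: \<pi>)
  have "span_over d \<pi> E J F (\<lambda>e. (l (\<pi> e) * (u e + v e)) * F j e)" if j: "j \<in> J" for j
  proof -
    have "span_over d \<pi> E J F (\<lambda>e. b n (\<pi> e) * ((a m (\<pi> e) * u e) * F j e) + a m (\<pi> e) * ((b n (\<pi> e) * v e) * F j e))"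
      using a b by (intro span_over_add span_over_scale U V j) auto
    then show ?thesis by (rule span_over_cong) (simp add: l_def algebra_simps)
  qed
  then show "alg_over d \<pi> E (\<lambda>e. u e + v e)"
    by (intro alg_over_span[OF fin one l]) (auto simp: \<pi>)
qed

lemma alg_over_const: "alg_over d \<pi> E (\<lambda>e. c)"
  unfolding alg_over_def
  by (intro exI[of _ 1] exI[of _ "\<lambda>i w. if i = 1 then 1 else - c"])
     (auto intro!: poly_fun_intros exI[of _ 1] exI[of _ "replicate d 0"])

lemma alg_over_poly:
  assumes "poly_fun N g" "\<And>j. j < N \<Longrightarrow> alg_over d \<pi> E (\<lambda>z. z ! j)" "\<And>e. e \<in> E \<Longrightarrow> length (\<pi> e) = d"
  shows "alg_over d \<pi> E g"
  using assms(1) by induction (auto intro: alg_over_const alg_over_add_mult assms(2,3))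

text \<open>Irreducibility cancels the power of \<open>g\<close> left in
  \<open>alg_over_factor\<close>. The result carries non-vanishing from \<open>E\<close> down to the
  coordinate space, with \<open>a\<close> in the role of the norm of \<open>g\<close>.\<close>

lemma zar_irred_norm:
  assumes "zar_irred N E" "set L \<subseteq> {..<N}" "\<And>j. j < N \<Longrightarrow> alg_over (length L) (sel L) E (\<lambda>z. z ! j)"
    and g: "poly_fun N g" "\<exists>z\<in>E. g z \<noteq> 0"
  obtains B a where "poly_fun N B" "poly_fun (length L) a" "\<exists>w\<in>Rn (length L). a w \<noteq> 0"
    "\<And>z. z \<in> E \<Longrightarrow> B z * g z = a (sel L z)"
proof -
  have "alg_over (length L) (sel L) E g" by (rule alg_over_poly[OF g(1) assms(3)]) auto
  then obtain k m a where a: "\<And>i. poly_fun (length L) (a i)" "\<exists>w\<in>Rn (length L). a 0 w \<noteq> 0"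
    "\<And>e. e \<in> E \<Longrightarrow> g e ^ k * (a 0 (sel L e) + g e * (\<Sum>i<m. a (Suc i) (sel L e) * g e ^ i)) = 0"
    by (rule alg_over_factor) auto
  define R where "R e = (\<Sum>i<m. a (Suc i) (sel L e) * g e ^ i)" for e
  have pR: "poly_fun N R" unfolding R_def using g(1) assms(2) a(1) by (intro poly_fun_intros poly_fun_sel) auto
  have 0: "a 0 (sel L e) + g e * R e = 0" if "e \<in> E" for e
  proof -
    obtain z where "z \<in> E" "g z ^ k \<noteq> 0" using g(2) by auto
    moreover have "poly_fun N (\<lambda>e. a 0 (sel L e) + g e * R e)"
      using g(1) assms(2) a(1) pR by (intro poly_fun_intros poly_fun_sel) auto
    ultimately show ?thesis
      using zar_irredD[OF assms(1) poly_fun_power[OF g(1)], of "\<lambda>e. a 0 (sel L e) + g e * R e" z k e] a(3) that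
      by (auto simp: R_def)
  qed
  show thesis
  proof (rule that)
    show "poly_fun N (\<lambda>z. - R z)" using pR by (rule poly_fun_uminus)
    show "poly_fun (length L) (a 0)" "\<exists>w\<in>Rn (length L). a 0 w \<noteq> 0" using a by blast+
    show "- R z * g z = a 0 (sel L z)" if "z \<in> E" for z using 0[OF that] by (simp add: mult.commute)
  qed
qed

lemma alg_over_relation:
  assumes "poly_fun (Suc d) a" "w \<in> Rn (Suc d)" "a w \<noteq> 0"
    and "\<And>e. e \<in> E \<Longrightarrow> a (\<pi> e @ [h e]) = 0" "\<And>e. e \<in> E \<Longrightarrow> length (\<pi> e) = d"
  shows "alg_over d \<pi> E h"
proof -
  obtain m b where b: "\<And>i. poly_fun d (b i)" "\<And>i x. i \<ge> m \<Longrightarrow> b i x = 0"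
    "\<And>x y. length x = d \<Longrightarrow> a (x @ [y]) = (\<Sum>i<m. b i x * y ^ i)"
    by (rule poly_fun_Suc_expand[OF assms(1)]) blast
  obtain x y where xy: "w = x @ [y]" "length x = d" using assms(2) by (auto elim: length_SucE)
  have "\<exists>i<m. b i x \<noteq> 0"
  proof (rule ccontr)
    assume "\<not> (\<exists>i<m. b i x \<noteq> 0)"
    then show False using b(3)[OF xy(2), of y] xy assms(3) by simp
  qed
  then have "\<exists>i\<le>m. \<exists>w\<in>Rn d. b i w \<noteq> 0" using xy by (metis Rn_iff less_imp_le)
  moreover have "(\<Sum>i\<le>m. b i (\<pi> e) * h e ^ i) = 0" if "e \<in> E" for e
    using assms(4)[OF that] b(2)[of m] b(3)[OF assms(5)[OF that], of "h e"]
    by (simp add: lessThan_Suc_atMost[symmetric])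
  ultimately show ?thesis using b(1) unfolding alg_over_def by blast
qed

section \<open>Algebraic independence of coordinates\<close>

definition indep_on :: "nat \<Rightarrow> ('a \<Rightarrow> real list) \<Rightarrow> 'a set \<Rightarrow> bool" where
  "indep_on d \<pi> E \<longleftrightarrow> (\<forall>a. poly_fun d a \<longrightarrow> (\<forall>e\<in>E. a (\<pi> e) = 0) \<longrightarrow> (\<forall>w\<in>Rn d. a w = 0))"

lemma indep_on_distinct:
  assumes "indep_on (length L) (sel L) E" shows "distinct L"
proof (rule ccontr)
  assume "\<not> distinct L"
  then obtain i j where ij: "i < length L" "j < length L" "i \<noteq> j" "L ! i = L ! j" by (auto simp: distinct_conv_nth)
  have "poly_fun (length L) (\<lambda>w. w ! i - w ! j)" using ij by (auto intro: poly_fun_intros)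
  moreover have "\<forall>e\<in>E. sel L e ! i - sel L e ! j = 0" using ij by (simp add: sel_def)
  ultimately have "\<forall>w\<in>Rn (length L). w ! i - w ! j = 0" using assms unfolding indep_on_def by blast
  from bspec[OF this, of "(replicate (length L) 0)[i := 1]"] show False using ij by simp
qed

text \<open>An independent list of maximal length; independence forces distinct indices, so lengths
  are at most \<open>n\<close>. The dependence of \<open>L @ [j]\<close> is the relation for
  coordinate \<open>j\<close>.\<close>

lemma transcendence_basis:
  assumes "V \<noteq> {}"
  obtains L where "set L \<subseteq> {..<n}" "indep_on (length L) (sel L) V"
    "\<And>j. j < n \<Longrightarrow> alg_over (length L) (sel L) V (\<lambda>x. x ! j)"
proof -
  define P where "P L \<longleftrightarrow> set L \<subseteq> {..<n} \<and> indep_on (length L) (sel L) V" for L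
  have "P []" using assms by (auto simp: P_def indep_on_def sel_def)
  moreover have "length L \<le> n" if "P L" for L
    using that indep_on_distinct[of L V] card_mono[of "{..<n}" "set L"] distinct_card[of L] by (auto simp: P_def)
  ultimately have "\<exists>L. P L \<and> (\<forall>L'. P L' \<longrightarrow> length L' \<le> length L)"
    by (intro ex_has_greatest_nat[of P "[]" length "Suc n"]) (auto simp: less_Suc_eq_le)
  then obtain L where L: "P L" "\<And>L'. P L' \<Longrightarrow> length L' \<le> length L" by blast
  have "alg_over (length L) (sel L) V (\<lambda>x. x ! j)" if "j < n" for j
  proof -
    have "\<not> P (L @ [j])" using L(2)[of "L @ [j]"] by auto
    then have "\<not> indep_on (Suc (length L)) (sel (L @ [j])) V" using L(1) that by (auto simp: P_def)
    then obtain a w where "poly_fun (Suc (length L)) a" "w \<in> Rn (Suc (length L))" "a w \<noteq> 0"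
      "\<forall>e\<in>V. a (sel (L @ [j]) e) = 0" unfolding indep_on_def by blast
    then show ?thesis by (intro alg_over_relation[of _ a w]) (auto simp: sel_def)
  qed
  then show thesis using that L(1) by (auto simp: P_def)
qed

section \<open>Semialgebraic sets through sign conditions\<close>

lemma semialg_signs:
  assumes "semialg n S"
  shows "S \<subseteq> Rn n \<and> (\<exists>Q. finite Q \<and> (\<forall>q\<in>Q. poly_fun n q) \<and>
    (\<forall>x\<in>Rn n. \<forall>y\<in>Rn n. (\<forall>q\<in>Q. sgn (q x) = sgn (q y)) \<longrightarrow> (x \<in> S \<longleftrightarrow> y \<in> S)))"
  using assms
proof induction
  case (sa_eq p)
  then show ?case by (intro conjI exI[of _ "{p}"]) (auto simp: sgn_if split: if_splits)
next
  case (sa_pos p)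
  then show ?case by (intro conjI exI[of _ "{p}"]) (auto simp: sgn_if split: if_splits)
next
  case (sa_union A B)
  obtain Q where Q: "finite Q" "\<forall>q\<in>Q. poly_fun n q"
    "\<forall>x\<in>Rn n. \<forall>y\<in>Rn n. (\<forall>q\<in>Q. sgn (q x) = sgn (q y)) \<longrightarrow> (x \<in> A \<longleftrightarrow> y \<in> A)"
    using sa_union.IH(1) by blast
  obtain Q' where Q': "finite Q'" "\<forall>q\<in>Q'. poly_fun n q"
    "\<forall>x\<in>Rn n. \<forall>y\<in>Rn n. (\<forall>q\<in>Q'. sgn (q x) = sgn (q y)) \<longrightarrow> (x \<in> B \<longleftrightarrow> y \<in> B)"
    using sa_union.IH(2) by blast
  have "x \<in> A \<union> B \<longleftrightarrow> y \<in> A \<union> B"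
    if "x \<in> Rn n" "y \<in> Rn n" "\<forall>q\<in>Q \<union> Q'. sgn (q x) = sgn (q y)" for x y
    using Q(3)[rule_format, OF that(1,2)] Q'(3)[rule_format, OF that(1,2)] that(3) by simp
  then show ?case using sa_union.IH Q(1,2) Q'(1,2) by (intro conjI exI[of _ "Q \<union> Q'"]) (blast, simp, blast, blast)
next
  case (sa_inter A B)
  obtain Q where Q: "finite Q" "\<forall>q\<in>Q. poly_fun n q"
    "\<forall>x\<in>Rn n. \<forall>y\<in>Rn n. (\<forall>q\<in>Q. sgn (q x) = sgn (q y)) \<longrightarrow> (x \<in> A \<longleftrightarrow> y \<in> A)"
    using sa_inter.IH(1) by blast
  obtain Q' where Q': "finite Q'" "\<forall>q\<in>Q'. poly_fun n q"
    "\<forall>x\<in>Rn n. \<forall>y\<in>Rn n. (\<forall>q\<in>Q'. sgn (q x) = sgn (q y)) \<longrightarrow> (x \<in> B \<longleftrightarrow> y \<in> B)"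
    using sa_inter.IH(2) by blast
  have "x \<in> A \<inter> B \<longleftrightarrow> y \<in> A \<inter> B"
    if "x \<in> Rn n" "y \<in> Rn n" "\<forall>q\<in>Q \<union> Q'. sgn (q x) = sgn (q y)" for x y
    using Q(3)[rule_format, OF that(1,2)] Q'(3)[rule_format, OF that(1,2)] that(3) by simp
  then show ?case using sa_inter.IH Q(1,2) Q'(1,2) by (intro conjI exI[of _ "Q \<union> Q'"]) (blast, simp, blast, blast)
next
  case (sa_compl A)
  then show ?case by blast
qed

lemma semialg_alg_set: "alg_set n T \<Longrightarrow> semialg n T"
  by (elim alg_set_zeroE) (simp only: sa_eq)

lemma semialg_cylinder:
  assumes "semialg n A" shows "semialg (Suc n) {z\<in>Rn (Suc n). take n z \<in> A}"
  using assms
proof induction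
  case (sa_eq p)
  have "{z\<in>Rn (Suc n). take n z \<in> {x\<in>Rn n. p x = 0}} = {z\<in>Rn (Suc n). p (take n z) = 0}" by auto
  then show ?case using semialg.sa_eq[OF poly_fun_take[OF sa_eq, of "Suc n"]] by simp
next
  case (sa_pos p)
  have "{z\<in>Rn (Suc n). take n z \<in> {x\<in>Rn n. p x > 0}} = {z\<in>Rn (Suc n). p (take n z) > 0}" by auto
  then show ?case using semialg.sa_pos[OF poly_fun_take[OF sa_pos, of "Suc n"]] by simp
next
  case (sa_union A B)
  have "{z\<in>Rn (Suc n). take n z \<in> A \<union> B} = {z\<in>Rn (Suc n). take n z \<in> A} \<union> {z\<in>Rn (Suc n). take n z \<in> B}" by auto
  then show ?case using semialg.sa_union[OF sa_union.IH] by simp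
next
  case (sa_inter A B)
  have "{z\<in>Rn (Suc n). take n z \<in> A \<inter> B} = {z\<in>Rn (Suc n). take n z \<in> A} \<inter> {z\<in>Rn (Suc n). take n z \<in> B}" by auto
  then show ?case using semialg.sa_inter[OF sa_inter.IH] by simp
next
  case (sa_compl A)
  have "{z\<in>Rn (Suc n). take n z \<in> Rn n - A} = Rn (Suc n) - {z\<in>Rn (Suc n). take n z \<in> A}" by auto
  then show ?case using semialg.sa_compl[OF sa_compl.IH] by simp
qed

text \<open>Two polynomials that are each nonzero somewhere on the cylinder are so at a common
  height \<open>s\<close>, as each has finitely many bad heights. The claim then descends to the
  slice at that height, a copy of \<open>V\<close>.\<close>

lemma zar_irred_cylinder:
  assumes "zar_irred n V" shows "zar_irred (Suc n) {x @ [t] |x t. x \<in> V}" (is "zar_irred _ ?E")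
  unfolding zar_irred_def
proof (intro conjI allI impI)
  show "?E \<noteq> {}" using assms unfolding zar_irred_def by blast
  show "?E \<subseteq> Rn (Suc n)" using assms by (auto simp: zar_irred_def)
  fix p q assume pq: "poly_fun (Suc n) p" "poly_fun (Suc n) q" "\<forall>z\<in>?E. p z * q z = 0"
  show "(\<forall>z\<in>?E. p z = 0) \<or> (\<forall>z\<in>?E. q z = 0)"
  proof (rule ccontr)
    assume "\<not> ?thesis"
    then obtain x t x' t' where x: "x \<in> V" "p (x @ [t]) \<noteq> 0" "x' \<in> V" "q (x' @ [t']) \<noteq> 0" by blast
    have len: "length x = n" if "x \<in> V" for x using assms that by (auto simp: zar_irred_def)
    have "finite ({s. p (x @ [s]) = 0} \<union> {s. q (x' @ [s]) = 0})"
      using finite_zeros_last[OF pq(1) len x(2)] finite_zeros_last[OF pq(2) len x(4)] x by blast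
    then obtain s where "s \<notin> {s. p (x @ [s]) = 0} \<union> {s. q (x' @ [s]) = 0}"
      using ex_new_if_finite[OF infinite_UNIV_char_0[where 'a = real]] by blast
    then have s: "p (x @ [s]) \<noteq> 0" "q (x' @ [s]) \<noteq> 0" by auto
    obtain p' where p': "poly_fun n p'" "\<forall>x\<in>Rn n. p' x = p (x @ [s])"
      using poly_fun_append[of n 1 p "[s]"] pq(1) by auto
    obtain q' where q': "poly_fun n q'" "\<forall>x\<in>Rn n. q' x = q (x @ [s])"
      using poly_fun_append[of n 1 q "[s]"] pq(2) by auto
    have "p' y * q' y = 0" if "y \<in> V" for y using pq(3) that p' q' len by auto
    then have "q' x' = 0" using zar_irredD[OF assms p'(1) q'(1) x(1) _ _ x(3)] s p' len x by auto
    then show False using s q' len x by simp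
  qed
qed

text \<open>If no sign condition had a nontrivial zero at a point of the graph, the graph would contain a
  vertical segment; this is the only place where semialgebraicity yields algebraicity.\<close>
lemma graph_sign_zero:
  assumes Q: "finite Q" "\<And>q. q \<in> Q \<Longrightarrow> poly_fun (Suc n) q"
    and S: "\<And>z z'. length z = Suc n \<Longrightarrow> length z' = Suc n \<Longrightarrow> (\<And>q. q \<in> Q \<Longrightarrow> sgn (q z) = sgn (q z')) \<Longrightarrow> z \<in> S \<Longrightarrow> z' \<in> S"
    and "length x = n" "x @ [y] \<in> S" "\<And>t. x @ [t] \<in> S \<Longrightarrow> t = y"
  shows "\<exists>q\<in>Q. q (x @ [y]) = 0 \<and> (\<exists>t. q (x @ [t]) \<noteq> 0)"
proof (rule ccontr)
  assume no: "\<not> ?thesis"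
  have "\<forall>\<^sub>F t in at y. sgn (q (x @ [t])) = sgn (q (x @ [y]))" if q: "q \<in> Q" for q
  proof (cases "q (x @ [y]) = 0")
    case True
    then show ?thesis using no q by auto
  next
    case False
    obtain r where r: "\<And>t. q (x @ [t]) = poly r t" using poly_fun_last_poly[OF Q(2)[OF q] assms(4)] by blast
    have "((\<lambda>t. sgn (poly r t)) \<longlongrightarrow> sgn (poly r y)) (at y)"
      using False r by (intro tendsto_sgn) (auto intro!: poly_isCont[unfolded isCont_def])
    then have "\<forall>\<^sub>F t in at y. dist (sgn (poly r t)) (sgn (poly r y)) < 1" by (rule tendstoD) simp
    \<comment> \<open>Two signs at distance less than 1 are equal.\<close>
    then show ?thesis unfolding r
      by eventually_elim (auto simp: sgn_if dist_real_def split: if_splits)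
  qed
  then have "\<forall>\<^sub>F t in at y. \<forall>q\<in>Q. sgn (q (x @ [t])) = sgn (q (x @ [y]))"
    using Q(1) by (simp add: eventually_ball_finite_distrib)
  moreover have "\<forall>\<^sub>F t in at y. t \<noteq> y" by (simp add: eventually_at_filter)
  ultimately have "\<forall>\<^sub>F t in at y. False"
  proof eventually_elim
    case (elim t)
    have "x @ [t] \<in> S" using S[of "x @ [y]" "x @ [t]"] elim(1) assms(4,5) by auto
    then show False using assms(6) elim(2) by blast
  qed
  then show False by simp
qed

text \<open>The product \<open>G\<close> of the sign polynomials that are nontrivial on the cylinder
  over \<open>V\<close> vanishes on \<open>S\<close>; its norm with respect to the coordinates
  \<open>L @ [n]\<close> is the desired relation.\<close>

lemma graph_last_alg:
  assumes V: "zar_irred n V" and L: "set L \<subseteq> {..<n}"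
    and alg: "\<And>j. j < n \<Longrightarrow> alg_over (length L) (sel L) V (\<lambda>x. x ! j)"
    and S: "semialg (Suc n) S" "S \<subseteq> {x @ [f x] |x. x \<in> V}"
  shows "alg_over (length L) (sel L) S (\<lambda>z. z ! n)"
proof -
  have len: "length x = n" if "x \<in> V" for x using V that by (auto simp: zar_irred_def)
  obtain Q where Q: "finite Q" "\<And>q. q \<in> Q \<Longrightarrow> poly_fun (Suc n) q"
    "\<forall>x\<in>Rn (Suc n). \<forall>y\<in>Rn (Suc n). (\<forall>q\<in>Q. sgn (q x) = sgn (q y)) \<longrightarrow> (x \<in> S \<longleftrightarrow> y \<in> S)"
    using semialg_signs[OF S(1)] by blast
  define E where "E = {x @ [t] |x t. x \<in> V}"
  have E: "zar_irred (Suc n) E" unfolding E_def by (rule zar_irred_cylinder[OF V])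
  \<comment> \<open>Polynomials vanishing on the whole cylinder are dropped. The one produced by
    \<open>graph_sign_zero\<close> always survives, being nonzero somewhere on its vertical
    line.\<close>
  define Q' where "Q' = {q\<in>Q. \<exists>z\<in>E. q z \<noteq> 0}"
  define G where "G z = (\<Prod>q\<in>Q'. q z)" for z
  have fin: "finite Q'" using Q by (simp add: Q'_def)
  have G: "poly_fun (Suc n) G" unfolding G_def using Q by (intro poly_fun_intros) (auto simp: Q'_def)
  have "\<exists>z\<in>E. \<forall>q\<in>Q'. q z \<noteq> 0" using Q by (intro zar_irred_prod[OF E fin]) (auto simp: Q'_def)
  then have G0: "\<exists>z\<in>E. G z \<noteq> 0" using fin by (auto simp: G_def)
  let ?L = "L @ [n]"
  have selE: "sel ?L (x @ [t]) = sel L x @ [t]" if "x \<in> V" for x t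
    using L len[OF that] by (auto simp: sel_def nth_append)
  \<comment> \<open>On the cylinder the last coordinate is a free variable, so \<open>n\<close>
    joins the list of independent coordinates.\<close>
  have "alg_over (length ?L) (sel ?L) E (\<lambda>z. z ! j)" if j: "j < Suc n" for j
  proof (cases "j = n")
    case True
    have "alg_over (Suc (length L)) (sel ?L) E (\<lambda>z. z ! n)"
      unfolding alg_over_def
      by (intro exI[of _ 1] exI[of _ "\<lambda>i w. if i = 1 then 1 else - (w ! length L)"])
         (auto intro!: poly_fun_intros poly_fun_if exI[of _ 1] exI[of _ "replicate (Suc (length L)) 0"] simp: sel_def nth_append)
    then show ?thesis using True by simp
  next
    case False
    then have "j < n" using j by simp
    then obtain m a where a: "\<forall>i. poly_fun (length L) (a i)" "\<exists>i\<le>m. \<exists>w\<in>Rn (length L). a i w \<noteq> 0"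
      "\<forall>x\<in>V. (\<Sum>i\<le>m. a i (sel L x) * (x ! j) ^ i) = 0" using alg unfolding alg_over_def by blast
    obtain i w where iw: "i \<le> m" "length w = length L" "a i w \<noteq> 0" using a(2) by auto
    have "\<forall>i. poly_fun (Suc (length L)) (\<lambda>w. a i (take (length L) w))"
      using a(1) by (auto intro: poly_fun_take)
    moreover have "\<exists>i\<le>m. \<exists>w\<in>Rn (Suc (length L)). a i (take (length L) w) \<noteq> 0"
      using iw by (intro exI[of _ i] conjI bexI[of _ "w @ [0]"]) auto
    moreover have "(\<Sum>i\<le>m. a i (take (length L) (sel ?L z)) * (z ! j) ^ i) = 0" if z: "z \<in> E" for z
    proof -
      obtain x t where "z = x @ [t]" "x \<in> V" using z by (auto simp: E_def)
      then show ?thesis using a(3) selE len \<open>j < n\<close> by (auto simp: nth_append)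
    qed
    ultimately show ?thesis unfolding alg_over_def
      by (intro exI[of _ m] exI[of _ "\<lambda>i w. a i (take (length L) w)"]) auto
  qed
  note alg' = this
  have L': "set ?L \<subseteq> {..<Suc n}" using L by auto
  obtain B a where Ba: "poly_fun (Suc n) B" "poly_fun (length ?L) a" "\<exists>w\<in>Rn (length ?L). a w \<noteq> 0"
    "\<And>z. z \<in> E \<Longrightarrow> B z * G z = a (sel ?L z)"
    by (rule zar_irred_norm[OF E L' alg' G G0]) (assumption, rule that)
  have "a (sel L z @ [z ! n]) = 0" if z: "z \<in> S" for z
  proof -
    obtain x where x: "z = x @ [f x]" "x \<in> V" using S(2) z by blast
    have "\<exists>q\<in>Q. q (x @ [f x]) = 0 \<and> (\<exists>t. q (x @ [t]) \<noteq> 0)"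
    proof (rule graph_sign_zero[OF Q(1,2) _ len[OF x(2)]])
      show "z' \<in> S" if "length z = Suc n" "length z' = Suc n" "\<And>q. q \<in> Q \<Longrightarrow> sgn (q z) = sgn (q z')" "z \<in> S" for z z'
        using Q(3)[rule_format, of z z'] that by simp
      show "x @ [f x] \<in> S" using z x by simp
      show "t = f x" if "x @ [t] \<in> S" for t
        using S(2) that by auto
    qed
    then have "\<exists>q\<in>Q'. q z = 0" using x by (auto simp: Q'_def E_def)
    then have "G z = 0" using fin by (auto simp: G_def)
    moreover have "z \<in> E" using x by (auto simp: E_def)
    ultimately have "a (sel ?L z) = 0" using Ba(4)[of z] by simp
    then show ?thesis by (simp add: sel_def)
  qed
  moreover obtain w where "w \<in> Rn (Suc (length L))" "a w \<noteq> 0" using Ba(3) by auto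
  ultimately show ?thesis
    using Ba(2) by (intro alg_over_relation[of _ a w]) auto
qed

section \<open>Asymptotics and implicit functions\<close>

text \<open>Lists carry no topology, so the neighbourhood filter of a point of R^n is generated by
  boxes. The centre is not removed.\<close>

definition near :: "nat \<Rightarrow> real list \<Rightarrow> real list filter" where
  "near n x = (INF \<delta>\<in>{0<..}. principal {y. length y = n \<and> (\<forall>i<n. \<bar>y ! i - x ! i\<bar> < \<delta>)})"

lemma eventually_near:
  "eventually P (near n x) \<longleftrightarrow>
    (\<exists>\<delta>>0. \<forall>y. length y = n \<longrightarrow> (\<forall>i<n. \<bar>y ! i - x ! i\<bar> < \<delta>) \<longrightarrow> P y)"
proof -
  have "eventually P (near n x) \<longleftrightarrow>
    (\<exists>\<delta>\<in>{0<..}. eventually P (principal {y. length y = n \<and> (\<forall>i<n. \<bar>y ! i - x ! i\<bar> < \<delta>)}))"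
    unfolding near_def
  proof (rule eventually_INF_base)
    fix a b :: real assume "a \<in> {0<..}" "b \<in> {0<..}"
    then show "\<exists>c\<in>{0<..}. principal {y. length y = n \<and> (\<forall>i<n. \<bar>y ! i - x ! i\<bar> < c)}
      \<le> inf (principal {y. length y = n \<and> (\<forall>i<n. \<bar>y ! i - x ! i\<bar> < a)})
          (principal {y. length y = n \<and> (\<forall>i<n. \<bar>y ! i - x ! i\<bar> < b)})"
      by (intro bexI[of _ "min a b"]) auto
  qed auto
  then show ?thesis by (auto simp: eventually_principal Bex_def)
qed

lemma eventually_near_length: "eventually (\<lambda>y. length y = n) (near n x)"
  unfolding eventually_near by (auto intro: exI[of _ 1])

lemma eventually_near_close: "\<epsilon> > 0 \<Longrightarrow> eventually (\<lambda>y. \<forall>i<n. \<bar>y ! i - x ! i\<bar> < \<epsilon>) (near n x)"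
  unfolding eventually_near by blast

lemma near_nth_tendsto: "i < n \<Longrightarrow> ((\<lambda>y. y ! i) \<longlongrightarrow> x ! i) (near n x)"
  by (rule tendstoI) (auto dest!: eventually_near_close[of _ n x] elim: eventually_mono simp: dist_real_def)

lemma poly_fun_tendsto:
  assumes "poly_fun n p" "\<And>i. i < n \<Longrightarrow> ((\<lambda>s. u s ! i) \<longlongrightarrow> x ! i) F"
  shows "((\<lambda>s. p (u s)) \<longlongrightarrow> p x) F"
  using assms(1) by induction (auto intro!: tendsto_intros assms(2))

lemma poly_fun_near: "poly_fun n p \<Longrightarrow> (p \<longlongrightarrow> p x) (near n x)"
  by (rule poly_fun_tendsto) (auto intro: near_nth_tendsto)

lemma sgn_near:
  assumes "poly_fun n q" "q x \<noteq> 0"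
  shows "eventually (\<lambda>y. sgn (q y) = sgn (q x)) (near n x)"
proof -
  have "((\<lambda>y. sgn (q y)) \<longlongrightarrow> sgn (q x)) (near n x)"
    using assms by (intro tendsto_sgn poly_fun_near) auto
  then have "eventually (\<lambda>y. dist (sgn (q y)) (sgn (q x)) < 1) (near n x)" by (rule tendstoD) simp
  then show ?thesis by eventually_elim (auto simp: sgn_if dist_real_def split: if_splits)
qed

section \<open>Orders of vanishing at the origin of R^d\<close>

abbreviation near0 :: "nat \<Rightarrow> real list filter" where
  "near0 d \<equiv> near d (replicate d 0)"

definition vadd :: "real list \<Rightarrow> real list \<Rightarrow> real list" where
  "vadd b w = map (\<lambda>i. b ! i + w ! i) [0..<length b]"

definition smul :: "real \<Rightarrow> real list \<Rightarrow> real list" where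
  "smul t w = map ((*) t) w"

definition nrm :: "real list \<Rightarrow> real" where
  "nrm w = (\<Sum>i<length w. \<bar>w ! i\<bar>)"

lemma length_vadd [simp]: "length (vadd b w) = length b"
  by (simp add: vadd_def)

lemma nth_vadd [simp]: "i < length b \<Longrightarrow> vadd b w ! i = b ! i + w ! i"
  by (simp add: vadd_def)

lemma vadd_0: "vadd b (replicate (length b) 0) = b"
  by (rule nth_equalityI) auto

lemma length_smul [simp]: "length (smul t w) = length w"
  by (simp add: smul_def)

lemma nth_smul [simp]: "i < length w \<Longrightarrow> smul t w ! i = t * w ! i"
  by (simp add: smul_def)

lemma nrm_nonneg [simp]: "nrm w \<ge> 0"
  by (simp add: nrm_def sum_nonneg)

lemma nrm_smul: "nrm (smul t w) = \<bar>t\<bar> * nrm w"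
  by (simp add: nrm_def abs_mult sum_distrib_left)

lemma nth_le_nrm: "i < length w \<Longrightarrow> \<bar>w ! i\<bar> \<le> nrm w"
  unfolding nrm_def by (rule member_le_sum) auto

lemma poly_fun_vadd: "poly_fun d p \<Longrightarrow> length b = d \<Longrightarrow> poly_fun d (\<lambda>w. p (vadd b w))"
  by (rule poly_fun_comp[of d _ d "\<lambda>i w. b ! i + w ! i"]) (auto intro: poly_fun_intros)

lemma nrm_tendsto: "(nrm \<longlongrightarrow> 0) (near0 d)"
proof -
  have "((\<lambda>w. \<Sum>i<d. \<bar>w ! i\<bar>) \<longlongrightarrow> (\<Sum>i<d. \<bar>replicate d 0 ! i\<bar>)) (near0 d)"
    by (intro tendsto_sum tendsto_rabs near_nth_tendsto) auto
  moreover have "eventually (\<lambda>w. (\<Sum>i<d. \<bar>w ! i\<bar>) = nrm w) (near0 d)"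
    using eventually_near_length[of d "replicate d 0"] by eventually_elim (simp add: nrm_def)
  ultimately show ?thesis by (simp add: tendsto_cong)
qed

lemma tendsto_bigo_1:
  fixes f :: "'a \<Rightarrow> real" assumes "(f \<longlongrightarrow> c) F" shows "f \<in> O[F](\<lambda>_. 1)"
proof (rule bigoI)
  have "eventually (\<lambda>x. dist (f x) c < 1) F" by (rule tendstoD[OF assms]) simp
  then show "eventually (\<lambda>x. norm (f x) \<le> (\<bar>c\<bar> + 1) * norm (1::real)) F"
    by eventually_elim (auto simp: dist_real_def)
qed

lemma poly_fun_bigo_1: "poly_fun d p \<Longrightarrow> p \<in> O[near0 d](\<lambda>_. 1)"
  by (rule tendsto_bigo_1[OF poly_fun_near])

lemma nth_bigo: "i < d \<Longrightarrow> (\<lambda>w. w ! i) \<in> O[near0 d](nrm)"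
  by (rule bigoI[of _ 1], rule eventually_mono[OF eventually_near_length]) (auto intro: nth_le_nrm)

lemma poly_fun_bigo:
  assumes "poly_fun d p" shows "(\<lambda>w. p w - p (replicate d 0)) \<in> O[near0 d](nrm)"
  using assms
proof induction
  case (pf_var i)
  then show ?case using nth_bigo by simp
next
  case (pf_add p q)
  then show ?case using sum_in_bigo(1)[OF pf_add.IH] by (simp add: algebra_simps)
next
  case (pf_mult p q)
  have "(\<lambda>w. (p w - p (replicate d 0)) * q w) \<in> O[near0 d](\<lambda>w. nrm w * 1)"
    by (intro landau_o.big.mult pf_mult.IH poly_fun_bigo_1 pf_mult.hyps)
  moreover have "(\<lambda>w. p (replicate d 0) * (q w - q (replicate d 0))) \<in> O[near0 d](\<lambda>w. nrm w)"
    by (cases "p (replicate d 0) = 0") (use pf_mult.IH in auto)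
  ultimately have "(\<lambda>w. (p w - p (replicate d 0)) * q w + p (replicate d 0) * (q w - q (replicate d 0))) \<in> O[near0 d](nrm)"
    by (intro sum_in_bigo) auto
  then show ?case by (simp add: algebra_simps)
qed simp

text \<open>Taylor approximations may be substituted into a polynomial. \<open>G\<close> is not
  truncated at degree \<open>K\<close>; only the order of the error is controlled.\<close>

lemma bigo_poly_compose:
  assumes "poly_fun N g" "\<And>j. j < N \<Longrightarrow> (\<lambda>w. \<gamma> w ! j - Y j w) \<in> O[near0 d](\<lambda>w. nrm w ^ K)"
    and Y: "\<And>j. j < N \<Longrightarrow> poly_fun d (Y j)"
  shows "\<exists>G. poly_fun d G \<and> (\<lambda>w. g (\<gamma> w) - G w) \<in> O[near0 d](\<lambda>w. nrm w ^ K)"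
  using assms(1)
proof induction
  case (pf_const c)
  then show ?case by (intro exI[of _ "\<lambda>_. c"]) (auto intro: poly_fun_intros)
next
  case (pf_var i)
  then show ?case using assms(2,3) by blast
next
  case (pf_add p q)
  obtain G where "poly_fun d G" "(\<lambda>w. p (\<gamma> w) - G w) \<in> O[near0 d](\<lambda>w. nrm w ^ K)" using pf_add.IH(1) by blast
  moreover obtain H where "poly_fun d H" "(\<lambda>w. q (\<gamma> w) - H w) \<in> O[near0 d](\<lambda>w. nrm w ^ K)" using pf_add.IH(2) by blast
  ultimately show ?case
    by (intro exI[of _ "\<lambda>w. G w + H w"]) (auto intro: poly_fun_intros dest: sum_in_bigo(1) simp: algebra_simps)
next
  case (pf_mult p q)
  have one: "(\<lambda>w. nrm w ^ K) \<in> O[near0 d](\<lambda>_. 1)"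
    by (rule tendsto_bigo_1[OF tendsto_power[OF nrm_tendsto]])
  obtain G where G: "poly_fun d G" "(\<lambda>w. p (\<gamma> w) - G w) \<in> O[near0 d](\<lambda>w. nrm w ^ K)" using pf_mult.IH(1) by blast
  obtain H where H: "poly_fun d H" "(\<lambda>w. q (\<gamma> w) - H w) \<in> O[near0 d](\<lambda>w. nrm w ^ K)" using pf_mult.IH(2) by blast
  have "(\<lambda>w. (q (\<gamma> w) - H w) + H w) \<in> O[near0 d](\<lambda>_. 1)"
    by (intro sum_in_bigo landau_o.big_trans[OF H(2) one] poly_fun_bigo_1 H)
  then have "(\<lambda>w. (p (\<gamma> w) - G w) * q (\<gamma> w)) \<in> O[near0 d](\<lambda>w. nrm w ^ K * 1)"
    by (intro landau_o.big.mult G) simp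
  moreover have "(\<lambda>w. G w * (q (\<gamma> w) - H w)) \<in> O[near0 d](\<lambda>w. 1 * nrm w ^ K)"
    by (intro landau_o.big.mult H poly_fun_bigo_1 G)
  ultimately have "(\<lambda>w. (p (\<gamma> w) - G w) * q (\<gamma> w) + G w * (q (\<gamma> w) - H w)) \<in> O[near0 d](\<lambda>w. nrm w ^ K)"
    by (intro sum_in_bigo) auto
  then show ?case using G(1) H(1)
    by (intro exI[of _ "\<lambda>w. G w * H w"]) (auto intro: poly_fun_intros simp: algebra_simps)
qed

text \<open>The sum on the right is the difference quotient, and at \<open>y = y'\<close> the
  derivative; hence the shape of the simple-root conditions below.\<close>

lemma sum_power_diff:
  fixes a :: "nat \<Rightarrow> real"
  shows "(\<Sum>i\<le>m. a i * y ^ i) - (\<Sum>i\<le>m. a i * y' ^ i) =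
    (y - y') * (\<Sum>i\<le>m. a i * (\<Sum>k<i. y' ^ (i - Suc k) * y ^ k))"
  by (simp add: sum_subtractf[symmetric] right_diff_distrib[symmetric] power_diff_sumr2 sum_distrib_left mult_ac)

text \<open>The approximations \<open>Y\<close> are the Newton iterates with frozen derivative \<open>\<beta>\<close>.\<close>
lemma implicit_root:
  fixes y0 \<epsilon> :: real
  assumes a: "\<And>i. poly_fun d (a i)" and b: "length b = d"
    and root: "(\<Sum>i\<le>m. a i b * y0 ^ i) = 0"
    and simple: "(\<Sum>i\<le>m. a i b * (\<Sum>k<i. y0 ^ (i - Suc k) * y0 ^ k)) \<noteq> 0" and "\<epsilon> > 0"
  shows "\<exists>\<xi>. eventually (\<lambda>w. \<bar>\<xi> w - y0\<bar> < \<epsilon> \<and> (\<Sum>i\<le>m. a i (vadd b w) * \<xi> w ^ i) = 0) (near0 d) \<and>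
    (\<forall>K. \<exists>Y. poly_fun d Y \<and> (\<lambda>w. \<xi> w - Y w) \<in> O[near0 d](\<lambda>w. nrm w ^ K))"
proof -
  define g where "g w y = (\<Sum>i\<le>m. a i (vadd b w) * y ^ i)" for w y
  define B where "B w y y' = (\<Sum>i\<le>m. a i (vadd b w) * (\<Sum>k<i. y' ^ (i - Suc k) * y ^ k))" for w y y'
  define o0 where "o0 = replicate d (0::real)"
  define \<beta> where "\<beta> = B o0 y0 y0"
  have o0: "vadd b o0 = b" using vadd_0[of b] b by (simp add: o0_def)
  have \<beta>: "\<beta> \<noteq> 0" using simple by (simp add: \<beta>_def B_def o0)
  have gB: "g w y - g w y' = (y - y') * B w y y'" for w y y'
    unfolding g_def B_def by (rule sum_power_diff)
  have g0: "g o0 y0 = 0" using root by (simp add: g_def o0)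
  have aw: "poly_fun d (\<lambda>w. a i (vadd b w))" for i by (rule poly_fun_vadd[OF a b])
  have pg: "poly_fun d (\<lambda>w. g w (Y w))" if "poly_fun d Y" for Y
    unfolding g_def by (intro poly_fun_intros aw that)
  have pB: "poly_fun d (\<lambda>w. B w (Y w) (Y' w))" if "poly_fun d Y" "poly_fun d Y'" for Y Y'
    unfolding B_def by (intro poly_fun_intros aw that)
  \<comment> \<open>The three arguments are packed into one point of R^(d+2), so that continuity of
    polynomials applies jointly.\<close>
  define Bp where "Bp z = B (take d z) (z ! d) (z ! Suc d)" for z
  have pBp: "poly_fun (Suc (Suc d)) Bp"
    unfolding Bp_def B_def by (intro poly_fun_intros poly_fun_take[OF aw]) auto
  have "Bp (o0 @ [y0, y0]) = \<beta>" by (simp add: Bp_def \<beta>_def nth_append o0_def)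
  then have "(Bp \<longlongrightarrow> \<beta>) (near (Suc (Suc d)) (o0 @ [y0, y0]))" using poly_fun_near[OF pBp] by metis
  then have "eventually (\<lambda>z. dist (Bp z) \<beta> < \<bar>\<beta>\<bar> / 2) (near (Suc (Suc d)) (o0 @ [y0, y0]))"
    by (rule tendstoD) (use \<beta> in simp)
  then obtain \<delta> where \<delta>: "\<delta> > 0" "\<And>z. length z = Suc (Suc d) \<Longrightarrow>
    (\<forall>i<Suc (Suc d). \<bar>z ! i - (o0 @ [y0, y0]) ! i\<bar> < \<delta>) \<Longrightarrow> dist (Bp z) \<beta> < \<bar>\<beta>\<bar> / 2"
    unfolding eventually_near by blast
  have Bclose: "\<bar>B w y y' - \<beta>\<bar> < \<bar>\<beta>\<bar> / 2"
    if "length w = d" "\<forall>i<d. \<bar>w ! i\<bar> < \<delta>" "\<bar>y - y0\<bar> < \<delta>" "\<bar>y' - y0\<bar> < \<delta>" for w y y'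
    using \<delta>(2)[of "w @ [y, y']"] that
    by (auto simp: Bp_def nth_append dist_real_def o0_def less_Suc_eq)
  \<comment> \<open>Small enough for the requested \<open>\<epsilon>\<close> and for the region
    where the difference quotient stays within half of \<open>\<beta>\<close>.\<close>
  define \<eta> where "\<eta> = min \<epsilon> \<delta> / 2"
  have \<eta>: "\<eta> > 0" "\<eta> < \<epsilon>" "\<eta> < \<delta>" using \<delta>(1) \<open>\<epsilon> > 0\<close> by (auto simp: \<eta>_def)
  have ev0: "eventually (\<lambda>w. length w = d \<and> (\<forall>i<d. \<bar>w ! i\<bar> < \<delta>)) (near0 d)"
    using eventually_near_length[of d "replicate d 0"] eventually_near_close[OF \<delta>(1), of d "replicate d 0"]
    by eventually_elim auto
  \<comment> \<open>The difference quotient keeps the sign of \<open>\<beta>\<close>, so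
    \<open>g o0\<close> changes sign at \<open>y0\<close>. By continuity and the intermediate value
    theorem a root persists for small \<open>w\<close>.\<close>
  have sign: "g o0 (y0 - \<eta>) * g o0 (y0 + \<eta>) < 0"
  proof -
    have e: "g o0 (y0 - \<eta>) = - \<eta> * B o0 (y0 - \<eta>) y0" "g o0 (y0 + \<eta>) = \<eta> * B o0 (y0 + \<eta>) y0"
      using gB[of o0 "y0 - \<eta>" y0] gB[of o0 "y0 + \<eta>" y0] g0 by auto
    have c: "\<bar>B o0 (y0 - \<eta>) y0 - \<beta>\<bar> < \<bar>\<beta>\<bar> / 2" "\<bar>B o0 (y0 + \<eta>) y0 - \<beta>\<bar> < \<bar>\<beta>\<bar> / 2"
      using \<eta> \<delta>(1) by (intro Bclose; simp add: o0_def)+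
    have "B o0 (y0 - \<eta>) y0 * B o0 (y0 + \<eta>) y0 > 0"
    proof (cases "\<beta> > 0")
      case True
      then show ?thesis using c by (intro mult_pos_pos; linarith)
    next
      case False
      then show ?thesis using c \<beta> by (intro mult_neg_neg; linarith)
    qed
    then have "(\<eta> * \<eta>) * (B o0 (y0 - \<eta>) y0 * B o0 (y0 + \<eta>) y0) > 0" using \<eta>(1) by simp
    then show ?thesis unfolding e by (simp add: algebra_simps)
  qed
  have "poly_fun d (\<lambda>w. g w (y0 - \<eta>) * g w (y0 + \<eta>))" by (intro poly_fun_intros pg)
  then have "((\<lambda>w. g w (y0 - \<eta>) * g w (y0 + \<eta>)) \<longlongrightarrow> g o0 (y0 - \<eta>) * g o0 (y0 + \<eta>)) (near0 d)"
    unfolding o0_def by (rule poly_fun_near)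
  then have "eventually (\<lambda>w. g w (y0 - \<eta>) * g w (y0 + \<eta>) < 0) (near0 d)"
    using sign by (rule order_tendstoD(2))
  then have ex: "eventually (\<lambda>w. \<exists>y. \<bar>y - y0\<bar> < \<eta> \<and> g w y = 0) (near0 d)"
  proof eventually_elim
    case (elim w)
    have gp: "g w y = poly (\<Sum>i\<le>m. monom (a i (vadd b w)) i) y" for y
      by (simp add: g_def poly_sum poly_monom)
    obtain y where "y0 - \<eta> < y" "y < y0 + \<eta>" "g w y = 0"
      using poly_IVT[of "y0 - \<eta>" "y0 + \<eta>"] elim \<eta>(1) unfolding gp by auto
    then show ?case by (intro exI[of _ y]) auto
  qed
  define \<xi> where "\<xi> w = (SOME y. \<bar>y - y0\<bar> < \<eta> \<and> g w y = 0)" for w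
  have \<xi>: "eventually (\<lambda>w. \<bar>\<xi> w - y0\<bar> < \<eta> \<and> g w (\<xi> w) = 0) (near0 d)"
    using ex unfolding \<xi>_def by eventually_elim (rule someI_ex)
  have newton: "\<exists>Y. poly_fun d Y \<and> Y o0 = y0 \<and> (\<lambda>w. g w (Y w)) \<in> O[near0 d](\<lambda>w. nrm w ^ K)" for K
  proof (induction K)
    case 0
    have "poly_fun d (\<lambda>w. g w y0)" by (intro pg poly_fun_intros)
    then show ?case by (intro exI[of _ "\<lambda>_. y0"]) (auto intro: poly_fun_intros poly_fun_bigo_1)
  next
    case (Suc K)
    then obtain Y where Y: "poly_fun d Y" "Y o0 = y0" "(\<lambda>w. g w (Y w)) \<in> O[near0 d](\<lambda>w. nrm w ^ K)" by blast
    define Z where "Z w = Y w + (- 1 / \<beta>) * g w (Y w)" for w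
    have Z: "poly_fun d Z" unfolding Z_def by (intro poly_fun_intros pg Y)
    have Z0: "Z o0 = y0" using g0 Y(2) by (simp add: Z_def)
    \<comment> \<open>A Newton step multiplies the residual by \<open>h\<close>, which vanishes at
      the origin because \<open>\<beta>\<close> is the exact derivative there. This gains one
      order.\<close>
    define h where "h w = 1 + (- 1 / \<beta>) * B w (Z w) (Y w)" for w
    have "poly_fun d h" unfolding h_def by (intro poly_fun_intros pB Y Z)
    moreover have "h o0 = 0" using \<beta> by (simp add: h_def Z0 Y(2) \<beta>_def)
    ultimately have "h \<in> O[near0 d](nrm)" using poly_fun_bigo[of d h] by (simp add: o0_def)
    then have "(\<lambda>w. h w * g w (Y w)) \<in> O[near0 d](\<lambda>w. nrm w * nrm w ^ K)"
      by (intro landau_o.big.mult Y)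
    moreover have "g w (Z w) = h w * g w (Y w)" for w
      using gB[of w "Z w" "Y w"] by (simp add: h_def Z_def algebra_simps)
    ultimately show ?case using Z Z0 by (intro exI[of _ Z]) simp
  qed
  show ?thesis
  proof (rule exI[of _ \<xi>], intro conjI allI)
    show "eventually (\<lambda>w. \<bar>\<xi> w - y0\<bar> < \<epsilon> \<and> (\<Sum>i\<le>m. a i (vadd b w) * \<xi> w ^ i) = 0) (near0 d)"
      using \<xi> \<eta>(2) unfolding g_def by (auto elim: eventually_mono)
    fix K
    obtain Y where Y: "poly_fun d Y" "Y o0 = y0" "(\<lambda>w. g w (Y w)) \<in> O[near0 d](\<lambda>w. nrm w ^ K)"
      using newton by blast
    have "(Y \<longlongrightarrow> y0) (near0 d)" using poly_fun_near[OF Y(1), of o0] Y(2) by (simp add: o0_def)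
    then have "eventually (\<lambda>w. dist (Y w) y0 < \<delta>) (near0 d)" using \<delta>(1) by (rule tendstoD)
    \<comment> \<open>A small residual means a small error: the difference quotient between
      \<open>Y w\<close> and the root is at least \<open>\<bar>\<beta>\<bar> / 2\<close> in absolute
      value.\<close>
    then have "eventually (\<lambda>w. norm (\<xi> w - Y w) \<le> (2 / \<bar>\<beta>\<bar>) * norm (g w (Y w))) (near0 d)"
      using ev0 \<xi>
    proof eventually_elim
      case (elim w)
      have "\<bar>B w (\<xi> w) (Y w) - \<beta>\<bar> < \<bar>\<beta>\<bar> / 2"
        using elim \<eta>(3) by (intro Bclose) (auto simp: dist_real_def)
      then have "\<bar>\<beta>\<bar> / 2 \<le> \<bar>B w (\<xi> w) (Y w)\<bar>" by linarith
      then have "\<bar>\<xi> w - Y w\<bar> * (\<bar>\<beta>\<bar> / 2) \<le> \<bar>\<xi> w - Y w\<bar> * \<bar>B w (\<xi> w) (Y w)\<bar>" by (rule mult_left_mono) simp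
      also have "\<dots> = \<bar>g w (Y w)\<bar>" using gB[of w "\<xi> w" "Y w"] elim by (simp add: abs_mult[symmetric])
      finally show ?case using \<beta> by (simp add: field_simps)
    qed
    then have "(\<lambda>w. \<xi> w - Y w) \<in> O[near0 d](\<lambda>w. g w (Y w))" by (rule bigoI)
    then show "\<exists>Y. poly_fun d Y \<and> (\<lambda>w. \<xi> w - Y w) \<in> O[near0 d](\<lambda>w. nrm w ^ K)"
      using Y landau_o.big_trans by blast
  qed
qed

text \<open>In a relation of least degree the derivative cannot vanish on all of \<open>S\<close>:
  in characteristic 0 it would be a nontrivial relation of smaller degree. This supplies the simple
  roots for \<open>implicit_root\<close>.\<close>

lemma separable_relation:
  assumes ind: "indep_on d \<pi> S" and alg: "alg_over d \<pi> S h" and \<pi>: "\<And>z. z \<in> S \<Longrightarrow> length (\<pi> z) = d"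
  shows "\<exists>m a. (\<forall>i. poly_fun d (a i)) \<and> (\<forall>z\<in>S. (\<Sum>i\<le>m. a i (\<pi> z) * h z ^ i) = 0) \<and>
    (\<exists>z\<in>S. a m (\<pi> z) \<noteq> 0) \<and> (\<exists>z\<in>S. (\<Sum>i\<le>m. a i (\<pi> z) * (\<Sum>k<i. h z ^ (i - Suc k) * h z ^ k)) \<noteq> 0)"
proof -
  define P where "P m \<longleftrightarrow> (\<exists>a. (\<forall>i. poly_fun d (a i)) \<and> (\<exists>i\<le>m. \<exists>w\<in>Rn d. a i w \<noteq> 0) \<and>
      (\<forall>z\<in>S. (\<Sum>i\<le>m. a i (\<pi> z) * h z ^ i) = 0))" for m
  have nz: "\<exists>z\<in>S. a (\<pi> z) \<noteq> 0" if "poly_fun d a" "\<exists>w\<in>Rn d. a w \<noteq> 0" for a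
    using ind that unfolding indep_on_def by blast
  define m where "m = (LEAST m. P m)"
  have "\<exists>m. P m" using alg unfolding P_def alg_over_def .
  then have Pm: "P m" unfolding m_def by (rule LeastI_ex)
  have least: "\<not> P k" if "k < m" for k using that not_less_Least unfolding m_def by blast
  obtain a where a: "\<forall>i. poly_fun d (a i)" "\<exists>i\<le>m. \<exists>w\<in>Rn d. a i w \<noteq> 0"
    "\<forall>z\<in>S. (\<Sum>i\<le>m. a i (\<pi> z) * h z ^ i) = 0" using Pm unfolding P_def by blast
  have m0: "m > 0"
  proof (rule ccontr)
    assume "\<not> m > 0"
    then have "\<exists>w\<in>Rn d. a 0 w \<noteq> 0" "\<forall>z\<in>S. a 0 (\<pi> z) = 0" using a by auto
    then show False using nz[of "a 0"] a(1) by blast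
  qed
  then obtain k where k: "m = Suc k" by (cases m) auto
  have lead: "\<exists>w\<in>Rn d. a m w \<noteq> 0"
  proof (rule ccontr)
    assume no: "\<not> ?thesis"
    have "P k" unfolding P_def
    proof (intro exI[of _ a] conjI ballI)
      show "\<forall>i. poly_fun d (a i)" by (rule a)
      show "\<exists>i\<le>k. \<exists>w\<in>Rn d. a i w \<noteq> 0" using a(2) no k by (metis le_Suc_eq)
      fix z assume "z \<in> S"
      then show "(\<Sum>i\<le>k. a i (\<pi> z) * h z ^ i) = 0" using a(3) no \<pi>[of z] k by auto
    qed
    then show False using least k by simp
  qed
  have "\<exists>z\<in>S. (\<Sum>i\<le>m. a i (\<pi> z) * (\<Sum>k<i. h z ^ (i - Suc k) * h z ^ k)) \<noteq> 0"
  proof (rule ccontr)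
    assume no: "\<not> ?thesis"
    define b where "b i w = real (Suc i) * a (Suc i) w" for i w
    have "P k" unfolding P_def
    proof (intro exI[of _ b] conjI ballI)
      show "\<forall>i. poly_fun d (b i)" unfolding b_def using a(1) by (intro allI poly_fun_intros) auto
      show "\<exists>i\<le>k. \<exists>w\<in>Rn d. b i w \<noteq> 0" using lead k by (intro exI[of _ k]) (auto simp: b_def simp del: of_nat_Suc)
      fix z assume z: "z \<in> S"
      have "(\<Sum>k<i. h z ^ (i - Suc k) * h z ^ k) = real i * h z ^ (i - 1)" for i
        by (simp add: power_add[symmetric])
      then have "(\<Sum>i\<le>m. a i (\<pi> z) * (\<Sum>k<i. h z ^ (i - Suc k) * h z ^ k)) = (\<Sum>i\<le>Suc k. a i (\<pi> z) * (real i * h z ^ (i - 1)))"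
        by (simp only: k)
      also have "\<dots> = (\<Sum>i\<le>k. b i (\<pi> z) * h z ^ i)"
        by (subst sum.atMost_Suc_shift) (simp add: b_def mult_ac)
      finally show "(\<Sum>i\<le>k. b i (\<pi> z) * h z ^ i) = 0" using no z by simp
    qed
    then show False using least k by simp
  qed
  moreover have "\<exists>z\<in>S. a m (\<pi> z) \<noteq> 0" using nz lead a(1) by blast
  ultimately show ?thesis using a by blast
qed

text \<open>A polynomial vanishing on \<open>S\<close> also vanishes near a generic point of \<open>S\<close> on the larger
  set \<open>E\<close> cut out by one relation per coordinate.  Hence near such a point \<open>E\<close> lies in \<open>S\<close>.\<close>
lemma sign_locally_constant:
  assumes q: "poly_fun N q" and S: "S \<subseteq> E" "S \<noteq> {}" "E \<subseteq> Rn N" and L: "set L \<subseteq> {..<N}"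
    and ind: "indep_on (length L) (sel L) S"
    and alg: "\<And>j. j < N \<Longrightarrow> alg_over (length L) (sel L) E (\<lambda>z. z ! j)"
  shows "\<exists>c. poly_fun N c \<and> (\<exists>z\<in>S. c z \<noteq> 0) \<and>
    (\<forall>P\<in>S. c P \<noteq> 0 \<longrightarrow> eventually (\<lambda>z. z \<in> E \<longrightarrow> sgn (q z) = sgn (q P)) (near N P))"
proof (cases "\<exists>z\<in>S. q z \<noteq> 0")
  case True
  have "eventually (\<lambda>z. z \<in> E \<longrightarrow> sgn (q z) = sgn (q P)) (near N P)" if "q P \<noteq> 0" for P
    using sgn_near[of N q P, OF q that] by eventually_elim simp
  then show ?thesis using True q by blast
next
  case False
  have "alg_over (length L) (sel L) E q" by (rule alg_over_poly[OF q alg]) auto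
  then obtain k m a where a: "\<And>i. poly_fun (length L) (a i)" "\<exists>w\<in>Rn (length L). a 0 w \<noteq> 0"
    "\<And>z. z \<in> E \<Longrightarrow> q z ^ k * (a 0 (sel L z) + q z * (\<Sum>i<m. a (Suc i) (sel L z) * q z ^ i)) = 0"
    by (rule alg_over_factor) auto
  \<comment> \<open>On \<open>E\<close>, \<open>q ^ k * U = 0\<close>; on \<open>S\<close>, where
    \<open>q = 0\<close>, \<open>U\<close> equals \<open>a 0\<close>. If that is nonzero at
    \<open>P\<close>, then \<open>U\<close> is nonzero nearby and \<open>q\<close> vanishes on
    \<open>E\<close> there.\<close>
  define U where "U z = a 0 (sel L z) + q z * (\<Sum>i<m. a (Suc i) (sel L z) * q z ^ i)" for z
  have pU: "poly_fun N U" unfolding U_def by (intro poly_fun_intros poly_fun_sel q a L)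
  have "\<exists>z\<in>S. a 0 (sel L z) \<noteq> 0" using ind a(1,2) unfolding indep_on_def by blast
  moreover have "eventually (\<lambda>z. z \<in> E \<longrightarrow> sgn (q z) = sgn (q P)) (near N P)"
    if P: "P \<in> S" "a 0 (sel L P) \<noteq> 0" for P
  proof -
    have UP: "U P \<noteq> 0" using P False by (simp add: U_def)
    have "eventually (\<lambda>z. sgn (U z) = sgn (U P)) (near N P)" by (rule sgn_near[OF pU UP])
    then show ?thesis
    proof eventually_elim
      case (elim z)
      then have "U z \<noteq> 0" using UP by (auto simp: sgn_if split: if_splits)
      then have "q z = 0" if "z \<in> E" using a(3)[OF that] by (simp add: U_def)
      then show ?case using False P by simp
    qed
  qed
  moreover have "poly_fun N (\<lambda>z. a 0 (sel L z))" by (intro poly_fun_sel a L)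
  ultimately show ?thesis by (intro exI[of _ "\<lambda>z. a 0 (sel L z)"]) simp
qed

text \<open>\<open>P\<close> is a point of \<open>S\<close> off the zeros of finitely many
  polynomials: those that make the signs locally constant on \<open>E\<close>, and the leading
  coefficients and derivatives of one relation per coordinate. Implicit roots then give points of
  \<open>E\<close> near \<open>P\<close>, and these lie in \<open>S\<close>.\<close>

lemma local_structure:
  assumes S: "semialg N S" "zar_irred N S" and L: "set L \<subseteq> {..<N}" and d: "d = length L"
    and ind: "indep_on d (sel L) S"
    and alg: "\<And>j. j < N \<Longrightarrow> alg_over d (sel L) S (\<lambda>z. z ! j)"
  obtains P \<gamma> where "P \<in> S" "eventually (\<lambda>w. \<gamma> w \<in> S \<and> sel L (\<gamma> w) = vadd (sel L P) w) (near0 d)"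
    "\<And>j K. j < N \<Longrightarrow> \<exists>Y. poly_fun d Y \<and> (\<lambda>w. \<gamma> w ! j - Y w) \<in> O[near0 d](\<lambda>w. nrm w ^ K)"
    "\<And>j. j < N \<Longrightarrow> \<exists>m a. (\<forall>i. poly_fun d (a i)) \<and> a m (sel L P) \<noteq> 0 \<and>
       (\<forall>z\<in>S. (\<Sum>i\<le>m. a i (sel L z) * z ! j ^ i) = 0)"
proof -
  have dL: "distinct L" using indep_on_distinct ind d by blast
  have SN: "S \<subseteq> Rn N" "S \<noteq> {}" using S(2) by (auto simp: zar_irred_def)
  \<comment> \<open>The last clause concerns the coordinates in \<open>L\<close>: their relation,
    which will be \<open>y - w ! k\<close>, has to determine the value, so that the constructed
    point has the prescribed projection.\<close>
  define R where "R j m a \<longleftrightarrow> (\<forall>i. poly_fun d (a i)) \<and> (\<forall>z\<in>S. (\<Sum>i\<le>m. a i (sel L z) * z ! j ^ i) = 0) \<and>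
    (\<exists>z\<in>S. a m (sel L z) \<noteq> 0) \<and> (\<exists>z\<in>S. (\<Sum>i\<le>m. a i (sel L z) * (\<Sum>k<i. z ! j ^ (i - Suc k) * z ! j ^ k)) \<noteq> 0) \<and>
    (\<forall>k<d. L ! k = j \<longrightarrow> (\<forall>w y. (\<Sum>i\<le>m. a i w * y ^ i) = 0 \<longrightarrow> y = w ! k))"
    for j m and a :: "nat \<Rightarrow> real list \<Rightarrow> real"
  have "\<exists>r. j < N \<longrightarrow> R j (fst r) (snd r)" for j
  proof (cases "j \<in> set L")
    case True
    then obtain k where k: "k < d" "L ! k = j" using d by (metis in_set_conv_nth)
    have u: "k' = k" if "k' < d" "L ! k' = j" for k' using dL k that d nth_eq_iff_index_eq by blast
    have "R j 1 (\<lambda>i w. if i = 1 then 1 else - (w ! k))"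
      unfolding R_def
    proof (intro conjI allI impI)
      show "poly_fun d (\<lambda>w. if i = 1 then 1 else - (w ! k))" for i :: nat
        using k by (intro poly_fun_if poly_fun_intros)
      show "\<forall>z\<in>S. (\<Sum>i\<le>1. (if i = 1 then 1 else - (sel L z ! k)) * z ! j ^ i) = 0"
        using k d by (simp add: sel_def)
      fix k' w and y :: real assume "k' < d" "L ! k' = j" "(\<Sum>i\<le>1. (if i = 1 then 1 else - (w ! k)) * y ^ i) = 0"
      then show "y = w ! k'" using u[of k'] by simp
    qed (use SN in auto)
    then show ?thesis by (intro exI[of _ "(1, \<lambda>i w. if i = 1 then 1 else - (w ! k))"]) simp
  next
    case False
    then have nk: "L ! k \<noteq> j" if "k < d" for k using that d nth_mem by blast
    show ?thesis
    proof (cases "j < N")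
      case True
      obtain m a where "(\<forall>i. poly_fun d (a i)) \<and> (\<forall>z\<in>S. (\<Sum>i\<le>m. a i (sel L z) * z ! j ^ i) = 0) \<and>
        (\<exists>z\<in>S. a m (sel L z) \<noteq> 0) \<and> (\<exists>z\<in>S. (\<Sum>i\<le>m. a i (sel L z) * (\<Sum>k<i. z ! j ^ (i - Suc k) * z ! j ^ k)) \<noteq> 0)"
        using separable_relation[OF ind alg[OF True]] d by auto
      then have "R j m a" unfolding R_def using nk by blast
      then show ?thesis by (intro exI[of _ "(m, a)"]) simp
    qed simp
  qed
  then have "\<forall>j. \<exists>r. j < N \<longrightarrow> R j (fst r) (snd r)" by blast
  from choice[OF this] obtain r where r: "\<And>j. j < N \<Longrightarrow> R j (fst (r j)) (snd (r j))" by blast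
  define m where "m j = fst (r j)" for j
  define a where "a j = snd (r j)" for j
  have R: "R j (m j) (a j)" if "j < N" for j using r[OF that] by (simp add: m_def a_def)
  \<comment> \<open>Cut out by the chosen relations alone, hence within reach of implicit
    roots.\<close>
  define E where "E = {z\<in>Rn N. \<forall>j<N. (\<Sum>i\<le>m j. a j i (sel L z) * z ! j ^ i) = 0}"
  have SE: "S \<subseteq> E" using R SN by (auto simp: E_def R_def)
  have nzS: "\<exists>w\<in>Rn d. g w \<noteq> 0" if "\<exists>z\<in>S. g (sel L z) \<noteq> 0" for g
    using that d by (metis Rn_iff length_sel)
  have algE: "alg_over (length L) (sel L) E (\<lambda>z. z ! j)" if j: "j < N" for j
    unfolding alg_over_def
  proof (rule exI[of _ "m j"], rule exI[of _ "a j"], intro conjI)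
    show "\<forall>i. poly_fun (length L) (a j i)" using R[OF j] d by (simp add: R_def)
    show "\<exists>i\<le>m j. \<exists>w\<in>Rn (length L). a j i w \<noteq> 0" using R[OF j] nzS[of "a j (m j)"] d unfolding R_def by blast
    show "\<forall>e\<in>E. (\<Sum>i\<le>m j. a j i (sel L e) * e ! j ^ i) = 0" using j by (simp add: E_def)
  qed
  obtain Q where Q: "finite Q" "\<forall>q\<in>Q. poly_fun N q"
    "\<forall>x\<in>Rn N. \<forall>y\<in>Rn N. (\<forall>q\<in>Q. sgn (q x) = sgn (q y)) \<longrightarrow> (x \<in> S \<longleftrightarrow> y \<in> S)"
    using semialg_signs[OF S(1)] by blast
  have ER: "E \<subseteq> Rn N" unfolding E_def by blast
  have ind': "indep_on (length L) (sel L) S" using ind d by simp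
  have "\<forall>q. \<exists>c. q \<in> Q \<longrightarrow> poly_fun N c \<and> (\<exists>z\<in>S. c z \<noteq> 0) \<and>
    (\<forall>P\<in>S. c P \<noteq> 0 \<longrightarrow> eventually (\<lambda>z. z \<in> E \<longrightarrow> sgn (q z) = sgn (q P)) (near N P))"
    using sign_locally_constant[OF _ SE SN(2) ER L ind' algE] Q(2) by blast
  from choice[OF this] obtain c where c: "\<And>q. q \<in> Q \<Longrightarrow> poly_fun N (c q)" "\<And>q. q \<in> Q \<Longrightarrow> \<exists>z\<in>S. c q z \<noteq> 0"
    "\<And>q P. q \<in> Q \<Longrightarrow> P \<in> S \<Longrightarrow> c q P \<noteq> 0 \<Longrightarrow> eventually (\<lambda>z. z \<in> E \<longrightarrow> sgn (q z) = sgn (q P)) (near N P)"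
    by blast
  define lead where "lead j z = a j (m j) (sel L z)" for j z
  define der where "der j z = (\<Sum>i\<le>m j. a j i (sel L z) * (\<Sum>k<i. z ! j ^ (i - Suc k) * z ! j ^ k))" for j z
  have pa: "poly_fun N (\<lambda>z. a j i (sel L z))" if "j < N" for i j
    using R[OF that] L d by (auto simp: R_def intro: poly_fun_sel)
  define \<C> where "\<C> = c ` Q \<union> lead ` {..<N} \<union> der ` {..<N}"
  have "\<exists>P\<in>S. \<forall>g\<in>\<C>. g P \<noteq> 0"
  proof (rule zar_irred_prod[OF S(2)])
    show "finite \<C>" using Q(1) by (simp add: \<C>_def)
    fix g assume "g \<in> \<C>"
    then consider q where "q \<in> Q" "g = c q" | j where "j < N" "g = lead j" | j where "j < N" "g = der j"
      by (auto simp: \<C>_def)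
    then show "poly_fun N g" "\<exists>z\<in>S. g z \<noteq> 0"
    proof (atomize (full), cases)
      case 1
      then show "poly_fun N g \<and> (\<exists>z\<in>S. g z \<noteq> 0)" using c by blast
    next
      case 2
      then show "poly_fun N g \<and> (\<exists>z\<in>S. g z \<noteq> 0)" using pa[of j] R[of j] by (auto simp: lead_def[abs_def] R_def)
    next
      case 3
      have "poly_fun N (der j)" unfolding der_def using 3 by (intro poly_fun_intros pa) auto
      then show "poly_fun N g \<and> (\<exists>z\<in>S. g z \<noteq> 0)" using 3 R[of j] by (auto simp: der_def R_def)
    qed
  qed
  then obtain P where P: "P \<in> S" "\<And>g. g \<in> \<C> \<Longrightarrow> g P \<noteq> 0" by blast
  have "\<forall>q\<in>Q. eventually (\<lambda>z. z \<in> E \<longrightarrow> sgn (q z) = sgn (q P)) (near N P)"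
    using c(3) P by (simp add: \<C>_def)
  then have "eventually (\<lambda>z. \<forall>q\<in>Q. z \<in> E \<longrightarrow> sgn (q z) = sgn (q P)) (near N P)"
    by (rule eventually_ball_finite[OF Q(1)])
  then obtain \<epsilon> where \<epsilon>': "\<epsilon> > 0" "\<And>z. length z = N \<Longrightarrow> (\<forall>j<N. \<bar>z ! j - P ! j\<bar> < \<epsilon>) \<Longrightarrow>
      \<forall>q\<in>Q. z \<in> E \<longrightarrow> sgn (q z) = sgn (q P)"
    unfolding eventually_near by blast
  have \<epsilon>: "z \<in> S" if "length z = N" "\<forall>j<N. \<bar>z ! j - P ! j\<bar> < \<epsilon>" "z \<in> E" for z
  proof -
    have "\<forall>q\<in>Q. sgn (q z) = sgn (q P)" using \<epsilon>'(2)[OF that(1,2)] that(3) by blast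
    then show "z \<in> S" using Q(3)[rule_format, of z P] that(1) P(1) SN by auto
  qed
  define b where "b = sel L P"
  have lb: "length b = d" by (simp add: b_def d)
  have "\<exists>\<xi>. eventually (\<lambda>w. \<bar>\<xi> w - P ! j\<bar> < \<epsilon> \<and> (\<Sum>i\<le>m j. a j i (vadd b w) * \<xi> w ^ i) = 0) (near0 d) \<and>
    (\<forall>K. \<exists>Y. poly_fun d Y \<and> (\<lambda>w. \<xi> w - Y w) \<in> O[near0 d](\<lambda>w. nrm w ^ K))" if j: "j < N" for j
  proof (rule implicit_root[OF _ lb _ _ \<epsilon>'(1)])
    show "poly_fun d (a j i)" for i using R[OF j] by (simp add: R_def)
    show "(\<Sum>i\<le>m j. a j i b * P ! j ^ i) = 0" using SE P(1) j by (auto simp: E_def b_def)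
    show "(\<Sum>i\<le>m j. a j i b * (\<Sum>k<i. P ! j ^ (i - Suc k) * P ! j ^ k)) \<noteq> 0"
      using P(2)[of "der j"] j by (auto simp: \<C>_def der_def b_def)
  qed
  then have "\<forall>j. \<exists>\<xi>. j < N \<longrightarrow> eventually (\<lambda>w. \<bar>\<xi> w - P ! j\<bar> < \<epsilon> \<and> (\<Sum>i\<le>m j. a j i (vadd b w) * \<xi> w ^ i) = 0) (near0 d) \<and>
    (\<forall>K. \<exists>Y. poly_fun d Y \<and> (\<lambda>w. \<xi> w - Y w) \<in> O[near0 d](\<lambda>w. nrm w ^ K))" by blast
  from choice[OF this] obtain \<xi> where
    \<xi>: "\<And>j. j < N \<Longrightarrow> eventually (\<lambda>w. \<bar>\<xi> j w - P ! j\<bar> < \<epsilon> \<and> (\<Sum>i\<le>m j. a j i (vadd b w) * \<xi> j w ^ i) = 0) (near0 d)"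
    "\<And>j K. j < N \<Longrightarrow> \<exists>Y. poly_fun d Y \<and> (\<lambda>w. \<xi> j w - Y w) \<in> O[near0 d](\<lambda>w. nrm w ^ K)" by blast
  define \<gamma> where "\<gamma> w = map (\<lambda>j. \<xi> j w) [0..<N]" for w
  have "eventually (\<lambda>w. \<forall>j\<in>{..<N}. \<bar>\<xi> j w - P ! j\<bar> < \<epsilon> \<and> (\<Sum>i\<le>m j. a j i (vadd b w) * \<xi> j w ^ i) = 0) (near0 d)"
    using \<xi>(1) by (simp add: eventually_ball_finite_distrib)
  then have "eventually (\<lambda>w. \<gamma> w \<in> S \<and> sel L (\<gamma> w) = vadd (sel L P) w) (near0 d)"
  proof eventually_elim
    case (elim w)
    have sel: "sel L (\<gamma> w) = vadd b w"
    proof (rule nth_equalityI)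
      show "length (sel L (\<gamma> w)) = length (vadd b w)" using d lb by simp
      fix k assume "k < length (sel L (\<gamma> w))"
      then have k: "k < d" by (simp add: d)
      then have "L ! k \<in> set L" by (simp add: d)
      then have Lk: "L ! k < N" using L by auto
      then have "\<xi> (L ! k) w = vadd b w ! k"
        using R[OF Lk] k elim unfolding R_def by blast
      then show "sel L (\<gamma> w) ! k = vadd b w ! k" using k d Lk by (simp add: sel_def \<gamma>_def)
    qed
    have "\<gamma> w \<in> E" unfolding E_def using elim by (auto simp: sel) (auto simp: \<gamma>_def)
    then have "\<gamma> w \<in> S" using \<epsilon>[of "\<gamma> w"] elim by (auto simp: \<gamma>_def)
    then show ?case using sel by (simp add: b_def)
  qed
  moreover have "\<exists>Y. poly_fun d Y \<and> (\<lambda>w. \<gamma> w ! j - Y w) \<in> O[near0 d](\<lambda>w. nrm w ^ K)" if "j < N" for j K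
    using \<xi>(2)[OF that, of K] that by (simp add: \<gamma>_def)
  moreover have "\<exists>m a. (\<forall>i. poly_fun d (a i)) \<and> a m (sel L P) \<noteq> 0 \<and> (\<forall>z\<in>S. (\<Sum>i\<le>m. a i (sel L z) * z ! j ^ i) = 0)"
    if j: "j < N" for j
    using R[OF j] P(2)[of "lead j"] j unfolding R_def
    by (intro exI[of _ "m j"] exI[of _ "a j"]) (auto simp: \<C>_def lead_def)
  ultimately show thesis using that P(1) by blast
qed

section \<open>Charts and pencils of lines\<close>

text \<open>Divide by the power of \<open>t\<close> already known to divide \<open>r\<close> and
  pass to the limit. \<open>F\<close> is a general proper subfilter because relations along an arc
  are known only for parameters accumulating at 0.\<close>

lemma poly_flat:
  fixes r :: "real poly"
  assumes F: "F \<le> at_right 0" "F \<noteq> bot" and O: "(\<lambda>t. poly r t) \<in> O[F](\<lambda>t. t ^ K)" and "k < K"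
  shows "coeff r k = 0"
  using \<open>k < K\<close>
proof (induction k rule: less_induct)
  case (less k)
  have "monom 1 k dvd r" using less by (simp add: monom_1_dvd_iff')
  then obtain s where s: "r = monom 1 k * s" by (auto elim: dvdE)
  have pos: "eventually (\<lambda>t. t > 0) F" using F(1) eventually_at_right_less by (auto intro: filter_leD)
  obtain C where "eventually (\<lambda>t. norm (poly r t) \<le> C * norm (t ^ K)) F" using O by (elim landau_o.bigE)
  then have up: "eventually (\<lambda>t. norm (poly s t) \<le> C * t ^ (K - k)) F"
    using pos
  proof eventually_elim
    case (elim t)
    have "t ^ K = t ^ k * t ^ (K - k)" using less.prems by (simp flip: power_add)
    then have "t ^ k * \<bar>poly s t\<bar> \<le> t ^ k * (C * t ^ (K - k))"
      using elim by (simp add: s poly_monom abs_mult mult_ac)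
    then show ?case using elim by simp
  qed
  have "((\<lambda>t. C * t ^ (K - k)) \<longlongrightarrow> C * 0 ^ (K - k)) F"
    by (intro tendsto_intros tendsto_mono[OF F(1)] tendsto_ident_at)
  moreover have "C * 0 ^ (K - k) = 0" using less.prems by (simp add: zero_power)
  ultimately have "((\<lambda>t. C * t ^ (K - k)) \<longlongrightarrow> 0) F" by simp
  then have "((\<lambda>t. norm (poly s t)) \<longlongrightarrow> 0) F"
    by (rule tendsto_sandwich[OF _ up tendsto_const, rotated]) simp
  then have "(poly s \<longlongrightarrow> 0) F" by (rule tendsto_norm_zero_cancel)
  moreover have "(poly s \<longlongrightarrow> poly s 0) F"
  proof (rule tendsto_mono[OF F(1)])
    show "(poly s \<longlongrightarrow> poly s 0) (at_right 0)"
      using poly_isCont[of 0 s] unfolding isCont_def by (rule tendsto_mono[OF at_le, rotated]) simp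
  qed
  ultimately have "poly s 0 = 0" using F(2) tendsto_unique by blast
  then show ?case by (simp add: s coeff_monom_mult poly_0_coeff_0)
qed

lemma poly_fun_line:
  assumes "poly_fun d p" "length b = d" "length c = d"
  shows "\<exists>r. \<forall>t. p (vadd b (smul t c)) = poly r t"
  using assms(1)
proof induction
  case (pf_const a)
  show ?case by (intro exI[of _ "[:a:]"]) simp
next
  case (pf_var i)
  then show ?case using assms by (intro exI[of _ "[:b ! i, c ! i:]"]) (simp add: mult.commute)
next
  case (pf_add p q)
  then show ?case by (metis poly_add)
next
  case (pf_mult p q)
  then show ?case by (metis poly_mult)
qed

lemma vadd_zero: "length w = d \<Longrightarrow> vadd (replicate d 0) w = w"
  by (rule nth_equalityI) auto

lemma smul_smul: "smul s (smul t w) = smul (s * t) w"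
  by (simp add: smul_def mult_ac)

lemma smul_one: "smul 1 w = w"
  by (rule nth_equalityI) auto

lemma poly_fun_ray:
  assumes "poly_fun d p" "length c = d"
  shows "\<exists>r. \<forall>t. p (smul t c) = poly r t"
  using poly_fun_line[OF assms(1) _ assms(2), of "replicate d 0"] by (simp add: vadd_zero assms)

text \<open>The value \<open>p (smul t w)\<close> is polynomial in \<open>w\<close> and
  \<open>t\<close>; its coefficients in \<open>t\<close> are the homogeneous parts of
  \<open>p\<close>. Comparing \<open>smul t (smul s w)\<close> with \<open>smul (t * s) w\<close>
  proves homogeneity.\<close>

lemma homogeneous_parts:
  assumes "poly_fun d p"
  shows "\<exists>M h. (\<forall>k. poly_fun d (h k)) \<and> (\<forall>w\<in>Rn d. \<forall>t. p (smul t w) = (\<Sum>k<M. h k w * t ^ k)) \<and>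
    (\<forall>k. \<forall>w\<in>Rn d. \<forall>t. h k (smul t w) = t ^ k * h k w)"
proof -
  have "poly_fun (Suc d) (\<lambda>z. p (map (\<lambda>i. z ! d * z ! i) [0..<d]))"
    by (rule poly_fun_comp[OF assms, of _ "\<lambda>i z. z ! d * z ! i"]) (simp_all add: pf_mult pf_var)
  then obtain M h where h: "\<And>k. poly_fun d (h k)" "\<And>k w. k \<ge> M \<Longrightarrow> h k w = 0"
    "\<And>w t. length w = d \<Longrightarrow> p (map (\<lambda>i. (w @ [t]) ! d * (w @ [t]) ! i) [0..<d]) = (\<Sum>k<M. h k w * t ^ k)"
    by (rule poly_fun_Suc_expand) blast
  have eq: "p (smul t w) = (\<Sum>k<M. h k w * t ^ k)" if "length w = d" for t w
  proof -
    have "map (\<lambda>i. (w @ [t]) ! d * (w @ [t]) ! i) [0..<d] = smul t w"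
      using that by (intro nth_equalityI) (auto simp: nth_append)
    then show ?thesis using h(3)[OF that, of t] by simp
  qed
  have "h k (smul s w) = s ^ k * h k w" if w: "length w = d" for k s w
  proof (cases "k < M")
    case True
    have "poly (\<Sum>k<M. monom (h k (smul s w)) k) t = poly (\<Sum>k<M. monom (s ^ k * h k w) k) t" for t
      using eq[of "smul s w" t] eq[OF w, of "t * s"] w
      by (simp add: poly_sum poly_monom smul_smul power_mult_distrib mult_ac)
    then have "(\<Sum>k<M. monom (h k (smul s w)) k) = (\<Sum>k<M. monom (s ^ k * h k w) k)"
      by (simp add: poly_eq_poly_eq_iff[symmetric] fun_eq_iff)
    then have "coeff (\<Sum>k<M. monom (h k (smul s w)) k) k = coeff (\<Sum>k<M. monom (s ^ k * h k w) k) k" by simp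
    then show ?thesis using True by (simp add: coeff_sum if_distrib sum.delta)
  qed (simp add: h)
  then show ?thesis using h(1) eq by (intro exI[of _ M] exI[of _ h]) auto
qed

text \<open>A local section \<open>\<gamma>\<close> of the projection to the coordinates
  \<open>L\<close> over a box around \<open>b\<close>, with Taylor polynomials of every order. In
  the last clause \<open>a m b \<noteq> 0\<close> keeps the relations nontrivial on every line
  through \<open>b\<close>.\<close>

definition chart :: "nat \<Rightarrow> nat list \<Rightarrow> real list set \<Rightarrow> real list \<Rightarrow> (real list \<Rightarrow> real list) \<Rightarrow> real \<Rightarrow> bool" where
  "chart N L S b \<gamma> \<rho> \<longleftrightarrow> \<rho> > 0 \<and> length b = length L \<and>
     (\<forall>w. length w = length L \<longrightarrow> (\<forall>i<length L. \<bar>w ! i\<bar> < \<rho>) \<longrightarrow> \<gamma> w \<in> S \<and> sel L (\<gamma> w) = vadd b w) \<and>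
     (\<forall>j<N. \<forall>K. \<exists>Y. poly_fun (length L) Y \<and> (\<lambda>w. \<gamma> w ! j - Y w) \<in> O[near0 (length L)](\<lambda>w. nrm w ^ K)) \<and>
     (\<forall>j<N. \<exists>m a. (\<forall>i. poly_fun (length L) (a i)) \<and> a m b \<noteq> 0 \<and>
        (\<forall>z\<in>S. (\<Sum>i\<le>m. a i (sel L z) * z ! j ^ i) = 0))"

lemma chartD:
  assumes "chart N L S b \<gamma> \<rho>"
  shows "\<rho> > 0" "length b = length L"
    "length w = length L \<Longrightarrow> (\<And>i. i < length L \<Longrightarrow> \<bar>w ! i\<bar> < \<rho>) \<Longrightarrow> \<gamma> w \<in> S"
    "length w = length L \<Longrightarrow> (\<And>i. i < length L \<Longrightarrow> \<bar>w ! i\<bar> < \<rho>) \<Longrightarrow> sel L (\<gamma> w) = vadd b w"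
    "j < N \<Longrightarrow> \<exists>Y. poly_fun (length L) Y \<and> (\<lambda>w. \<gamma> w ! j - Y w) \<in> O[near0 (length L)](\<lambda>w. nrm w ^ K)"
    "j < N \<Longrightarrow> \<exists>m a. (\<forall>i. poly_fun (length L) (a i)) \<and> a m b \<noteq> 0 \<and>
       (\<forall>z\<in>S. (\<Sum>i\<le>m. a i (sel L z) * z ! j ^ i) = 0)"
  using assms unfolding chart_def by simp_all

lemma chart_exists:
  assumes "semialg N S" "zar_irred N S" "set L \<subseteq> {..<N}" "indep_on (length L) (sel L) S"
    and "\<And>j. j < N \<Longrightarrow> alg_over (length L) (sel L) S (\<lambda>z. z ! j)"
  obtains b \<gamma> \<rho> where "chart N L S b \<gamma> \<rho>"
proof -
  obtain P \<gamma> where P: "P \<in> S" "eventually (\<lambda>w. \<gamma> w \<in> S \<and> sel L (\<gamma> w) = vadd (sel L P) w) (near0 (length L))"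
    "\<And>j K. j < N \<Longrightarrow> \<exists>Y. poly_fun (length L) Y \<and> (\<lambda>w. \<gamma> w ! j - Y w) \<in> O[near0 (length L)](\<lambda>w. nrm w ^ K)"
    "\<And>j. j < N \<Longrightarrow> \<exists>m a. (\<forall>i. poly_fun (length L) (a i)) \<and> a m (sel L P) \<noteq> 0 \<and>
       (\<forall>z\<in>S. (\<Sum>i\<le>m. a i (sel L z) * z ! j ^ i) = 0)"
    by (rule local_structure[OF assms(1-3) refl assms(4,5)]) (assumption, rule that)
  obtain \<rho> where "\<rho> > 0" "\<And>w. length w = length L \<Longrightarrow> (\<forall>i<length L. \<bar>w ! i - replicate (length L) 0 ! i\<bar> < \<rho>) \<Longrightarrow>
      \<gamma> w \<in> S \<and> sel L (\<gamma> w) = vadd (sel L P) w"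
    using P(2) unfolding eventually_near by blast
  then have "chart N L S (sel L P) \<gamma> \<rho>"
    unfolding chart_def using P(3,4) by simp
  then show thesis by (rule that)
qed

lemma smul_near0: "length w = d \<Longrightarrow> filterlim (\<lambda>t. smul t w) (near0 d) (at_right 0)"
  unfolding filterlim_def le_filter_def eventually_filtermap
proof (intro allI impI)
  fix P assume w: "length w = d" and "eventually P (near0 d)"
  then obtain \<delta> where \<delta>: "\<delta> > 0" "\<And>y. length y = d \<Longrightarrow> (\<forall>i<d. \<bar>y ! i\<bar> < \<delta>) \<Longrightarrow> P y"
    unfolding eventually_near by auto
  have "((\<lambda>t::real. t * w ! i) \<longlongrightarrow> 0 * w ! i) (at_right 0)" for i by (intro tendsto_intros)
  then have "eventually (\<lambda>t. dist (t * w ! i) (0 * w ! i) < \<delta>) (at_right 0)" for i using \<delta>(1) by (rule tendstoD)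
  then have "eventually (\<lambda>t. \<forall>i\<in>{..<d}. \<bar>t * w ! i\<bar> < \<delta>) (at_right 0)"
    by (intro eventually_ball_finite) (auto simp: dist_real_def)
  then show "eventually (\<lambda>t. P (smul t w)) (at_right 0)"
    by eventually_elim (use w in \<open>auto intro!: \<delta>(2)\<close>)
qed

lemma bigo_along_ray:
  assumes "f \<in> O[near0 d](\<lambda>w. nrm w ^ K)" "length c = d"
  shows "(\<lambda>t. f (smul t c)) \<in> O[at_right 0](\<lambda>t. t ^ K)"
proof -
  have "(\<lambda>t. f (smul t c)) \<in> O[at_right 0](\<lambda>t. nrm (smul t c) ^ K)"
    using landau_o.big.compose[OF assms(1) smul_near0[OF assms(2)]] .
  moreover have "(\<lambda>t::real. nrm (smul t c) ^ K) \<in> O[at_right 0](\<lambda>t. t ^ K)"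
    by (rule bigoI[of _ "nrm c ^ K"]) (simp add: nrm_smul power_mult_distrib abs_mult power_abs mult_ac)
  ultimately show ?thesis by (rule landau_o.big_trans)
qed

text \<open>The lines through the base point \<open>b\<close> of a chart form the pencil.  Along the line with direction \<open>c\<close>
  the Taylor coefficients of the \<open>\<phi> e\<close> are polynomials in \<open>c\<close>, so linear relations
  on the individual lines can be chosen polynomially in \<open>c\<close>; substituting \<open>c = sel L z - b\<close> gives a relation on \<open>S\<close>.\<close>
lemma pencil:
  assumes ch: "chart N L S b \<gamma> \<rho>" and S: "zar_irred N S" and L: "set L \<subseteq> {..<N}" and d: "d = length L"
    and alg: "\<And>j. j < N \<Longrightarrow> alg_over d (sel L) S (\<lambda>z. z ! j)"
    and I: "finite I" and \<phi>: "\<And>e. e \<in> I \<Longrightarrow> poly_fun N (\<phi> e)" and A: "zar_dense d A"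
    and ex: "\<And>c. c \<in> A \<Longrightarrow> \<exists>v. (\<exists>\<^sub>F t in at_right 0. (\<Sum>e\<in>I. \<phi> e (\<gamma> (smul t c)) * v e) = 0) \<and> (\<Sum>e\<in>I. l e c * v e) \<noteq> 0"
  shows "\<exists>v. (\<forall>e\<in>I. poly_fun d (v e)) \<and> (\<exists>c\<in>A. (\<Sum>e\<in>I. l e c * v e c) \<noteq> 0) \<and>
    (\<forall>z\<in>S. (\<Sum>e\<in>I. \<phi> e z * v e (vadd (map uminus b) (sel L z))) = 0)"
proof -
  have lb: "length b = d" using ch d by (simp add: chart_def)
  have \<gamma>S: "\<gamma> w \<in> S" "sel L (\<gamma> w) = vadd b w" if "length w = d" "\<forall>i<d. \<bar>w ! i\<bar> < \<rho>" for w
    using chartD(3,4)[OF ch, of w] that d by simp_all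
  have \<gamma>Y: "\<exists>Y. poly_fun d Y \<and> (\<lambda>w. \<gamma> w ! j - Y w) \<in> O[near0 d](\<lambda>w. nrm w ^ K)" if "j < N" for j K
    using chartD(5)[OF ch that, of K] d by simp
  have \<rho>: "\<rho> > 0" using ch by (simp add: chart_def)
  have appr: "\<exists>G. poly_fun d G \<and> (\<lambda>w. g (\<gamma> w) - G w) \<in> O[near0 d](\<lambda>w. nrm w ^ K)" if g: "poly_fun N g" for g K
  proof -
    have "\<forall>j. \<exists>Y. j < N \<longrightarrow> poly_fun d Y \<and> (\<lambda>w. \<gamma> w ! j - Y w) \<in> O[near0 d](\<lambda>w. nrm w ^ K)" using \<gamma>Y by blast
    from choice[OF this] obtain Y where "\<And>j. j < N \<Longrightarrow> poly_fun d (Y j)"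
      "\<And>j. j < N \<Longrightarrow> (\<lambda>w. \<gamma> w ! j - Y j w) \<in> O[near0 d](\<lambda>w. nrm w ^ K)" by blast
    then show ?thesis by (intro bigo_poly_compose[OF g])
  qed
  have "\<forall>x. \<exists>G. fst x \<in> I \<longrightarrow> poly_fun d G \<and> (\<lambda>w. \<phi> (fst x) (\<gamma> w) - G w) \<in> O[near0 d](\<lambda>w. nrm w ^ snd x)"
    using appr \<phi> by blast
  from choice[OF this] obtain \<psi>' where \<psi>': "\<And>x. fst x \<in> I \<Longrightarrow> poly_fun d (\<psi>' x)"
    "\<And>x. fst x \<in> I \<Longrightarrow> (\<lambda>w. \<phi> (fst x) (\<gamma> w) - \<psi>' x w) \<in> O[near0 d](\<lambda>w. nrm w ^ snd x)" by blast
  have "\<forall>x. \<exists>r. fst x \<in> I \<longrightarrow> (\<forall>k. poly_fun d (snd r k)) \<and> (\<forall>w\<in>Rn d. \<forall>t. \<psi>' x (smul t w) = (\<Sum>k<fst r. snd r k w * t ^ k)) \<and>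
    (\<forall>k. \<forall>w\<in>Rn d. \<forall>t. snd r k (smul t w) = t ^ k * snd r k w)"
  proof
    fix x
    show "\<exists>r. fst x \<in> I \<longrightarrow> (\<forall>k. poly_fun d (snd r k)) \<and> (\<forall>w\<in>Rn d. \<forall>t. \<psi>' x (smul t w) = (\<Sum>k<fst r. snd r k w * t ^ k)) \<and>
      (\<forall>k. \<forall>w\<in>Rn d. \<forall>t. snd r k (smul t w) = t ^ k * snd r k w)"
    proof (cases "fst x \<in> I")
      case True
      from homogeneous_parts[OF \<psi>'(1)[OF True]] obtain M h where
        "(\<forall>k. poly_fun d (h k)) \<and> (\<forall>w\<in>Rn d. \<forall>t. \<psi>' x (smul t w) = (\<Sum>k<M. h k w * t ^ k)) \<and>
         (\<forall>k. \<forall>w\<in>Rn d. \<forall>t. h k (smul t w) = t ^ k * h k w)" by blast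
      then show ?thesis by (intro exI[of _ "(M, h)"]) simp
    qed simp
  qed
  from choice[OF this] obtain r where r': "\<And>x. fst x \<in> I \<longrightarrow> (\<forall>k. poly_fun d (snd (r x) k)) \<and>
    (\<forall>w\<in>Rn d. \<forall>t. \<psi>' x (smul t w) = (\<Sum>k<fst (r x). snd (r x) k w * t ^ k)) \<and>
    (\<forall>k. \<forall>w\<in>Rn d. \<forall>t. snd (r x) k (smul t w) = t ^ k * snd (r x) k w)" by blast
  have r: "poly_fun d (snd (r x) k)"
    "length w = d \<Longrightarrow> \<psi>' x (smul t w) = (\<Sum>k<fst (r x). snd (r x) k w * t ^ k)"
    "length w = d \<Longrightarrow> snd (r x) k (smul t w) = t ^ k * snd (r x) k w" if "fst x \<in> I" for x k w t
    using r'[of x] that by simp_all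
  define \<psi> where "\<psi> e K = \<psi>' (e, K)" for e K
  define M where "M e K = fst (r (e, K))" for e K
  define h where "h e K k w = (if k < M e K then snd (r (e, K)) k w else 0)" for e K k w
  have h: "poly_fun d (h e K k)" if "e \<in> I" for e K k
    unfolding h_def using r(1)[of "(e, K)" k] that by (cases "k < M e K") (auto intro: poly_fun_intros)
  have hom: "h e K k (smul t w) = t ^ k * h e K k w" if "e \<in> I" "length w = d" for e K k t w
    using r(3)[of "(e, K)" w k t] that by (simp add: h_def)
  have \<psi>: "\<psi> e K (smul t w) = (\<Sum>k<M e K. h e K k w * t ^ k)" if "e \<in> I" "length w = d" for e K t w
    using r(2)[of "(e, K)" w t] that by (simp add: h_def \<psi>_def M_def)
  have O\<psi>: "(\<lambda>t. \<phi> e (\<gamma> (smul t c)) - \<psi> e K (smul t c)) \<in> O[at_right 0](\<lambda>t. t ^ K)" if "e \<in> I" "length c = d" for e K c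
    using bigo_along_ray[OF \<psi>'(2)[of "(e, K)"] that(2)] that(1) by (simp add: \<psi>_def)
  \<comment> \<open>The equation \<open>(K, k)\<close> with \<open>k < K\<close> says that the
    Taylor coefficient of order \<open>k\<close>, read off from the approximation of order
    \<open>K\<close>, vanishes. The other pairs give trivial equations.\<close>
  define rows where "rows x e c = (if snd x < fst x then h e (fst x) (snd x) c else 0)" for x :: "nat \<times> nat" and e c
  have "\<exists>v. (\<forall>e\<in>I. poly_fun d (v e)) \<and> (\<forall>x. \<forall>c\<in>Rn d. (\<Sum>e\<in>I. rows x e c * v e c) = 0) \<and>
    (\<exists>c\<in>A. (\<Sum>e\<in>I. l e c * v e c) \<noteq> 0)"
  proof (rule poly_kernel_lift[OF I _ A])
    show "poly_fun d (rows x e)" if "e \<in> I" for x e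
      unfolding rows_def using h[OF that] by (cases "snd x < fst x") (auto intro: poly_fun_intros)
    fix c assume c: "c \<in> A"
    then have lc: "length c = d" using A by (auto simp: zar_dense_def)
    obtain v where v: "\<exists>\<^sub>F t in at_right 0. (\<Sum>e\<in>I. \<phi> e (\<gamma> (smul t c)) * v e) = 0" "(\<Sum>e\<in>I. l e c * v e) \<noteq> 0"
      using ex[OF c] by blast
    \<comment> \<open>Restricting to the parameters where the relation holds turns frequent validity
      into eventual validity along a proper filter.\<close>
    define F where "F = inf (at_right 0) (principal {t. (\<Sum>e\<in>I. \<phi> e (\<gamma> (smul t c)) * v e) = 0})"
    have F: "F \<le> at_right 0" "F \<noteq> bot" using v(1)
      by (auto simp: F_def trivial_limit_def eventually_inf_principal frequently_def)
    have "(\<Sum>e\<in>I. rows (K, k) e c * v e) = 0" for K k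
    proof (cases "k < K")
      case True
      define p where "p = (\<Sum>e\<in>I. smult (v e) (\<Sum>k<M e K. monom (h e K k c) k))"
      have p: "poly p t = (\<Sum>e\<in>I. \<psi> e K (smul t c) * v e)" for t
        unfolding p_def by (simp add: poly_sum poly_monom \<psi>[OF _ lc] mult.commute)
      have "(\<lambda>t. \<Sum>e\<in>I. (\<phi> e (\<gamma> (smul t c)) - \<psi> e K (smul t c)) * v e) \<in> O[at_right 0](\<lambda>t. t ^ K)"
      proof (rule big_sum_in_bigo)
        fix e assume e: "e \<in> I"
        have "(\<lambda>t. (\<phi> e (\<gamma> (smul t c)) - \<psi> e K (smul t c)) * v e) \<in> O[at_right 0](\<lambda>t. t ^ K * 1)"
          by (intro landau_o.big.mult O\<psi>[OF e lc]) simp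
        then show "(\<lambda>t. (\<phi> e (\<gamma> (smul t c)) - \<psi> e K (smul t c)) * v e) \<in> O[at_right 0](\<lambda>t. t ^ K)" by simp
      qed
      then have "(\<lambda>t. \<Sum>e\<in>I. (\<phi> e (\<gamma> (smul t c)) - \<psi> e K (smul t c)) * v e) \<in> O[F](\<lambda>t. t ^ K)"
        by (rule landau_o.big.filter_mono[OF F(1)])
      moreover have "eventually (\<lambda>t. (\<Sum>e\<in>I. (\<phi> e (\<gamma> (smul t c)) - \<psi> e K (smul t c)) * v e) = - poly p t) F"
        unfolding F_def eventually_inf_principal
        by (auto simp: p left_diff_distrib sum_subtractf)
      ultimately have "(\<lambda>t. - poly p t) \<in> O[F](\<lambda>t. t ^ K)" by (subst (asm) landau_o.big.in_cong)
      then have "(\<lambda>t. poly p t) \<in> O[F](\<lambda>t. t ^ K)" by simp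
      then have "coeff p k = 0" by (rule poly_flat[OF F _ True])
      moreover have "coeff p k = (\<Sum>e\<in>I. v e * h e K k c)"
        unfolding p_def by (auto simp: coeff_sum if_distrib sum.delta h_def cong: if_cong intro!: sum.cong)
      ultimately show ?thesis using True by (simp add: rows_def mult.commute)
    qed (simp add: rows_def)
    then show "\<exists>v. (\<forall>x. (\<Sum>e\<in>I. rows x e c * v e) = 0) \<and> (\<Sum>e\<in>I. l e c * v e) \<noteq> 0"
      using v(2) by (intro exI[of _ v]) (auto simp: split_paired_all)
  qed
  then obtain v where v: "\<forall>e\<in>I. poly_fun d (v e)" "\<forall>x. \<forall>c\<in>Rn d. (\<Sum>e\<in>I. rows x e c * v e c) = 0"
    "\<exists>c\<in>A. (\<Sum>e\<in>I. l e c * v e c) \<noteq> 0" by blast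
  \<comment> \<open>The solution \<open>v\<close> lies in the kernel at every vector of R^d, in
    particular at all multiples of a direction; this allows \<open>c\<close> to be replaced by
    \<open>sel L z - b\<close>.\<close>
  define \<Phi> where "\<Phi> z = (\<Sum>e\<in>I. \<phi> e z * v e (vadd (map uminus b) (sel L z)))" for z
  have p\<Phi>: "poly_fun N \<Phi>"
    unfolding \<Phi>_def
  proof (intro poly_fun_intros \<phi>)
    fix e assume "e \<in> I"
    then have "poly_fun (length L) (\<lambda>x. v e (vadd (map uminus b) x))"
      using v(1) lb d by (intro poly_fun_vadd) auto
    then show "poly_fun N (\<lambda>z. v e (vadd (map uminus b) (sel L z)))" by (rule poly_fun_sel[OF _ L])
  qed
  have "\<Phi> z = 0" if z: "z \<in> S" for z
  proof (rule ccontr)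
    assume "\<Phi> z \<noteq> 0"
    then have nz: "\<exists>z\<in>S. \<Phi> z \<noteq> 0" using z by blast
    have alg': "alg_over (length L) (sel L) S (\<lambda>z. z ! j)" if "j < N" for j using alg[OF that] d by simp
    \<comment> \<open>If \<open>\<Phi>\<close> were nonzero on \<open>S\<close>, a multiple of it
      would be a nonzero polynomial \<open>a\<close> in \<open>sel L z\<close>. Flatness of
      \<open>\<Phi>\<close> on the line from \<open>b\<close> to a point \<open>x\<close> with
      \<open>a x \<noteq> 0\<close> then makes \<open>a\<close> zero on that line.\<close>
    obtain B a where Ba: "poly_fun N B" "poly_fun (length L) a" "\<exists>w\<in>Rn (length L). a w \<noteq> 0"
      "\<And>z. z \<in> S \<Longrightarrow> B z * \<Phi> z = a (sel L z)"
      by (rule zar_irred_norm[OF S L alg' p\<Phi> nz]) (assumption, rule that)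
    obtain x where x: "length x = d" "a x \<noteq> 0" using Ba(3) d by auto
    define w where "w = vadd (map uminus b) x"
    have w: "length w = d" "vadd b w = x" using lb x by (auto simp: w_def intro: nth_equalityI)
    obtain R where R: "\<And>t. a (vadd b (smul t w)) = poly R t" using poly_fun_line[OF _ lb w(1), of a] Ba(2) d by auto
    have small: "eventually (\<lambda>t. \<gamma> (smul t w) \<in> S \<and> sel L (\<gamma> (smul t w)) = vadd b (smul t w)) (at_right 0)"
    proof -
      have "eventually (\<lambda>u. \<gamma> u \<in> S \<and> sel L (\<gamma> u) = vadd b u) (near0 d)"
        unfolding eventually_near using \<gamma>S \<rho> by (intro exI[of _ \<rho>]) auto
      then show ?thesis using smul_near0[OF w(1)] by (rule eventually_compose_filterlim)
    qed
    have "coeff R k = 0" for k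
    proof (rule poly_flat[of "at_right 0" R "Suc k"])
      define K where "K = Suc k"
      have vO: "(\<lambda>t. v e (smul t w)) \<in> O[at_right 0](\<lambda>_. 1)" if "e \<in> I" for e
      proof -
        have "v e \<in> O[near0 d](\<lambda>w. nrm w ^ 0)" using v(1) that poly_fun_bigo_1[of d "v e"] by simp
        from bigo_along_ray[OF this w(1)] show ?thesis by simp
      qed
      have 1: "(\<lambda>t. \<Sum>e\<in>I. (\<phi> e (\<gamma> (smul t w)) - \<psi> e K (smul t w)) * v e (smul t w)) \<in> O[at_right 0](\<lambda>t. t ^ K)"
      proof (rule big_sum_in_bigo)
        fix e assume e: "e \<in> I"
        have "(\<lambda>t. (\<phi> e (\<gamma> (smul t w)) - \<psi> e K (smul t w)) * v e (smul t w)) \<in> O[at_right 0](\<lambda>t. t ^ K * 1)"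
          by (intro landau_o.big.mult O\<psi>[OF e w(1)] vO[OF e])
        then show "(\<lambda>t. (\<phi> e (\<gamma> (smul t w)) - \<psi> e K (smul t w)) * v e (smul t w)) \<in> O[at_right 0](\<lambda>t. t ^ K)" by simp
      qed
      \<comment> \<open>A common bound for all expansions, so that the sums over \<open>e\<close>
        and \<open>k\<close> can be exchanged.\<close>
      define M' where "M' = Max (insert K ((\<lambda>e. M e K) ` I))"
      have M': "M e K \<le> M'" if "e \<in> I" for e unfolding M'_def using I that by (intro Max_ge) auto
      have KM: "K \<le> M'" unfolding M'_def using I by (intro Max_ge) auto
      have \<psi>M: "\<psi> e K u = (\<Sum>k<M'. h e K k u)" if "e \<in> I" "length u = d" for e u
      proof -
        have "\<psi> e K u = (\<Sum>k<M e K. h e K k u)" using \<psi>[OF that, of K 1] by (simp add: smul_one)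
        also have "\<dots> = (\<Sum>k<M'. h e K k u)"
          by (rule sum.mono_neutral_left) (use M'[OF that(1)] in \<open>auto simp: h_def\<close>)
        finally show ?thesis .
      qed
      \<comment> \<open>The equations \<open>(K, k)\<close> at the vector \<open>smul t w\<close>
        remove all homogeneous parts of degree below \<open>K\<close>; each of the others
        contributes a factor \<open>t ^ k\<close> with \<open>k \<ge> K\<close>.\<close>
      have 2: "(\<Sum>e\<in>I. \<psi> e K (smul t w) * v e (smul t w)) = (\<Sum>k\<in>{K..<M'}. \<Sum>e\<in>I. t ^ k * (h e K k w * v e (smul t w)))" for t
      proof -
        have z: "(\<Sum>e\<in>I. h e K k (smul t w) * v e (smul t w)) = 0" if "k < K" for k
          using v(2)[rule_format, of "smul t w" "(K, k)"] that w by (simp add: rows_def)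
        have "(\<Sum>e\<in>I. \<psi> e K (smul t w) * v e (smul t w)) = (\<Sum>k<M'. \<Sum>e\<in>I. h e K k (smul t w) * v e (smul t w))"
          by (subst sum.swap) (simp add: \<psi>M w sum_distrib_right)
        also have "\<dots> = (\<Sum>k\<in>{K..<M'}. \<Sum>e\<in>I. h e K k (smul t w) * v e (smul t w))"
          by (rule sum.mono_neutral_right) (use z in auto)
        also have "\<dots> = (\<Sum>k\<in>{K..<M'}. \<Sum>e\<in>I. t ^ k * (h e K k w * v e (smul t w)))"
          by (intro sum.cong refl) (simp add: hom w mult_ac)
        finally show ?thesis .
      qed
      have "(\<lambda>t. \<Sum>e\<in>I. \<psi> e K (smul t w) * v e (smul t w)) \<in> O[at_right 0](\<lambda>t. t ^ K)"
        unfolding 2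
      proof (intro big_sum_in_bigo)
        fix k e assume ke: "k \<in> {K..<M'}" "e \<in> I"
        have tk: "(\<lambda>t::real. t ^ k) \<in> O[at_right 0](\<lambda>t. t ^ K)"
        proof (rule bigoI[of _ 1])
          have "eventually (\<lambda>t::real. 0 < t \<and> t < 1) (at_right 0)"
            using eventually_at_right_real[of 0 "1::real"] by (auto elim: eventually_mono)
          then show "eventually (\<lambda>t::real. norm (t ^ k) \<le> 1 * norm (t ^ K)) (at_right 0)"
            by eventually_elim (use ke in \<open>auto intro!: power_decreasing\<close>)
        qed
        have "(\<lambda>t. t ^ k * (h e K k w * v e (smul t w))) \<in> O[at_right 0](\<lambda>t. t ^ K * (1 * 1))"
          by (intro landau_o.big.mult tk vO ke) simp
        then show "(\<lambda>t. t ^ k * (h e K k w * v e (smul t w))) \<in> O[at_right 0](\<lambda>t. t ^ K)" by simp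
      qed
      from sum_in_bigo(1)[OF 1 this]
      have \<Phi>O: "(\<lambda>t. \<Sum>e\<in>I. \<phi> e (\<gamma> (smul t w)) * v e (smul t w)) \<in> O[at_right 0](\<lambda>t. t ^ K)"
        by (simp add: sum.distrib[symmetric] algebra_simps)
      obtain G where G: "poly_fun d G" "(\<lambda>w. B (\<gamma> w) - G w) \<in> O[near0 d](\<lambda>w. nrm w ^ 0)" using appr[OF Ba(1), of 0] by blast
      have "(\<lambda>w. (B (\<gamma> w) - G w) + G w) \<in> O[near0 d](\<lambda>w. nrm w ^ 0)"
        using G poly_fun_bigo_1[OF G(1)] by (intro sum_in_bigo(1)) auto
      then have "(\<lambda>w. B (\<gamma> w)) \<in> O[near0 d](\<lambda>w. nrm w ^ 0)" by simp
      from bigo_along_ray[OF this w(1)] have "(\<lambda>t. B (\<gamma> (smul t w))) \<in> O[at_right 0](\<lambda>_. 1)" by simp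
      from landau_o.big.mult[OF this \<Phi>O]
      have "(\<lambda>t. B (\<gamma> (smul t w)) * (\<Sum>e\<in>I. \<phi> e (\<gamma> (smul t w)) * v e (smul t w))) \<in> O[at_right 0](\<lambda>t. t ^ K)" by simp
      moreover have "eventually (\<lambda>t. B (\<gamma> (smul t w)) * (\<Sum>e\<in>I. \<phi> e (\<gamma> (smul t w)) * v e (smul t w)) = poly R t) (at_right 0)"
        using small
      proof eventually_elim
        case (elim t)
        have "vadd (map uminus b) (sel L (\<gamma> (smul t w))) = smul t w"
          using elim w lb by (intro nth_equalityI) auto
        then have "\<Phi> (\<gamma> (smul t w)) = (\<Sum>e\<in>I. \<phi> e (\<gamma> (smul t w)) * v e (smul t w))" by (simp add: \<Phi>_def)
        then show ?case using Ba(4)[of "\<gamma> (smul t w)"] elim R by simp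
      qed
      ultimately show "(\<lambda>t. poly R t) \<in> O[at_right 0](\<lambda>t. t ^ Suc k)"
        unfolding K_def by (subst (asm) landau_o.big.in_cong)
    qed auto
    then have "R = 0" by (simp add: poly_eq_iff)
    \<comment> \<open>At \<open>t = 1\<close> the line reaches \<open>x\<close>.\<close>
    then show False using R[of 1] w x by (simp add: smul_one)
  qed
  then show ?thesis using v by (auto simp: \<Phi>_def)
qed

section \<open>Curves\<close>

text \<open>The arc is covered by finitely many irreducible pieces. If each met some initial
  interval only countably often, the shortest of these intervals would be countable.\<close>

lemma arc_component:
  fixes X :: "real \<Rightarrow> real list"
  assumes "\<delta> > 0" "\<And>t. 0 < t \<Longrightarrow> t < \<delta> \<Longrightarrow> X t \<in> Rn n"
  obtains \<Theta> where "\<Theta> \<subseteq> {0<..<\<delta>}" "zar_irred n (X ` \<Theta>)" "\<And>\<epsilon>. \<epsilon> > 0 \<Longrightarrow> uncountable (\<Theta> \<inter> {0<..<\<epsilon>})"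
proof -
  define S where "S = X ` {0<..<\<delta>}"
  have "S \<subseteq> Rn n" using assms(2) by (auto simp: S_def)
  from zar_irred_decomp[OF this] obtain \<T> where T: "finite \<T>"
    "\<forall>T\<in>\<T>. alg_set n T \<and> zar_irred n (S \<inter> T)" "S \<subseteq> \<Union>\<T>" by (elim exE conjE)
  define \<Theta> where "\<Theta> T = {t\<in>{0<..<\<delta>}. X t \<in> T}" for T
  have im: "X ` \<Theta> T = S \<inter> T" for T by (auto simp: \<Theta>_def S_def)
  have "\<exists>T\<in>\<T>. \<forall>\<epsilon>>0. uncountable (\<Theta> T \<inter> {0<..<\<epsilon>})"
  proof (rule ccontr)
    assume no: "\<not> ?thesis"
    have "\<exists>\<epsilon>>0. countable (\<Theta> T \<inter> {0<..<\<epsilon>})" if T: "T \<in> \<T>" for T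
    proof (rule ccontr)
      assume "\<not> (\<exists>\<epsilon>>0. countable (\<Theta> T \<inter> {0<..<\<epsilon>}))"
      then have "\<forall>\<epsilon>>0. uncountable (\<Theta> T \<inter> {0<..<\<epsilon>})" by simp
      with T have "\<exists>T\<in>\<T>. \<forall>\<epsilon>>0. uncountable (\<Theta> T \<inter> {0<..<\<epsilon>})" by (rule bexI[rotated])
      with no show False by (rule notE)
    qed
    then have "\<forall>T\<in>\<T>. \<exists>\<epsilon>. \<epsilon> > 0 \<and> countable (\<Theta> T \<inter> {0<..<\<epsilon>})" by simp
    from bchoice[OF this] obtain \<epsilon> where \<epsilon>': "\<forall>T\<in>\<T>. \<epsilon> T > (0::real) \<and> countable (\<Theta> T \<inter> {0<..<\<epsilon> T})" ..
    then have \<epsilon>: "\<And>T. T \<in> \<T> \<Longrightarrow> \<epsilon> T > 0" "\<And>T. T \<in> \<T> \<Longrightarrow> countable (\<Theta> T \<inter> {0<..<\<epsilon> T})" by simp_all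
    define e where "e = Min (insert \<delta> (\<epsilon> ` \<T>))"
    have e: "e > 0" "e \<le> \<delta>" "\<And>T. T \<in> \<T> \<Longrightarrow> e \<le> \<epsilon> T"
      using T(1) \<epsilon>(1) assms(1) by (auto simp: e_def)
    have "countable (\<Union>T\<in>\<T>. \<Theta> T \<inter> {0<..<\<epsilon> T})"
      using T(1) \<epsilon>(2) by (intro countable_UN) (auto intro: countable_finite)
    moreover have "{0<..<e} \<subseteq> (\<Union>T\<in>\<T>. \<Theta> T \<inter> {0<..<\<epsilon> T})"
    proof
      fix t assume t: "t \<in> {0<..<e}"
      then have "X t \<in> S" using e(2) by (auto simp: S_def)
      then obtain T' where "T' \<in> \<T>" "X t \<in> T'" using T(3) by blast
      then show "t \<in> (\<Union>T\<in>\<T>. \<Theta> T \<inter> {0<..<\<epsilon> T})" using t e(2) e(3)[of T'] by (auto simp: \<Theta>_def)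
    qed
    ultimately show False using uncountable_open_interval[of 0 e] e(1) countable_subset by blast
  qed
  then obtain T' where T': "T' \<in> \<T>" "\<And>\<epsilon>. \<epsilon> > 0 \<Longrightarrow> uncountable (\<Theta> T' \<inter> {0<..<\<epsilon>})" by blast
  show thesis
  proof (rule that)
    show "\<Theta> T' \<subseteq> {0<..<\<delta>}" by (auto simp: \<Theta>_def)
    show "zar_irred n (X ` \<Theta> T')" using T(2) T'(1) im by simp
  qed (rule T'(2))
qed

lemma zar_irred_closure_irreducible:
  assumes "zar_irred n E" shows "alg_irreducible n (zar_closure n E)"
  unfolding alg_irreducible_def
proof (intro conjI allI impI)
  have E: "E \<subseteq> Rn n" "E \<noteq> {}" using assms by (auto simp: zar_irred_def)
  show "alg_set n (zar_closure n E)" by (rule alg_set_zar_closure[OF E(1)])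
  show "zar_closure n E \<noteq> {}" using E(2) subset_zar_closure[of E n] by blast
  fix A B assume AB: "alg_set n A \<and> alg_set n B \<and> zar_closure n E = A \<union> B"
  obtain p where p: "poly_fun n p" "A = {x\<in>Rn n. p x = 0}" using AB alg_set_zeroE by blast
  obtain q where q: "poly_fun n q" "B = {x\<in>Rn n. q x = 0}" using AB alg_set_zeroE by blast
  have "\<forall>x\<in>E. p x * q x = 0" using AB subset_zar_closure[of E n] p(2) q(2) by auto
  then have "(\<forall>x\<in>E. p x = 0) \<or> (\<forall>x\<in>E. q x = 0)" using assms p(1) q(1) unfolding zar_irred_def by blast
  then have "E \<subseteq> A \<or> E \<subseteq> B" using E(1) p(2) q(2) by blast
  then have "zar_closure n E \<subseteq> A \<or> zar_closure n E \<subseteq> B" using AB zar_closure_minimal by blast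
  then show "zar_closure n E = A \<or> zar_closure n E = B" using AB by blast
qed

text \<open>Dividing by \<open>s - a\<close> as often as possible keeps a relation nontrivial at the parameter value \<open>a\<close>.\<close>
lemma relation_at_value:
  fixes \<alpha> :: "nat \<Rightarrow> real poly"
  assumes E: "zar_irred n E" and T: "poly_fun n T" "infinite (T ` E)" and "j < n"
    and "\<exists>i\<le>m. \<alpha> i \<noteq> 0" "\<forall>x\<in>E. (\<Sum>i\<le>m. poly (\<alpha> i) (T x) * x ! j ^ i) = 0"
  shows "\<exists>\<alpha>'. (\<exists>i\<le>m. poly (\<alpha>' i) a \<noteq> 0) \<and> (\<forall>x\<in>E. (\<Sum>i\<le>m. poly (\<alpha>' i) (T x) * x ! j ^ i) = 0)"
  using assms(5,6)
proof (induction "\<Sum>i\<le>m. degree (\<alpha> i)" arbitrary: \<alpha> rule: less_induct)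
  case less
  show ?case
  proof (cases "\<exists>i\<le>m. poly (\<alpha> i) a \<noteq> 0")
    case True
    then show ?thesis using less.prems by blast
  next
    case False
    then have "\<forall>i. \<exists>b. i \<le> m \<longrightarrow> \<alpha> i = [:-a, 1:] * b" by (metis dvdE poly_eq_0_iff_dvd)
    from choice[OF this] obtain \<beta> where \<beta>: "\<And>i. i \<le> m \<Longrightarrow> \<alpha> i = [:-a, 1:] * \<beta> i" by blast
    have pT: "poly_fun n (\<lambda>x. poly r (T x))" for r
      by (induction r) (auto intro!: poly_fun_intros T)
    have "(\<Sum>i\<le>m. poly (\<beta> i) (T x) * x ! j ^ i) = 0" if x: "x \<in> E" for x
    proof -
      obtain y where y: "y \<in> E" "T y \<noteq> a"
        using T(2) finite_subset[of "T ` E" "{a}"] by auto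
      have 1: "poly_fun n (\<lambda>x. T x - a)" by (intro poly_fun_intros T)
      have 2: "poly_fun n (\<lambda>x. \<Sum>i\<le>m. poly (\<beta> i) (T x) * x ! j ^ i)"
        using \<open>j < n\<close> by (intro poly_fun_intros pT)
      show ?thesis
      proof (rule zar_irredD[OF E 1 2 y(1) _ _ x])
        show "T y - a \<noteq> 0" using y(2) by simp
        fix x assume "x \<in> E"
        then have "0 = (\<Sum>i\<le>m. poly (\<alpha> i) (T x) * x ! j ^ i)" using less.prems(2) by simp
        also have "\<dots> = (T x - a) * (\<Sum>i\<le>m. poly (\<beta> i) (T x) * x ! j ^ i)"
          unfolding sum_distrib_left by (rule sum.cong) (auto simp: \<beta> algebra_simps)
        finally show "(T x - a) * (\<Sum>i\<le>m. poly (\<beta> i) (T x) * x ! j ^ i) = 0" by simp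
      qed
    qed
    moreover obtain i where i: "i \<le> m" "\<beta> i \<noteq> 0"
    proof -
      obtain i where i: "i \<le> m" "\<alpha> i \<noteq> 0" using less.prems(1) by blast
      then have "\<beta> i \<noteq> 0" using \<beta>[OF i(1)] by auto
      then show thesis using that i(1) by blast
    qed
    moreover have "(\<Sum>i\<le>m. degree (\<beta> i)) < (\<Sum>i\<le>m. degree (\<alpha> i))"
    proof (rule sum_strict_mono_ex1)
      have deg: "degree (\<alpha> i) = (if \<beta> i = 0 then 0 else Suc (degree (\<beta> i)))" if "i \<le> m" for i
        using \<beta>[OF that] degree_mult_eq[of "[:-a, 1:]" "\<beta> i"] by auto
      then show "\<forall>i\<in>{..m}. degree (\<beta> i) \<le> degree (\<alpha> i)" by auto
      show "\<exists>i\<in>{..m}. degree (\<beta> i) < degree (\<alpha> i)" using deg i by (intro bexI[of _ i]) auto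
    qed simp
    ultimately show ?thesis using less.hyps[of \<beta>] by blast
  qed
qed

text \<open>Over a line each coordinate is algebraic over the parameter \<open>T\<close>. A proper
  algebraic subset is killed by some \<open>g\<close> not vanishing on \<open>E\<close>; the norm of
  \<open>g\<close> leaves finitely many values of \<open>T\<close> on it, and over each value every
  coordinate is a root of a nonzero polynomial.\<close>

lemma curve_of_arc:
  assumes E: "zar_irred n E" and L: "set L \<subseteq> {..<n}" and len: "length b = length L" "length c = length L"
    and rel: "\<And>j. j < n \<Longrightarrow> \<exists>m a. (\<forall>i. poly_fun (length L) (a i)) \<and> a m b \<noteq> 0 \<and>
        (\<forall>x\<in>E. (\<Sum>i\<le>m. a i (sel L x) * x ! j ^ i) = 0)"
    and line: "\<And>x. x \<in> E \<Longrightarrow> \<exists>t. sel L x = vadd b (smul t c)"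
    and i0: "i0 < length L" "c ! i0 \<noteq> 0" and inf: "infinite (sel L ` E)"
  shows "alg_curve n (zar_closure n E)"
proof -
  define C where "C = zar_closure n E"
  have ER: "E \<subseteq> Rn n" using E by (auto simp: zar_irred_def)
  have EC: "E \<subseteq> C" by (simp add: C_def subset_zar_closure)
  have C0: "p x = 0" if "poly_fun n p" "\<And>x. x \<in> E \<Longrightarrow> p x = 0" "x \<in> C" for p x
    using that zar_closure_eq[OF ER] by (auto simp: C_def)
  define k where "k = L ! i0"
  have "k \<in> set L" using i0(1) by (simp add: k_def)
  then have k: "k < n" using L by auto
  \<comment> \<open>The line parameter, read off from a coordinate in which the direction is
    nonzero.\<close>
  define T where "T x = (x ! k - b ! i0) / c ! i0" for x
  have pT: "poly_fun n T" unfolding T_def divide_inverse by (intro poly_fun_intros k)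
  have selT: "sel L x = vadd b (smul (T x) c)" if x: "x \<in> E" for x
  proof -
    obtain t where t: "sel L x = vadd b (smul t c)" using line[OF x] by blast
    then have "sel L x ! i0 = vadd b (smul t c) ! i0" by simp
    then have "x ! k = b ! i0 + t * c ! i0" using i0(1) len by (simp add: k_def sel_def)
    then have "t = T x" using i0(2) by (simp add: T_def)
    then show ?thesis using t by simp
  qed
  have infT: "infinite (T ` E)"
  proof
    assume "finite (T ` E)"
    then have "finite ((\<lambda>t. vadd b (smul t c)) ` (T ` E))" by simp
    moreover have "sel L ` E \<subseteq> (\<lambda>t. vadd b (smul t c)) ` (T ` E)" using selT by blast
    ultimately show False using inf finite_subset by blast
  qed
  have relT: "\<exists>m \<alpha>. (\<exists>i\<le>m. \<alpha> i \<noteq> 0) \<and> (\<forall>x\<in>E. (\<Sum>i\<le>m. poly (\<alpha> i) (T x) * x ! j ^ i) = 0)" if j: "j < n" for j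
  proof -
    obtain m a where a: "\<forall>i. poly_fun (length L) (a i)" "a m b \<noteq> 0"
      "\<forall>x\<in>E. (\<Sum>i\<le>m. a i (sel L x) * x ! j ^ i) = 0" using rel[OF j] by blast
    have "\<forall>i. \<exists>r. \<forall>t. a i (vadd b (smul t c)) = poly r t" using poly_fun_line a(1) len by blast
    from choice[OF this] obtain \<alpha> where \<alpha>: "\<And>i t. a i (vadd b (smul t c)) = poly (\<alpha> i) t" by blast
    \<comment> \<open>At parameter 0 the leading coefficient is \<open>a m b\<close>, so the
      relation stays nontrivial on the line.\<close>
    have "vadd b (smul 0 c) = b" using len by (intro nth_equalityI) auto
    then have "\<alpha> m \<noteq> 0" using \<alpha>[of m 0] a(2) by auto
    moreover have "\<forall>x\<in>E. (\<Sum>i\<le>m. poly (\<alpha> i) (T x) * x ! j ^ i) = 0" using a(3) selT \<alpha> by simp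
    ultimately show ?thesis by blast
  qed
  have alg: "alg_over (length [k]) (sel [k]) E (\<lambda>x. x ! j)" if j: "j < n" for j
  proof -
    obtain m \<alpha> where \<alpha>: "\<exists>i\<le>m. \<alpha> i \<noteq> 0" "\<forall>x\<in>E. (\<Sum>i\<le>m. poly (\<alpha> i) (T x) * x ! j ^ i) = 0"
      using relT[OF j] by blast
    define a where "a i w = poly (\<alpha> i) ((w ! 0 - b ! i0) / c ! i0)" for i and w :: "real list"
    have "poly_fun 1 (\<lambda>w. poly r ((w ! 0 - b ! i0) / c ! i0))" for r
      unfolding divide_inverse by (induction r) (auto intro!: poly_fun_intros)
    then have "\<forall>i. poly_fun 1 (a i)" by (simp add: a_def[abs_def])
    moreover have "\<exists>i\<le>m. \<exists>w\<in>Rn 1. a i w \<noteq> 0"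
    proof -
      obtain i t where "i \<le> m" "poly (\<alpha> i) t \<noteq> 0" using \<alpha>(1) poly_all_0_iff_0 by blast
      then show ?thesis using i0(2) by (intro exI[of _ i] conjI bexI[of _ "[b ! i0 + t * c ! i0]"]) (auto simp: a_def)
    qed
    moreover have "\<forall>x\<in>E. (\<Sum>i\<le>m. a i (sel [k] x) * x ! j ^ i) = 0"
      using \<alpha>(2) by (simp add: a_def sel_def T_def)
    ultimately show ?thesis unfolding alg_over_def by auto
  qed
  have "finite S" if S: "alg_set n S" "S \<subset> C" for S
  proof -
    obtain g where g: "poly_fun n g" "S = {x\<in>Rn n. g x = 0}" using S(1) by (rule alg_set_zeroE)
    have "\<exists>x\<in>E. g x \<noteq> 0"
    proof (rule ccontr)
      assume "\<not> ?thesis"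
      then have "E \<subseteq> S" using g(2) ER by blast
      then have "C \<subseteq> S" unfolding C_def by (rule zar_closure_minimal[OF S(1)])
      then show False using S(2) by blast
    qed
    moreover have "set [k] \<subseteq> {..<n}" using k by simp
    ultimately obtain B a where Ba: "poly_fun n B" "poly_fun (length [k]) a" "\<exists>w\<in>Rn (length [k]). a w \<noteq> 0"
      "\<And>z. z \<in> E \<Longrightarrow> B z * g z = a (sel [k] z)"
      using zar_irred_norm[OF E _ alg g(1)] by blast
    have "B z * g z - a (sel [k] z) = 0" if "z \<in> C" for z
    proof (rule C0[OF _ _ that])
      show "poly_fun n (\<lambda>z. B z * g z - a (sel [k] z))"
        using k by (intro poly_fun_intros Ba(1) g(1) poly_fun_sel[OF Ba(2)]) auto
    qed (simp add: Ba)
    then have aS: "a [z ! k] = 0" if "z \<in> S" for z using that S(2) g(2) by (force simp: sel_def)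
    obtain w0 where w0: "a [w0] \<noteq> 0" using Ba(3) by (auto simp: length_Suc_conv)
    have finA: "finite {t. a [t] = 0}" using finite_zeros_last[of 0 a "[]" w0] Ba(2) w0 by simp
    define D where "D = (\<lambda>t. (t - b ! i0) / c ! i0) ` {t. a [t] = 0}"
    have D: "finite D" "\<And>z. z \<in> S \<Longrightarrow> T z \<in> D" using finA aS by (auto simp: D_def T_def)
    have fin: "finite ((\<lambda>z. z ! j) ` S)" if j: "j < n" for j
    proof -
      obtain m \<alpha> where \<alpha>: "\<exists>i\<le>m. \<alpha> i \<noteq> 0" "\<forall>x\<in>E. (\<Sum>i\<le>m. poly (\<alpha> i) (T x) * x ! j ^ i) = 0"
        using relT[OF j] by blast
      have "finite {y. \<exists>z\<in>S. T z = s \<and> z ! j = y}" for s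
      proof -
        \<comment> \<open>The original relation may vanish identically at the value
          \<open>s\<close>; its replacement does not.\<close>
        obtain \<alpha>' where \<alpha>': "\<exists>i\<le>m. poly (\<alpha>' i) s \<noteq> 0" "\<forall>x\<in>E. (\<Sum>i\<le>m. poly (\<alpha>' i) (T x) * x ! j ^ i) = 0"
          using relation_at_value[OF E pT infT j \<alpha>] by blast
        have pp: "poly_fun n (\<lambda>x. poly r (T x))" for r
          by (induction r) (auto intro!: poly_fun_intros pT)
        define r where "r = (\<Sum>i\<le>m. monom (poly (\<alpha>' i) s) i)"
        obtain i where i: "i \<le> m" "poly (\<alpha>' i) s \<noteq> 0" using \<alpha>'(1) by blast
        have "coeff r i = poly (\<alpha>' i) s" using i(1) by (simp add: r_def coeff_sum if_distrib sum.delta)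
        then have "r \<noteq> 0" using i(2) by auto
        then have "finite {y. poly r y = 0}" by (rule poly_roots_finite)
        moreover have "{y. \<exists>z\<in>S. T z = s \<and> z ! j = y} \<subseteq> {y. poly r y = 0}"
        proof safe
          fix z assume z: "z \<in> S" "s = T z"
          have "poly_fun n (\<lambda>x. \<Sum>i\<le>m. poly (\<alpha>' i) (T x) * x ! j ^ i)" using j by (intro poly_fun_intros pp)
          then have "(\<Sum>i\<le>m. poly (\<alpha>' i) (T z) * z ! j ^ i) = 0" using C0 \<alpha>'(2) S(2) z(1) by blast
          then show "poly r (z ! j) = 0" using z(2) by (simp add: r_def poly_sum poly_monom)
        qed
        ultimately show ?thesis by (rule rev_finite_subset)
      qed
      then have "finite (\<Union>s\<in>D. {y. \<exists>z\<in>S. T z = s \<and> z ! j = y})" using D(1) by blast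
      moreover have "(\<lambda>z. z ! j) ` S \<subseteq> (\<Union>s\<in>D. {y. \<exists>z\<in>S. T z = s \<and> z ! j = y})" using D(2) by blast
      ultimately show ?thesis by (rule rev_finite_subset)
    qed
    define F where "F = (\<Union>j<n. (\<lambda>z. z ! j) ` S)"
    have "finite F" unfolding F_def using fin by blast
    then have "finite {xs. set xs \<subseteq> F \<and> length xs = n}" by (rule finite_lists_length_eq)
    moreover have "S \<subseteq> {xs. set xs \<subseteq> F \<and> length xs = n}"
    proof safe
      fix x y assume x: "x \<in> S" and "y \<in> set x"
      moreover have "length x = n" using x g(2) by simp
      ultimately obtain j where "j < n" "y = x ! j" by (auto simp: in_set_conv_nth)
      then show "y \<in> F" using x by (auto simp: F_def)
    next
      fix x assume "x \<in> S"
      then show "length x = n" using g(2) by simp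
    qed
    ultimately show ?thesis by (rule rev_finite_subset)
  qed
  moreover have "infinite C" using inf EC finite_subset by blast
  ultimately show ?thesis using zar_irred_closure_irreducible[OF E] by (simp add: alg_curve_def C_def)
qed

text \<open>An enumeration of the monomials: \<open>from_nat e\<close> decodes to a list of variable
  indices, and those out of range are skipped. Monomials recur, so this is a spanning sequence and
  not a basis.\<close>

definition mono_fun :: "nat \<Rightarrow> nat \<Rightarrow> real list \<Rightarrow> real" where
  "mono_fun n e x = (\<Prod>k\<leftarrow>filter (\<lambda>k. k < n) (from_nat e). x ! k)"

lemma poly_fun_mono_fun: "poly_fun n (mono_fun n e)"
proof -
  have "poly_fun n (\<lambda>x. \<Prod>k\<leftarrow>filter (\<lambda>k. k < n) ks. x ! k)" for ks
    by (induction ks) (auto intro: poly_fun_intros)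
  then show ?thesis by (simp add: mono_fun_def[abs_def])
qed

text \<open>The same coefficients serve every larger bound, so several polynomials can share one.
  Natural numbers as bounds are what makes the cover by degrees countable.\<close>

lemma poly_fun_mono_span:
  assumes "poly_fun n p"
  shows "\<exists>D u. \<forall>D'\<ge>D. \<forall>x. p x = (\<Sum>e<D'. u e * mono_fun n e x)"
proof -
  define S where "S p \<longleftrightarrow> (\<exists>D u. \<forall>D'\<ge>D. \<forall>x. p x = (\<Sum>e<D'. u e * mono_fun n e x))" for p
  have S_mono: "S (\<lambda>x. c * mono_fun n e x)" for c e
    unfolding S_def
    by (intro exI[of _ "Suc e"] exI[of _ "\<lambda>i. if i = e then c else 0"])
       (auto simp: if_distribR if_distrib sum.delta cong: if_cong)
  have S_add: "S (\<lambda>x. p x + q x)" if pq: "S p" "S q" for p q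
  proof -
    obtain D u where u: "\<forall>D'\<ge>D. \<forall>x. p x = (\<Sum>e<D'. u e * mono_fun n e x)" using pq(1) unfolding S_def by blast
    obtain D1 u1 where u1: "\<forall>D'\<ge>D1. \<forall>x. q x = (\<Sum>e<D'. u1 e * mono_fun n e x)" using pq(2) unfolding S_def by blast
    have "p x + q x = (\<Sum>e<D'. (u e + u1 e) * mono_fun n e x)" if "D' \<ge> max D D1" for D' x
      using u[rule_format, of D' x] u1[rule_format, of D' x] that by (simp add: sum.distrib distrib_right)
    then show ?thesis unfolding S_def by (intro exI[of _ "max D D1"] exI[of _ "\<lambda>e. u e + u1 e"]) blast
  qed
  have S_zero: "S (\<lambda>x. 0)" using S_mono[of 0] by simp
  have S_sum: "S (\<lambda>x. \<Sum>i\<in>I. f i x)" if "\<And>i. i \<in> I \<Longrightarrow> S (f i)" for I :: "(nat \<times> nat) set" and f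
    using that by (induction I rule: infinite_finite_induct) (auto intro: S_add S_zero)
  have mult: "mono_fun n e x * mono_fun n e' x =
      mono_fun n (to_nat ((from_nat e :: nat list) @ from_nat e')) x" for e e' x
    by (simp add: mono_fun_def)
  have one: "mono_fun n (to_nat ([] :: nat list)) x = 1" for x by (simp add: mono_fun_def)
  from assms have "S p"
  proof induction
    case (pf_const c)
    show ?case using S_mono[of c "to_nat ([] :: nat list)"] by (simp add: one)
  next
    case (pf_var i)
    have "mono_fun n (to_nat [i]) x = x ! i" for x using pf_var by (simp add: mono_fun_def)
    then show ?case using S_mono[of 1 "to_nat [i]"] by simp
  next
    case (pf_add p q)
    then show ?case by (intro S_add)
  next
    case (pf_mult p q)
    obtain D u where u: "\<And>x. p x = (\<Sum>e<D. u e * mono_fun n e x)" using pf_mult.IH(1) unfolding S_def by blast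
    obtain D' u' where u': "\<And>x. q x = (\<Sum>e<D'. u' e * mono_fun n e x)" using pf_mult.IH(2) unfolding S_def by blast
    have "p x * q x = (\<Sum>(e,e')\<in>{..<D}\<times>{..<D'}. (u e * u' e') * mono_fun n (to_nat ((from_nat e :: nat list) @ from_nat e')) x)" for x
      unfolding u u' sum_product sum.cartesian_product
      by (rule sum.cong) (auto simp: mult[symmetric] mult_ac)
    moreover have "S (\<lambda>x. \<Sum>(e,e')\<in>{..<D}\<times>{..<D'}. (u e * u' e') * mono_fun n (to_nat ((from_nat e :: nat list) @ from_nat e')) x)"
      unfolding split_def by (intro S_sum S_mono)
    ultimately show ?case by simp
  qed
  then show ?thesis unfolding S_def .
qed

text \<open>Used with \<open>Good D\<close> bounding the degree of a relation on the curve of a pencil by \<open>D\<close>.\<close>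
lemma zar_dense_cover:
  fixes Good :: "nat \<Rightarrow> real list \<Rightarrow> bool"
  assumes "d > 0" "length c0 = d" "\<epsilon> > 0"
    and ray: "\<And>c. length c = d \<Longrightarrow> (\<forall>i<d. \<bar>c ! i - c0 ! i\<bar> < \<epsilon>) \<Longrightarrow> c ! 0 \<noteq> 0 \<Longrightarrow>
      uncountable {t. \<exists>D. Good D (smul t c)}"
  shows "\<exists>D. zar_dense d {c\<in>Rn d. Good D c}"
proof (rule ccontr)
  assume "\<not> ?thesis"
  then have "\<forall>D. \<exists>g. poly_fun d g \<and> (\<forall>c\<in>Rn d. Good D c \<longrightarrow> g c = 0) \<and> (\<exists>w\<in>Rn d. g w \<noteq> 0)"
    unfolding zar_dense_def by blast
  from choice[OF this] obtain g where g: "\<And>D. poly_fun d (g D)"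
    "\<And>D c. length c = d \<Longrightarrow> Good D c \<Longrightarrow> g D c = 0" "\<And>D. \<exists>w\<in>Rn d. g D w \<noteq> 0" by (auto simp: Rn_def)
  \<comment> \<open>The extra first member \<open>w ! 0\<close> makes the chosen direction satisfy
    \<open>c ! 0 \<noteq> 0\<close>.\<close>
  define h where "h k = (case k of 0 \<Rightarrow> (\<lambda>w. w ! 0) | Suc D \<Rightarrow> g D)" for k
  have "\<exists>w\<in>Rn d. (\<forall>i<d. \<bar>w ! i - c0 ! i\<bar> < \<epsilon>) \<and> (\<forall>k. h k w \<noteq> 0)"
  proof (rule avoid_countable[OF _ _ assms(2,3)])
    fix k
    show "poly_fun d (h k)" using g(1) assms(1) by (auto simp: h_def intro: poly_fun_intros split: nat.split)
    have "\<exists>w\<in>Rn d. w ! 0 \<noteq> 0" using assms(1) by (intro bexI[of _ "replicate d 1"]) auto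
    then show "\<exists>w\<in>Rn d. h k w \<noteq> 0" using g(3) by (auto simp: h_def split: nat.split)
  qed
  then obtain c where c: "length c = d" "\<forall>i<d. \<bar>c ! i - c0 ! i\<bar> < \<epsilon>" "\<And>k. h k c \<noteq> 0" by auto
  have "finite {t. g D (smul t c) = 0}" for D
  proof -
    obtain r where r: "\<And>t. g D (smul t c) = poly r t" using poly_fun_ray[OF g(1) c(1)] by blast
    \<comment> \<open>Since \<open>g D\<close> is nonzero at \<open>t = 1\<close>, each
      \<open>Good D\<close> holds for finitely many scalings of \<open>c\<close> only, against
      \<open>ray\<close>.\<close>
    have "r \<noteq> 0" using r[of 1] c(3)[of "Suc D"] by (auto simp: smul_one h_def)
    then show ?thesis unfolding r by (rule poly_roots_finite)
  qed
  then have "countable (\<Union>D. {t. g D (smul t c) = 0})" by (intro countable_UN) (auto intro: countable_finite)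
  moreover have "{t. \<exists>D. Good D (smul t c)} \<subseteq> (\<Union>D. {t. g D (smul t c) = 0})"
  proof
    fix t assume "t \<in> {t. \<exists>D. Good D (smul t c)}"
    then obtain D where "Good D (smul t c)" by blast
    then have "g D (smul t c) = 0" using c(1) by (intro g(2)) auto
    then show "t \<in> (\<Union>D. {t. g D (smul t c) = 0})" by blast
  qed
  ultimately have "countable {t. \<exists>D. Good D (smul t c)}" by (rule countable_subset[rotated])
  moreover have "c ! 0 \<noteq> 0" using c(3)[of 0] by (simp add: h_def)
  ultimately show False using ray[OF c(1,2)] by blast
qed

section \<open>Rationality on irreducible sets\<close>

lemma sel_take: "set L \<subseteq> {..<n} \<Longrightarrow> sel L (take n z) = sel L z"
  by (auto simp: sel_def)

lemma graph_memD:
  assumes "S \<subseteq> {x @ [f x] |x. x \<in> V}" "V \<subseteq> Rn n" "z \<in> S"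
  shows "take n z \<in> V" "z ! n = f (take n z)" "z = take n z @ [f (take n z)]"
proof -
  obtain x where "z = x @ [f x]" "x \<in> V" using assms(1,3) by blast
  moreover from this have "length x = n" using assms(2) by auto
  ultimately show "take n z \<in> V" "z ! n = f (take n z)" "z = take n z @ [f (take n z)]"
    by (auto simp: nth_append)
qed

lemma alg_over_pullback:
  assumes "alg_over d \<pi> E h" "\<And>e. e \<in> E' \<Longrightarrow> g e \<in> E" "\<And>e. e \<in> E' \<Longrightarrow> \<pi>' e = \<pi> (g e)" "\<And>e. e \<in> E' \<Longrightarrow> h' e = h (g e)"
  shows "alg_over d \<pi>' E' h'"
proof -
  obtain m a where a: "\<forall>i. poly_fun d (a i)" "\<exists>i\<le>m. \<exists>w\<in>Rn d. a i w \<noteq> 0"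
    "\<forall>e\<in>E. (\<Sum>i\<le>m. a i (\<pi> e) * h e ^ i) = 0" using assms(1) unfolding alg_over_def by blast
  then have "\<forall>e\<in>E'. (\<Sum>i\<le>m. a i (\<pi>' e) * h' e ^ i) = 0" using assms(2-4) by simp
  then show ?thesis unfolding alg_over_def using a(1,2) by blast
qed

text \<open>The Zariski closure of the projection of \<open>S\<close> contains
  \<open>V\<close>.\<close>

definition dominates :: "nat \<Rightarrow> real list set \<Rightarrow> real list set \<Rightarrow> bool" where
  "dominates n S V \<longleftrightarrow> (\<forall>g. poly_fun n g \<longrightarrow> (\<forall>z\<in>S. g (take n z) = 0) \<longrightarrow> (\<forall>x\<in>V. g x = 0))"

text \<open>If no irreducible piece dominated, each would have a polynomial vanishing on its
  projection but not on \<open>V\<close>; their product would contradict the domination by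
  \<open>G\<close>.\<close>

lemma dominant_piece:
  assumes V: "zar_irred n V" and G: "semialg (Suc n) G" "G \<subseteq> Rn (Suc n)" "dominates n G V"
  obtains S where "S \<subseteq> G" "semialg (Suc n) S" "zar_irred (Suc n) S" "dominates n S V"
proof -
  from zar_irred_decomp[OF G(2)] obtain \<T> where T: "finite \<T>"
    "\<forall>T\<in>\<T>. alg_set (Suc n) T \<and> zar_irred (Suc n) (G \<inter> T)" "G \<subseteq> \<Union>\<T>" by (elim exE conjE)
  have "\<exists>T\<in>\<T>. dominates n (G \<inter> T) V"
  proof (rule ccontr)
    assume no: "\<not> ?thesis"
    have "\<exists>g. poly_fun n g \<and> (\<forall>z\<in>G \<inter> T. g (take n z) = 0) \<and> (\<exists>x\<in>V. g x \<noteq> 0)" if "T \<in> \<T>" for T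
      using no that unfolding dominates_def by blast
    then have "\<forall>T\<in>\<T>. \<exists>g. poly_fun n g \<and> (\<forall>z\<in>G \<inter> T. g (take n z) = 0) \<and> (\<exists>x\<in>V. g x \<noteq> 0)" by blast
    from bchoice[OF this] obtain g where g: "\<forall>T\<in>\<T>. poly_fun n (g T) \<and> (\<forall>z\<in>G \<inter> T. g T (take n z) = 0) \<and> (\<exists>x\<in>V. g T x \<noteq> 0)" ..
    have "\<exists>x\<in>V. \<forall>T\<in>\<T>. g T x \<noteq> 0" using g by (intro zar_irred_prod[OF V T(1)]) auto
    then have 1: "\<exists>x\<in>V. (\<Prod>T\<in>\<T>. g T x) \<noteq> 0" using T(1) by auto
    have "poly_fun n (\<lambda>x. \<Prod>T\<in>\<T>. g T x)" using g by (intro poly_fun_intros) auto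
    moreover have "(\<Prod>T\<in>\<T>. g T (take n z)) = 0" if "z \<in> G" for z
    proof -
      have "z \<in> \<Union>\<T>" using T(3) that by blast
      then obtain T where "T \<in> \<T>" "z \<in> T" by (rule UnionE)
      then show ?thesis using g that T(1) by (auto simp: prod_zero_iff)
    qed
    ultimately show False using G(3) 1 unfolding dominates_def by blast
  qed
  then obtain T' where "T' \<in> \<T>" "dominates n (G \<inter> T') V" by blast
  then show thesis using that[of "G \<inter> T'"] T(2) sa_inter[OF G(1) semialg_alg_set] by blast
qed

text \<open>Domination carries the independence of the coordinates \<open>L\<close> from
  \<open>V\<close> to \<open>S\<close>; the last coordinate is algebraic by
  \<open>graph_last_alg\<close>.\<close>

lemma graph_chart:
  assumes V: "zar_irred n V" and L: "set L \<subseteq> {..<n}" and ind: "indep_on (length L) (sel L) V"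
    and alg: "\<And>j. j < n \<Longrightarrow> alg_over (length L) (sel L) V (\<lambda>x. x ! j)"
    and S: "S \<subseteq> {x @ [f x] |x. x \<in> V}" "semialg (Suc n) S" "zar_irred (Suc n) S" "dominates n S V"
  shows "\<And>j. j < Suc n \<Longrightarrow> alg_over (length L) (sel L) S (\<lambda>z. z ! j)" "\<exists>b \<gamma> \<rho>. chart (Suc n) L S b \<gamma> \<rho>"
proof -
  have len: "length x = n" if "x \<in> V" for x using V that by (auto simp: zar_irred_def)
  have tk: "take n z \<in> V" if "z \<in> S" for z using S(1) that len by auto
  show algS: "alg_over (length L) (sel L) S (\<lambda>z. z ! j)" if j: "j < Suc n" for j
  proof (cases "j = n")
    case True
    then show ?thesis using graph_last_alg[OF V L alg S(2,1)] by simp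
  next
    case False
    then have "j < n" using j by simp
    show ?thesis
      by (rule alg_over_pullback[OF alg[OF \<open>j < n\<close>], of S "take n"]) (use tk \<open>j < n\<close> in \<open>auto simp: sel_take[OF L]\<close>)
  qed
  have "indep_on (length L) (sel L) S"
    unfolding indep_on_def
  proof (intro allI impI)
    fix a assume a: "poly_fun (length L) a" "\<forall>e\<in>S. a (sel L e) = 0"
    have "poly_fun n (\<lambda>x. a (sel L x))" by (rule poly_fun_sel[OF a(1) L])
    then have "\<forall>x\<in>V. a (sel L x) = 0"
      using S(4) a(2) unfolding dominates_def by (auto simp: sel_take[OF L])
    then show "\<forall>w\<in>Rn (length L). a w = 0" using ind a(1) unfolding indep_on_def by blast
  qed
  moreover have "set L \<subseteq> {..<Suc n}" using L by auto
  ultimately show "\<exists>b \<gamma> \<rho>. chart (Suc n) L S b \<gamma> \<rho>"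
    using chart_exists[OF S(2,3) _ _ algS] by blast
qed

text \<open>For rescaled vectors: the ray through \<open>smul t0 c\<close> is the ray through
  \<open>c\<close> with its parameters divided by \<open>t0\<close>.\<close>

lemma frequently_scaled:
  assumes "\<And>\<epsilon>. \<epsilon> > 0 \<Longrightarrow> uncountable (\<Theta> \<inter> {0<..<\<epsilon>})" "t0 > (0::real)"
  shows "\<exists>\<^sub>F t in at_right 0. t * t0 \<in> \<Theta>"
  unfolding frequently_def
proof
  assume "eventually (\<lambda>t. t * t0 \<notin> \<Theta>) (at_right 0)"
  then obtain b where b: "b > 0" "\<And>t. t > 0 \<Longrightarrow> t < b \<Longrightarrow> t * t0 \<notin> \<Theta>"
    unfolding eventually_at_right_field by auto
  have "uncountable (\<Theta> \<inter> {0<..<b * t0})" using assms b(1) by simp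
  then obtain s where s: "s \<in> \<Theta>" "0 < s" "s < b * t0" by (metis IntE countable_empty equals0I greaterThanLessThan_iff)
  then show False using b(2)[of "s / t0"] assms(2) by (simp add: field_simps)
qed

lemma uncountable_minus_finite: "uncountable A \<Longrightarrow> finite B \<Longrightarrow> uncountable (A - B)"
  using uncountable_minus_countable countable_finite by blast

text \<open>Applies the hypothesis on curves to the closure \<open>C\<close> of one component of the
  lifted line. A polynomial vanishes on all of \<open>C\<close> or at finitely many of its points,
  so the zeros of \<open>q\<close> can be removed from \<open>\<Theta>\<close> without changing the
  closure.\<close>

lemma arc_curve:
  assumes V: "zar_irred n V" and L: "set L \<subseteq> {..<n}"
    and S: "S \<subseteq> {x @ [f x] |x. x \<in> V}" and ch: "chart (Suc n) L S b \<gamma> \<rho>"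
    and curves: "\<forall>C. alg_curve n C \<longrightarrow> C \<subseteq> zar_closure n V \<longrightarrow> rational_on n (V \<inter> C) f"
    and c: "length c = length L" "i0 < length L" "c ! i0 \<noteq> 0"
    and \<delta>: "\<delta> > 0" "\<forall>t i. 0 < t \<longrightarrow> t < \<delta> \<longrightarrow> i < length L \<longrightarrow> \<bar>t * c ! i\<bar> < \<rho>"
  shows "\<exists>\<Theta> C p q. \<Theta> \<subseteq> {0<..<\<delta>} \<and> (\<forall>\<epsilon>>0. uncountable (\<Theta> \<inter> {0<..<\<epsilon>})) \<and>
    alg_set n C \<and> poly_fun n p \<and> poly_fun n q \<and>
    (\<forall>t\<in>\<Theta>. take n (\<gamma> (smul t c)) \<in> C \<and> q (take n (\<gamma> (smul t c))) \<noteq> 0) \<and>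
    finite {x\<in>C. q x = 0} \<and> (\<forall>x\<in>V \<inter> C. q x \<noteq> 0 \<longrightarrow> f x * q x = p x) \<and>
    (\<forall>g. poly_fun n g \<longrightarrow> (\<forall>t\<in>\<Theta>. g (take n (\<gamma> (smul t c))) = 0) \<longrightarrow> (\<forall>x\<in>C. g x = 0))"
proof -
  have VR: "V \<subseteq> Rn n" using V by (simp add: zar_irred_def)
  define X where "X t = take n (\<gamma> (smul t c))" for t
  have lb: "length b = length L" using chartD(2)[OF ch] .
  have \<gamma>: "\<gamma> (smul t c) \<in> S" "sel L (\<gamma> (smul t c)) = vadd b (smul t c)" if "0 < t" "t < \<delta>" for t
    using chartD(3,4)[OF ch, of "smul t c"] \<delta>(2)[rule_format, OF that] c(1) by auto
  have XV: "X t \<in> V" and selX: "sel L (X t) = vadd b (smul t c)" if "0 < t" "t < \<delta>" for t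
    using \<gamma>[OF that] graph_memD(1)[OF S VR] by (auto simp: X_def sel_take[OF L])
  have inj: "t = s" if ts: "0 < t" "t < \<delta>" "0 < s" "s < \<delta>" "sel L (X t) = sel L (X s)" for t s
  proof -
    have "vadd b (smul t c) ! i0 = vadd b (smul s c) ! i0" using ts selX by simp
    then show ?thesis using c lb by simp
  qed
  have XR: "X t \<in> Rn n" if "0 < t" "t < \<delta>" for t using XV[OF that] VR by blast
  obtain \<Theta> where \<Theta>: "\<Theta> \<subseteq> {0<..<\<delta>}" "zar_irred n (X ` \<Theta>)" "\<And>\<epsilon>. \<epsilon> > 0 \<Longrightarrow> uncountable (\<Theta> \<inter> {0<..<\<epsilon>})"
    using arc_component[of \<delta> X n, OF \<delta>(1) XR] by blast
  define E where "E = X ` \<Theta>"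
  define C where "C = zar_closure n E"
  have EV: "E \<subseteq> V" using XV \<Theta>(1) by (auto simp: E_def)
  have ER: "E \<subseteq> Rn n" using EV VR by blast
  have EC: "E \<subseteq> C" by (simp add: C_def subset_zar_closure)
  have injX: "inj_on (\<lambda>t. sel L (X t)) \<Theta>" using inj \<Theta>(1) by (intro inj_onI) (auto simp: subset_iff)
  then have injX': "inj_on X \<Theta>" by (auto simp: inj_on_def)
  have inf\<Theta>: "infinite \<Theta>" using \<Theta>(3)[of 1] countable_finite finite_Int by (metis zero_less_one)
  have "alg_curve n C"
    unfolding C_def
  proof (rule curve_of_arc[OF _ L lb c(1) _ _ c(2,3)])
    show "zar_irred n E" using \<Theta>(2) by (simp add: E_def)
    show "\<exists>t. sel L x = vadd b (smul t c)" if x: "x \<in> E" for x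
    proof -
      obtain t where t: "t \<in> \<Theta>" "x = X t" using x by (auto simp: E_def)
      then have "sel L x = vadd b (smul t c)" using selX \<Theta>(1) by (auto simp: subset_iff)
      then show ?thesis by blast
    qed
    show "infinite (sel L ` E)" using inf\<Theta> injX finite_imageD by (auto simp: E_def image_image)
    fix j assume j: "j < n"
    then obtain m a where a: "\<forall>i. poly_fun (length L) (a i)" "a m b \<noteq> 0"
      "\<forall>z\<in>S. (\<Sum>i\<le>m. a i (sel L z) * z ! j ^ i) = 0" using chartD(6)[OF ch, of j] by auto
    have "\<forall>x\<in>E. (\<Sum>i\<le>m. a i (sel L x) * x ! j ^ i) = 0"
    proof
      fix x assume "x \<in> E"
      then obtain t where t: "t \<in> \<Theta>" "x = X t" by (auto simp: E_def)
      then have z: "\<gamma> (smul t c) \<in> S" using \<gamma> \<Theta>(1) by (auto simp: subset_iff)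
      then show "(\<Sum>i\<le>m. a i (sel L x) * x ! j ^ i) = 0"
        using a(3) j by (auto simp: t X_def sel_take[OF L])
    qed
    then show "\<exists>m a. (\<forall>i. poly_fun (length L) (a i)) \<and> a m b \<noteq> 0 \<and> (\<forall>x\<in>E. (\<Sum>i\<le>m. a i (sel L x) * x ! j ^ i) = 0)"
      using a(1,2) by blast
  qed
  moreover have "C \<subseteq> zar_closure n V"
    unfolding C_def using EV subset_zar_closure[of V n] by (intro zar_closure_minimal alg_set_zar_closure VR) auto
  ultimately have rat: "rational_on n (V \<inter> C) f" and cur: "alg_curve n C" using curves by auto
  have aC: "alg_set n C" unfolding C_def by (rule alg_set_zar_closure[OF ER])
  have zeros: "{x\<in>C. g x = 0} = C \<or> finite {x\<in>C. g x = 0}" if g: "poly_fun n g" for g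
  proof -
    have "{x\<in>C. g x = 0} = C \<inter> {x\<in>Rn n. g x = 0}" using alg_set_subset[OF aC] by auto
    then have "alg_set n {x\<in>C. g x = 0}" using alg_set_Int[OF aC alg_set_zeroI[OF g]] by simp
    then show ?thesis using cur unfolding alg_curve_def by blast
  qed
  obtain p q where pq: "poly_fun n p" "poly_fun n q"
    "\<And>r. poly_fun n r \<Longrightarrow> (\<forall>x\<in>V \<inter> C. q x \<noteq> 0 \<longrightarrow> r x = 0) \<Longrightarrow> (\<forall>x\<in>V \<inter> C. r x = 0)"
    "\<forall>x\<in>V \<inter> C. q x \<noteq> 0 \<longrightarrow> f x * q x = p x"
  proof -
    have "V \<inter> C \<subseteq> Rn n" using VR by blast
    with rat rational_on_iff[of "V \<inter> C" n f] show thesis using that by blast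
  qed
  \<comment> \<open>Otherwise density of the domain of \<open>p / q\<close> would force the constant
    1 to vanish on \<open>V \<inter> C\<close>, which contains the arc.\<close>
  have "{x\<in>C. q x = 0} \<noteq> C"
  proof
    assume "{x\<in>C. q x = 0} = C"
    then have "\<forall>x\<in>V \<inter> C. q x = 0" by blast
    then have "\<forall>x\<in>V \<inter> C. (1::real) = 0" using pq(3)[OF pf_const[of n 1]] by blast
    moreover have "\<Theta> \<noteq> {}" using inf\<Theta> by (metis finite.emptyI)
    then have "V \<inter> C \<noteq> {}" using EV EC by (auto simp: E_def)
    ultimately show False by auto
  qed
  then have fin: "finite {x\<in>C. q x = 0}" using zeros[OF pq(2)] by blast
  define B where "B = {t\<in>\<Theta>. q (X t) = 0}"
  have "X ` B \<subseteq> {x\<in>C. q x = 0}" using EC by (auto simp: B_def E_def)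
  then have "finite (X ` B)" using fin by (rule finite_subset)
  moreover have "inj_on X B" using injX' by (rule inj_on_subset) (auto simp: B_def)
  ultimately have finB: "finite B" by (rule finite_imageD)
  show ?thesis
  proof (rule exI[of _ "\<Theta> - B"], rule exI[of _ C], rule exI[of _ p], rule exI[of _ q], intro conjI)
    show "\<Theta> - B \<subseteq> {0<..<\<delta>}" using \<Theta>(1) by blast
    show "\<forall>\<epsilon>>0. uncountable ((\<Theta> - B) \<inter> {0<..<\<epsilon>})"
    proof (intro allI impI)
      fix \<epsilon> :: real assume "\<epsilon> > 0"
      then have "uncountable (\<Theta> \<inter> {0<..<\<epsilon>} - B)" by (intro uncountable_minus_finite \<Theta>(3) finB)
      moreover have "\<Theta> \<inter> {0<..<\<epsilon>} - B = (\<Theta> - B) \<inter> {0<..<\<epsilon>}" by blast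
      ultimately show "uncountable ((\<Theta> - B) \<inter> {0<..<\<epsilon>})" by simp
    qed
    show "\<forall>t\<in>\<Theta> - B. take n (\<gamma> (smul t c)) \<in> C \<and> q (take n (\<gamma> (smul t c))) \<noteq> 0"
      using EC by (auto simp: B_def E_def X_def)
    show "\<forall>g. poly_fun n g \<longrightarrow> (\<forall>t\<in>\<Theta> - B. g (take n (\<gamma> (smul t c))) = 0) \<longrightarrow> (\<forall>x\<in>C. g x = 0)"
    proof (intro allI impI)
      fix g assume g: "poly_fun n g" "\<forall>t\<in>\<Theta> - B. g (take n (\<gamma> (smul t c))) = 0"
      have "infinite (\<Theta> - B)" using inf\<Theta> finB by simp
      moreover have "inj_on X (\<Theta> - B)" using injX' by (rule inj_on_subset) blast
      ultimately have "infinite (X ` (\<Theta> - B))" using finite_imageD by blast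
      moreover have "X ` (\<Theta> - B) \<subseteq> {x\<in>C. g x = 0}" using g(2) EC by (auto simp: E_def X_def)
      ultimately have "infinite {x\<in>C. g x = 0}" using finite_subset by blast
      then show "\<forall>x\<in>C. g x = 0" using zeros[OF g(1)] by blast
    qed
  qed (use aC pq fin in auto)
qed

lemma rational_on_piece:
  assumes V: "zar_irred n V" and L: "set L \<subseteq> {..<n}" "L \<noteq> []"
    and S: "S \<subseteq> {x @ [f x] |x. x \<in> V}" "zar_irred (Suc n) S" and ch: "chart (Suc n) L S b \<gamma> \<rho>"
    and algS: "\<And>j. j < Suc n \<Longrightarrow> alg_over (length L) (sel L) S (\<lambda>z. z ! j)"
    and curves: "\<forall>C. alg_curve n C \<longrightarrow> C \<subseteq> zar_closure n V \<longrightarrow> rational_on n (V \<inter> C) f"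
  obtains P Q where "poly_fun n P" "poly_fun n Q" "\<exists>x\<in>V. Q x \<noteq> 0"
    "\<And>z. z \<in> S \<Longrightarrow> z ! n * Q (take n z) = P (take n z)"
proof -
  define d where "d = length L"
  have d: "d > 0" using L(2) by (simp add: d_def)
  have VR: "V \<subseteq> Rn n" using V by (simp add: zar_irred_def)
  have lb: "length b = d" using chartD(2)[OF ch] by (simp add: d_def)
  note Sz = graph_memD(1,2)[OF S(1) VR]
  have \<gamma>: "\<gamma> w \<in> S" "sel L (\<gamma> w) = vadd b w" if "length w = d" "\<forall>i<d. \<bar>w ! i\<bar> < \<rho>" for w
    using chartD(3,4)[OF ch, of w] that by (auto simp: d_def)
  \<comment> \<open>The relation \<open>f * q - p = 0\<close> as a linear one: the unknowns
    \<open>(True, e)\<close> and \<open>(False, e)\<close> are the coefficients of the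
    \<open>e\<close>-th monomial in \<open>q\<close> and in \<open>- p\<close>.\<close>
  define \<phi> :: "bool \<times> nat \<Rightarrow> real list \<Rightarrow> real"
    where "\<phi> e z = (if fst e then z ! n else 1) * mono_fun n (snd e) (take n z)" for e z
  \<comment> \<open>The side condition is the value of \<open>q\<close> at the point over
    \<open>b + c\<close>; it will keep the final denominator from vanishing on all of
    \<open>V\<close>.\<close>
  define l :: "bool \<times> nat \<Rightarrow> real list \<Rightarrow> real"
    where "l e c = (if fst e then mono_fun n (snd e) (take n (\<gamma> c)) else 0)" for e c
  define I where "I D = (UNIV :: bool set) \<times> {..<D::nat}" for D
  have sumI: "(\<Sum>e\<in>I D. h e) = (\<Sum>e<D. h (True, e)) + (\<Sum>e<D. h (False, e))" for D and h :: "bool \<times> nat \<Rightarrow> real"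
  proof -
    have "(\<Sum>e\<in>I D. h e) = (\<Sum>B\<in>UNIV. \<Sum>e<D. h (B, e))" by (simp add: I_def sum.cartesian_product)
    then show ?thesis by (simp add: UNIV_bool)
  qed
  \<comment> \<open>A condition on the vector \<open>c\<close> and not only on its direction: the
    relation holds along the ray, but the denominator is tested at \<open>t = 1\<close>.\<close>
  define Good where "Good D c \<longleftrightarrow> (\<forall>i<d. \<bar>c ! i\<bar> < \<rho>) \<and>
    (\<exists>v. (\<exists>\<^sub>F t in at_right 0. (\<Sum>e\<in>I D. \<phi> e (\<gamma> (smul t c)) * v e) = 0) \<and> (\<Sum>e\<in>I D. l e c * v e) \<noteq> 0)" for D c
  have "\<exists>D. zar_dense d {c\<in>Rn d. Good D c}"
  proof (rule zar_dense_cover[OF d, of "replicate d 0" \<rho>])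
    show "\<rho> > 0" by (rule chartD(1)[OF ch])
    fix c assume c: "length c = d" "\<forall>i<d. \<bar>c ! i - replicate d 0 ! i\<bar> < \<rho>" "c ! 0 \<noteq> 0"
    have small: "\<bar>t * c ! i\<bar> < \<rho>" if "0 < t" "t < 1" "i < d" for t i
    proof -
      have "\<bar>t * c ! i\<bar> \<le> 1 * \<bar>c ! i\<bar>" unfolding abs_mult using that by (intro mult_right_mono) auto
      then show ?thesis using c(2) that(3) by fastforce
    qed
    have c': "length c = length L" "0 < length L" "c ! 0 \<noteq> 0" using c d by (auto simp: d_def)
    have small': "\<forall>t i. 0 < t \<longrightarrow> t < 1 \<longrightarrow> i < length L \<longrightarrow> \<bar>t * c ! i\<bar> < \<rho>" using small by (simp add: d_def)
    from arc_curve[OF V L(1) S(1) ch curves c' zero_less_one small']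
    obtain \<Theta> C p q where \<Theta>: "\<Theta> \<subseteq> {0<..<1}" "\<forall>\<epsilon>>0. uncountable (\<Theta> \<inter> {0<..<\<epsilon>})"
      "poly_fun n p" "poly_fun n q"
      "\<forall>t\<in>\<Theta>. take n (\<gamma> (smul t c)) \<in> C \<and> q (take n (\<gamma> (smul t c))) \<noteq> 0"
      "\<forall>x\<in>V \<inter> C. q x \<noteq> 0 \<longrightarrow> f x * q x = p x"
      by (elim exE conjE) (rule that)
    obtain D1 u1 where u1: "\<forall>D'\<ge>D1. \<forall>x. q x = (\<Sum>e<D'. u1 e * mono_fun n e x)" using poly_fun_mono_span[OF \<Theta>(4)] by blast
    obtain D2 u2 where u2: "\<forall>D'\<ge>D2. \<forall>x. p x = (\<Sum>e<D'. u2 e * mono_fun n e x)" using poly_fun_mono_span[OF \<Theta>(3)] by blast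
    define D where "D = max D1 D2"
    have q: "q x = (\<Sum>e<D. u1 e * mono_fun n e x)" for x using u1 by (simp add: D_def)
    have p: "p x = (\<Sum>e<D. u2 e * mono_fun n e x)" for x using u2 by (simp add: D_def)
    define v where "v e = (if fst e then u1 (snd e) else - u2 (snd e))" for e :: "bool \<times> nat"
    have \<phi>v: "(\<Sum>e\<in>I D. \<phi> e z * v e) = z ! n * q (take n z) - p (take n z)" for z
      by (simp add: sumI \<phi>_def v_def p q sum_distrib_left sum_negf mult_ac)
    have lv: "(\<Sum>e\<in>I D. l e c * v e) = q (take n (\<gamma> c))" for c
      by (simp add: sumI l_def v_def q mult_ac)
    have zero: "(\<Sum>e\<in>I D. \<phi> e (\<gamma> (smul t c)) * v e) = 0" if t: "t \<in> \<Theta>" for t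
    proof -
      have "0 < t" "t < 1" using t \<Theta>(1) by (auto simp: subset_iff)
      then have "\<gamma> (smul t c) \<in> S" using small c(1) by (intro \<gamma>) auto
      then show ?thesis using \<Theta>(5,6) t Sz[of "\<gamma> (smul t c)"] unfolding \<phi>v by auto
    qed
    have "Good D (smul t c)" if t: "t \<in> \<Theta>" for t
      unfolding Good_def
    proof (intro conjI exI[of _ v])
      have t01: "0 < t" "t < 1" using t \<Theta>(1) by (auto simp: subset_iff)
      then show "\<forall>i<d. \<bar>smul t c ! i\<bar> < \<rho>" using small c(1) by simp
      have "\<exists>\<^sub>F s in at_right 0. s * t \<in> \<Theta>" using \<Theta>(2) t01 by (intro frequently_scaled) auto
      then show "\<exists>\<^sub>F s in at_right 0. (\<Sum>e\<in>I D. \<phi> e (\<gamma> (smul s (smul t c))) * v e) = 0"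
        by (rule frequently_elim1) (simp add: smul_smul zero)
      show "(\<Sum>e\<in>I D. l e (smul t c) * v e) \<noteq> 0" using \<Theta>(5) t by (simp add: lv)
    qed
    then have "\<Theta> \<subseteq> {t. \<exists>D. Good D (smul t c)}" by blast
    moreover have "uncountable \<Theta>" using \<Theta>(2) countable_Int1 zero_less_one by blast
    ultimately show "uncountable {t. \<exists>D. Good D (smul t c)}" using countable_subset by blast
  qed simp
  then obtain D where D: "zar_dense d {c\<in>Rn d. Good D c}" by blast
  have p\<phi>: "poly_fun (Suc n) (\<phi> e)" for e
    unfolding \<phi>_def by (intro poly_fun_intros poly_fun_if poly_fun_take[OF poly_fun_mono_fun]) auto
  have L': "set L \<subseteq> {..<Suc n}" using L(1) by auto
  have "\<exists>v. (\<forall>e\<in>I D. poly_fun d (v e)) \<and> (\<exists>c\<in>{c\<in>Rn d. Good D c}. (\<Sum>e\<in>I D. l e c * v e c) \<noteq> 0) \<and>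
    (\<forall>z\<in>S. (\<Sum>e\<in>I D. \<phi> e z * v e (vadd (map uminus b) (sel L z))) = 0)"
  proof (rule pencil[OF ch S(2) L' d_def])
    show "finite (I D)" by (simp add: I_def)
    show "alg_over d (sel L) S (\<lambda>z. z ! j)" if "j < Suc n" for j using algS[OF that] by (simp add: d_def)
    show "\<exists>v. (\<exists>\<^sub>F t in at_right 0. (\<Sum>e\<in>I D. \<phi> e (\<gamma> (smul t c)) * v e) = 0) \<and> (\<Sum>e\<in>I D. l e c * v e) \<noteq> 0"
      if "c \<in> {c\<in>Rn d. Good D c}" for c using that unfolding Good_def by blast
  qed (use p\<phi> D in auto)
  then obtain v c where v: "\<forall>e\<in>I D. poly_fun d (v e)" "length c = d" "Good D c" "(\<Sum>e\<in>I D. l e c * v e c) \<noteq> 0"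
    "\<forall>z\<in>S. (\<Sum>e\<in>I D. \<phi> e z * v e (vadd (map uminus b) (sel L z))) = 0" by auto
  \<comment> \<open>With the direction replaced by \<open>sel L x - b\<close>, \<open>R True\<close>
    becomes the denominator and \<open>- R False\<close> the numerator.\<close>
  define R where "R B x = (\<Sum>e<D. mono_fun n e x * v (B, e) (vadd (map uminus b) (sel L x)))" for B x
  have pR: "poly_fun n (R B)" for B
    unfolding R_def
  proof (intro poly_fun_intros poly_fun_mono_fun)
    fix e assume "e \<in> {..<D}"
    then have "poly_fun (length L) (\<lambda>x. v (B, e) (vadd (map uminus b) x))"
      using v(1) lb by (intro poly_fun_vadd) (auto simp: I_def d_def)
    then show "poly_fun n (\<lambda>z. v (B, e) (vadd (map uminus b) (sel L z)))" by (rule poly_fun_sel[OF _ L(1)])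
  qed
  show thesis
  proof (rule that[of "\<lambda>x. - R False x" "R True"])
    show "poly_fun n (\<lambda>x. - R False x)" by (intro poly_fun_intros pR)
    show "z ! n * R True (take n z) = - R False (take n z)" if "z \<in> S" for z
      using v(5)[rule_format, OF that] by (simp add: sumI \<phi>_def R_def sel_take[OF L(1)] sum_distrib_left mult_ac)
    have w: "\<forall>i<d. \<bar>c ! i\<bar> < \<rho>" using v(3) by (simp add: Good_def)
    \<comment> \<open>Over \<open>b + c\<close> the substituted direction is \<open>c\<close> again,
      so \<open>R True\<close> takes there the nonzero value of the side condition.\<close>
    have "vadd (map uminus b) (sel L (take n (\<gamma> c))) = c"
      using \<gamma>(2)[OF v(2) w] lb v(2) by (auto simp: sel_take[OF L(1)] intro!: nth_equalityI)
    then have "R True (take n (\<gamma> c)) = (\<Sum>e\<in>I D. l e c * v e c)" by (simp add: R_def sumI l_def)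
    then show "\<exists>x\<in>V. R True x \<noteq> 0" using v(4) Sz(1)[OF \<gamma>(1)[OF v(2) w]] by metis
  qed (rule pR)
qed

lemma semialg_graph_part:
  assumes "semialg (Suc n) {x @ [f x] |x. x \<in> V}" "V \<subseteq> Rn n" "poly_fun n P" "poly_fun n Q"
  shows "semialg (Suc n) {x @ [f x] |x. x \<in> V \<and> f x * Q x \<noteq> P x}"
proof -
  have "poly_fun (Suc n) (\<lambda>z. z ! n * Q (take n z) - P (take n z))"
    using assms by (intro poly_fun_intros poly_fun_take) auto
  from sa_inter[OF assms(1) sa_compl[OF sa_eq[OF this]]] show ?thesis
  proof (rule back_subst[of "semialg (Suc n)"])
    show "{x @ [f x] |x. x \<in> V} \<inter> (Rn (Suc n) - {z\<in>Rn (Suc n). z ! n * Q (take n z) - P (take n z) = 0})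
      = {x @ [f x] |x. x \<in> V \<and> f x * Q x \<noteq> P x}" (is "?A = ?B")
    proof (intro set_eqI iffI)
      fix z assume "z \<in> ?A"
      then obtain x where "z = x @ [f x]" "x \<in> V" "z ! n * Q (take n z) - P (take n z) \<noteq> 0" by auto
      moreover have "length x = n" using assms(2) \<open>x \<in> V\<close> by auto
      ultimately show "z \<in> ?B" by (auto simp: nth_append)
    next
      fix z assume "z \<in> ?B"
      then obtain x where "z = x @ [f x]" "x \<in> V" "f x * Q x \<noteq> P x" by auto
      moreover have "length x = n" using assms(2) \<open>x \<in> V\<close> by auto
      ultimately show "z \<in> ?A" by (auto simp: nth_append)
    qed
  qed
qed

text \<open>Suppose \<open>f = P / Q\<close> on one piece \<open>S\<close> of the graph but not on a second dominating piece \<open>S2\<close>.  A curve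
  through the base point of the chart of \<open>S\<close> can contain only finitely many points of \<open>S2\<close>, so on
  each line some polynomial vanishes on the curve but not at a given point of \<open>S2\<close>.  The pencil turns
  these into one polynomial that vanishes on \<open>S\<close>, hence on \<open>V\<close>, but not on \<open>S2\<close>.\<close>
lemma no_second_piece:
  assumes V: "zar_irred n V" and L: "set L \<subseteq> {..<n}" "L \<noteq> []" and ind: "indep_on (length L) (sel L) V"
    and alg: "\<And>j. j < n \<Longrightarrow> alg_over (length L) (sel L) V (\<lambda>x. x ! j)"
    and graph: "semialg (Suc n) {x @ [f x] |x. x \<in> V}"
    and S: "S \<subseteq> {x @ [f x] |x. x \<in> V}" "zar_irred (Suc n) S" "dominates n S V" and ch: "chart (Suc n) L S b \<gamma> \<rho>"
    and algS: "\<And>j. j < Suc n \<Longrightarrow> alg_over (length L) (sel L) S (\<lambda>z. z ! j)"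
    and curves: "\<forall>C. alg_curve n C \<longrightarrow> C \<subseteq> zar_closure n V \<longrightarrow> rational_on n (V \<inter> C) f"
    and PQ: "poly_fun n P" "poly_fun n Q" "\<And>z. z \<in> S \<Longrightarrow> z ! n * Q (take n z) = P (take n z)"
  shows "\<exists>h. poly_fun n h \<and> (\<forall>x\<in>V. f x * Q x \<noteq> P x \<longrightarrow> h x = 0) \<and> (\<exists>x\<in>V. h x \<noteq> 0)"
proof (rule ccontr)
  assume no: "\<not> ?thesis"
  define d where "d = length L"
  have d: "d > 0" using L(2) by (simp add: d_def)
  have VR: "V \<subseteq> Rn n" using V by (simp add: zar_irred_def)
  define G where "G = {x @ [f x] |x. x \<in> V \<and> f x * Q x \<noteq> P x}"
  have G: "semialg (Suc n) G" unfolding G_def by (rule semialg_graph_part[OF graph VR PQ(1,2)])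
  have GV: "G \<subseteq> {x @ [f x] |x. x \<in> V}" by (auto simp: G_def)
  have GR: "G \<subseteq> Rn (Suc n)" using VR by (auto simp: G_def)
  \<comment> \<open>By \<open>no\<close>, a polynomial that vanishes wherever \<open>f * Q\<close>
    and \<open>P\<close> differ vanishes on \<open>V\<close>.\<close>
  have "dominates n G V"
    unfolding dominates_def
  proof (intro allI impI)
    fix g assume g: "poly_fun n g" "\<forall>z\<in>G. g (take n z) = 0"
    have "g x = 0" if x: "x \<in> V" "f x * Q x \<noteq> P x" for x
    proof -
      have "x @ [f x] \<in> G" using x by (auto simp: G_def)
      moreover have "length x = n" using x VR by auto
      ultimately show ?thesis using g(2) by force
    qed
    then show "\<forall>x\<in>V. g x = 0" using no g(1) by blast
  qed
  from dominant_piece[OF V G GR this] obtain S2 where S2: "S2 \<subseteq> G" "semialg (Suc n) S2"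
    "zar_irred (Suc n) S2" "dominates n S2 V" .
  have S2V: "S2 \<subseteq> {x @ [f x] |x. x \<in> V}" using S2(1) GV by blast
  obtain b2 \<gamma>2 \<rho>2 where ch2: "chart (Suc n) L S2 b2 \<gamma>2 \<rho>2"
    using graph_chart(2)[OF V L(1) ind alg S2V S2(2,3,4)] by blast
  have S2x: "take n z \<in> V" "f (take n z) * Q (take n z) \<noteq> P (take n z)" if z: "z \<in> S2" for z
  proof -
    show "take n z \<in> V" using graph_memD(1)[OF S2V VR z] .
    have "z \<in> {x @ [f x] |x. x \<in> {x\<in>V. f x * Q x \<noteq> P x}}" using z S2(1) by (auto simp: G_def)
    from graph_memD(1)[OF subset_refl _ this] VR show "f (take n z) * Q (take n z) \<noteq> P (take n z)" by auto
  qed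
  have lb: "length b = d" "length b2 = d" using chartD(2)[OF ch] chartD(2)[OF ch2] by (auto simp: d_def)
  note Sz = graph_memD(1,2)[OF S(1) VR]
  have \<gamma>: "\<gamma> w \<in> S" "sel L (\<gamma> w) = vadd b w" if "length w = d" "\<forall>i<d. \<bar>w ! i\<bar> < \<rho>" for w
    using chartD(3,4)[OF ch, of w] that by (auto simp: d_def)
  have \<gamma>2: "\<gamma>2 w \<in> S2" "sel L (\<gamma>2 w) = vadd b2 w" if "length w = d" "\<forall>i<d. \<bar>w ! i\<bar> < \<rho>2" for w
    using chartD(3,4)[OF ch2, of w] that by (auto simp: d_def)
  have \<rho>: "\<rho> > 0" "\<rho>2 > 0" using chartD(1)[OF ch] chartD(1)[OF ch2] .
  \<comment> \<open>The vector from the base point of the first chart to that of the second: for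
    \<open>c\<close> near \<open>c0\<close> the end \<open>b + c\<close> lies in the box of the
    second chart.\<close>
  define c0 where "c0 = vadd (map uminus b) b2"
  have c0: "length c0 = d" "\<And>i. i < d \<Longrightarrow> c0 ! i = b2 ! i - b ! i" using lb by (auto simp: c0_def)
  define off where "off c = vadd (map uminus c0) c" for c
  have off: "length (off c) = d" "\<And>i. i < d \<Longrightarrow> off c ! i = c ! i - c0 ! i" for c
    using c0(1) by (auto simp: off_def)
  \<comment> \<open>The point of the second piece over \<open>b + c\<close>; \<open>off c\<close> is
    the position of \<open>b + c\<close> relative to \<open>b2\<close>.\<close>
  define x2 where "x2 c = take n (\<gamma>2 (off c))" for c
  have x2: "x2 c \<in> V" "f (x2 c) * Q (x2 c) \<noteq> P (x2 c)" "vadd (map uminus b) (sel L (x2 c)) = c"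
    if c: "length c = d" "\<forall>i<d. \<bar>off c ! i\<bar> < \<rho>2" for c
  proof -
    show "x2 c \<in> V" "f (x2 c) * Q (x2 c) \<noteq> P (x2 c)"
      using S2x[OF \<gamma>2(1)[OF off(1) c(2)]] by (simp_all add: x2_def)
    show "vadd (map uminus b) (sel L (x2 c)) = c"
      using \<gamma>2(2)[OF off(1) c(2)] lb off c0 c(1) by (auto simp: x2_def sel_take[OF L(1)] intro!: nth_equalityI)
  qed
  define \<phi> where "\<phi> e z = mono_fun n e (take n z)" for e z
  \<comment> \<open>The unknowns are the coefficients of a polynomial that vanishes along the lifted
    line; the side condition is its value at \<open>x2 c\<close>.\<close>
  define Good where "Good D c \<longleftrightarrow> (\<forall>i<d. \<bar>off c ! i\<bar> < \<rho>2) \<and>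
    (\<exists>v. (\<exists>\<^sub>F t in at_right 0. (\<Sum>e<D. \<phi> e (\<gamma> (smul t c)) * v e) = 0) \<and> (\<Sum>e<D. mono_fun n e (x2 c) * v e) \<noteq> 0)"
    for D c
  have "\<exists>D. zar_dense d {c\<in>Rn d. Good D c}"
  proof (rule zar_dense_cover[OF d c0(1), of "\<rho>2 / 2"])
    show "\<rho>2 / 2 > 0" using \<rho> by simp
    fix c assume c: "length c = d" "\<forall>i<d. \<bar>c ! i - c0 ! i\<bar> < \<rho>2 / 2" "c ! 0 \<noteq> 0"
    have np: "nrm c + 1 > 0" using nrm_nonneg[of c] by linarith
    \<comment> \<open>The vector \<open>c\<close> may be long, so the arc is shortened until it lies
      in the first chart.\<close>
    define \<delta> where "\<delta> = \<rho> / (nrm c + 1)"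
    have \<delta>: "\<delta> > 0" using \<rho> np by (simp add: \<delta>_def)
    have small: "\<bar>t * c ! i\<bar> < \<rho>" if "0 < t" "t < \<delta>" "i < d" for t i
    proof -
      have "\<bar>t * c ! i\<bar> \<le> t * (nrm c + 1)" unfolding abs_mult
        using that nth_le_nrm[of i c] c(1) by (intro mult_mono) auto
      also have "\<dots> < \<delta> * (nrm c + 1)" using that(2) np by simp
      finally show ?thesis using np by (simp add: \<delta>_def)
    qed
    have c': "length c = length L" "0 < length L" "c ! 0 \<noteq> 0" using c d by (auto simp: d_def)
    have small': "\<forall>t i. 0 < t \<longrightarrow> t < \<delta> \<longrightarrow> i < length L \<longrightarrow> \<bar>t * c ! i\<bar> < \<rho>" using small by (simp add: d_def)
    from arc_curve[OF V L(1) S(1) ch curves c' \<delta> small']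
    obtain \<Theta> C p q where \<Theta>: "\<Theta> \<subseteq> {0<..<\<delta>}" "\<forall>\<epsilon>>0. uncountable (\<Theta> \<inter> {0<..<\<epsilon>})"
      "alg_set n C" "poly_fun n p" "poly_fun n q"
      "\<forall>t\<in>\<Theta>. take n (\<gamma> (smul t c)) \<in> C \<and> q (take n (\<gamma> (smul t c))) \<noteq> 0"
      "finite {x\<in>C. q x = 0}" "\<forall>x\<in>V \<inter> C. q x \<noteq> 0 \<longrightarrow> f x * q x = p x"
      "\<forall>g. poly_fun n g \<longrightarrow> (\<forall>t\<in>\<Theta>. g (take n (\<gamma> (smul t c))) = 0) \<longrightarrow> (\<forall>x\<in>C. g x = 0)"
      by (elim exE conjE) (rule that)
    have \<gamma>\<Theta>: "\<gamma> (smul t c) \<in> S" if t: "t \<in> \<Theta>" for t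
    proof -
      have "0 < t" "t < \<delta>" using t \<Theta>(1) by (auto simp: subset_iff)
      then show ?thesis using small c(1) by (intro \<gamma>) auto
    qed
    have "\<forall>t\<in>\<Theta>. Q (take n (\<gamma> (smul t c))) * p (take n (\<gamma> (smul t c))) - P (take n (\<gamma> (smul t c))) * q (take n (\<gamma> (smul t c))) = 0"
    proof
      fix t assume t: "t \<in> \<Theta>"
      define x where "x = take n (\<gamma> (smul t c))"
      have "f x * Q x = P x" "x \<in> V" using PQ(3)[OF \<gamma>\<Theta>[OF t]] Sz[OF \<gamma>\<Theta>[OF t]] by (simp_all add: x_def)
      moreover have "f x * q x = p x" using \<Theta>(6,8) t \<open>x \<in> V\<close> by (simp add: x_def)
      ultimately have "Q x * p x - P x * q x = Q x * (f x * q x) - (f x * Q x) * q x" by simp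
      then show "Q x * p x - P x * q x = 0" by (simp add: mult_ac)
    qed
    moreover have "poly_fun n (\<lambda>x. Q x * p x - P x * q x)" by (intro poly_fun_intros PQ \<Theta>)
    \<comment> \<open>Both descriptions of \<open>f\<close> agree along the arc, so
      \<open>Q * p = P * q\<close> on its closure, including points of \<open>C\<close> that do not
      come from \<open>S\<close>.\<close>
    ultimately have Cid: "Q x * p x - P x * q x = 0" if "x \<in> C" for x using \<Theta>(9) that by blast
    \<comment> \<open>For \<open>\<bar>t - 1\<bar> < \<eta>\<close> scaling moves \<open>c\<close>
      by at most \<open>\<rho>2 / 2\<close>, and \<open>c\<close> is within
      \<open>\<rho>2 / 2\<close> of \<open>c0\<close>. The bound 1/2 keeps \<open>t\<close>
      positive.\<close>
    define \<eta> where "\<eta> = min (1/2) (\<rho>2 / (2 * (nrm c + 1)))"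
    have \<eta>: "\<eta> > 0" using \<rho> np by (simp add: \<eta>_def)
    have near1: "0 < t" "\<forall>i<d. \<bar>off (smul t c) ! i\<bar> < \<rho>2" if t: "\<bar>t - 1\<bar> < \<eta>" for t
    proof -
      have "\<bar>t - 1\<bar> < 1/2" using t by (simp add: \<eta>_def)
      then show "0 < t" by linarith
      show "\<forall>i<d. \<bar>off (smul t c) ! i\<bar> < \<rho>2"
      proof (intro allI impI)
        fix i assume i: "i < d"
        have "\<bar>(t - 1) * c ! i\<bar> \<le> \<bar>t - 1\<bar> * (nrm c + 1)" unfolding abs_mult
          using i nth_le_nrm[of i c] c(1) by (intro mult_left_mono) auto
        also have "\<dots> \<le> \<rho>2 / (2 * (nrm c + 1)) * (nrm c + 1)"
          using t np by (intro mult_right_mono) (auto simp: \<eta>_def)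
        also have "\<dots> = \<rho>2 / 2" using np by (simp add: field_simps)
        finally have "\<bar>(t - 1) * c ! i\<bar> \<le> \<rho>2 / 2" .
        moreover have "\<bar>c ! i - c0 ! i\<bar> < \<rho>2 / 2" using c(2) i by blast
        moreover have "off (smul t c) ! i = (t - 1) * c ! i + (c ! i - c0 ! i)"
          using i off(2) c(1) by (simp add: algebra_simps)
        ultimately show "\<bar>off (smul t c) ! i\<bar> < \<rho>2" by linarith
      qed
    qed
    define T where "T = {t. \<bar>t - 1\<bar> < \<eta>} - {t. \<bar>t - 1\<bar> < \<eta> \<and> x2 (smul t c) \<in> {x\<in>C. q x = 0}}"
    have "finite {t. \<bar>t - 1\<bar> < \<eta> \<and> x2 (smul t c) \<in> {x\<in>C. q x = 0}}"
    proof (rule finite_imageD)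
      show "finite ((\<lambda>t. x2 (smul t c)) ` {t. \<bar>t - 1\<bar> < \<eta> \<and> x2 (smul t c) \<in> {x\<in>C. q x = 0}})"
        using \<Theta>(7) by (rule rev_finite_subset) auto
      show "inj_on (\<lambda>t. x2 (smul t c)) {t. \<bar>t - 1\<bar> < \<eta> \<and> x2 (smul t c) \<in> {x\<in>C. q x = 0}}"
      proof (rule inj_onI)
        fix s t assume s: "s \<in> {t. \<bar>t - 1\<bar> < \<eta> \<and> x2 (smul t c) \<in> {x\<in>C. q x = 0}}"
          and t: "t \<in> {t. \<bar>t - 1\<bar> < \<eta> \<and> x2 (smul t c) \<in> {x\<in>C. q x = 0}}"
          and eq: "x2 (smul s c) = x2 (smul t c)"
        have x2r: "vadd (map uminus b) (sel L (x2 (smul r c))) = smul r c" if "\<bar>r - 1\<bar> < \<eta>" for r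
          by (rule x2(3)[OF _ near1(2)[OF that]]) (simp add: c(1))
        have st: "\<bar>s - 1\<bar> < \<eta>" "\<bar>t - 1\<bar> < \<eta>" using s t by blast+
        have "smul s c = vadd (map uminus b) (sel L (x2 (smul s c)))" using x2r[OF st(1)] by (rule sym)
        also have "\<dots> = smul t c" unfolding eq by (rule x2r[OF st(2)])
        finally have "smul s c = smul t c" .
        then have "smul s c ! 0 = smul t c ! 0" by simp
        then show "s = t" using c d by simp
      qed
    qed
    then have uT: "uncountable T" unfolding T_def by (intro uncountable_minus_finite uncountable_box \<eta>)
    have "\<exists>D. Good D (smul t c)" if t: "t \<in> T" for t
    proof -
      have t1: "\<bar>t - 1\<bar> < \<eta>" using t by (simp add: T_def)
      note x2t = x2[of "smul t c"]
      have x: "x2 (smul t c) \<in> V" "f (x2 (smul t c)) * Q (x2 (smul t c)) \<noteq> P (x2 (smul t c))"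
        by (intro x2t(1,2) near1(2)[OF t1]; simp add: c(1))+
      \<comment> \<open>On \<open>V \<inter> C\<close> off the zeros of \<open>q\<close> the
        identity gives \<open>f * Q = P\<close>, which fails on the second piece.\<close>
      have "x2 (smul t c) \<notin> C"
      proof
        assume xC: "x2 (smul t c) \<in> C"
        define y where "y = x2 (smul t c)"
        have qy: "q y \<noteq> 0" using t xC t1 by (auto simp: T_def y_def)
        have "f y * q y = p y" using \<Theta>(8) qy xC x(1) by (auto simp: y_def)
        moreover have "Q y * p y - P y * q y = 0" using Cid xC by (simp add: y_def)
        ultimately have "(f y * Q y - P y) * q y = 0" by (simp add: algebra_simps)
        then show False using qy x(2) by (simp add: y_def)
      qed
      moreover obtain h where h: "poly_fun n h" "C = {x\<in>Rn n. h x = 0}" using \<Theta>(3) by (rule alg_set_zeroE)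
      ultimately have hx: "h (x2 (smul t c)) \<noteq> 0" using x(1) VR by blast
      obtain D u where u: "\<forall>D'\<ge>D. \<forall>x. h x = (\<Sum>e<D'. u e * mono_fun n e x)" using poly_fun_mono_span[OF h(1)] by blast
      then have hu: "h x = (\<Sum>e<D. mono_fun n e x * u e)" for x by (simp add: mult.commute)
      have "Good D (smul t c)"
        unfolding Good_def
      proof (intro conjI exI[of _ u])
        show "\<forall>i<d. \<bar>off (smul t c) ! i\<bar> < \<rho>2" by (rule near1(2)[OF t1])
        have "\<exists>\<^sub>F s in at_right 0. s * t \<in> \<Theta>" using \<Theta>(2) near1(1)[OF t1] by (intro frequently_scaled) auto
        then show "\<exists>\<^sub>F s in at_right 0. (\<Sum>e<D. \<phi> e (\<gamma> (smul s (smul t c))) * u e) = 0"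
        proof (rule frequently_elim1)
          fix s assume "s * t \<in> \<Theta>"
          then have "take n (\<gamma> (smul (s * t) c)) \<in> C" using \<Theta>(6) by blast
          then have "h (take n (\<gamma> (smul (s * t) c))) = 0" using h(2) by blast
          then show "(\<Sum>e<D. \<phi> e (\<gamma> (smul s (smul t c))) * u e) = 0" by (simp add: smul_smul \<phi>_def hu)
        qed
        show "(\<Sum>e<D. mono_fun n e (x2 (smul t c)) * u e) \<noteq> 0" using hx by (simp add: hu)
      qed
      then show ?thesis by blast
    qed
    then have "T \<subseteq> {t. \<exists>D. Good D (smul t c)}" by blast
    then show "uncountable {t. \<exists>D. Good D (smul t c)}" using uT countable_subset by blast
  qed
  then obtain D where D: "zar_dense d {c\<in>Rn d. Good D c}" by blast
  have L': "set L \<subseteq> {..<Suc n}" using L(1) by auto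
  have "\<exists>v. (\<forall>e\<in>{..<D}. poly_fun d (v e)) \<and> (\<exists>c\<in>{c\<in>Rn d. Good D c}. (\<Sum>e\<in>{..<D}. mono_fun n e (x2 c) * v e c) \<noteq> 0) \<and>
    (\<forall>z\<in>S. (\<Sum>e\<in>{..<D}. \<phi> e z * v e (vadd (map uminus b) (sel L z))) = 0)"
  proof (rule pencil[OF ch S(2) L' d_def])
    show "alg_over d (sel L) S (\<lambda>z. z ! j)" if "j < Suc n" for j using algS[OF that] by (simp add: d_def)
    show "poly_fun (Suc n) (\<phi> e)" for e unfolding \<phi>_def by (intro poly_fun_take[OF poly_fun_mono_fun]) auto
    show "\<exists>v. (\<exists>\<^sub>F t in at_right 0. (\<Sum>e\<in>{..<D}. \<phi> e (\<gamma> (smul t c)) * v e) = 0) \<and> (\<Sum>e\<in>{..<D}. mono_fun n e (x2 c) * v e) \<noteq> 0"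
      if "c \<in> {c\<in>Rn d. Good D c}" for c using that unfolding Good_def by blast
  qed (use D in auto)
  then obtain v c where v: "\<forall>e\<in>{..<D}. poly_fun d (v e)" "length c = d" "Good D c" "(\<Sum>e<D. mono_fun n e (x2 c) * v e c) \<noteq> 0"
    "\<forall>z\<in>S. (\<Sum>e<D. \<phi> e z * v e (vadd (map uminus b) (sel L z))) = 0" by auto
  define R where "R x = (\<Sum>e<D. mono_fun n e x * v e (vadd (map uminus b) (sel L x)))" for x
  have pR: "poly_fun n R"
    unfolding R_def
  proof (intro poly_fun_intros poly_fun_mono_fun)
    fix e assume "e \<in> {..<D}"
    then have "poly_fun (length L) (\<lambda>x. v e (vadd (map uminus b) x))"
      using v(1) lb by (intro poly_fun_vadd) (auto simp: d_def)
    then show "poly_fun n (\<lambda>z. v e (vadd (map uminus b) (sel L z)))" by (rule poly_fun_sel[OF _ L(1)])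
  qed
  have "\<forall>z\<in>S. R (take n z) = 0" using v(5) by (simp add: R_def \<phi>_def sel_take[OF L(1)])
  then have R0: "\<forall>x\<in>V. R x = 0" using S(3) pR unfolding dominates_def by blast
  have w: "\<forall>i<d. \<bar>off c ! i\<bar> < \<rho>2" using v(3) by (simp add: Good_def)
  have "R (x2 c) \<noteq> 0" using v(4) x2(3)[OF v(2) w] by (simp add: R_def)
  then show False using R0 x2(1)[OF v(2) w] by blast
qed

text \<open>Transcendence degree 0: each coordinate takes finitely many values, and irreducibility
  leaves one.\<close>

lemma zar_irred_alg_over_empty:
  assumes V: "zar_irred n V" and alg: "\<And>j. j < n \<Longrightarrow> alg_over 0 (sel []) V (\<lambda>x. x ! j)"
  shows "\<exists>a. V = {a}"
proof -
  have VR: "V \<subseteq> Rn n" "V \<noteq> {}" using V by (auto simp: zar_irred_def)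
  have const: "\<exists>r. \<forall>x\<in>V. x ! j = r" if j: "j < n" for j
  proof -
    obtain m a where a: "\<forall>i. poly_fun 0 (a i)" "\<exists>i\<le>m. \<exists>w\<in>Rn 0. a i w \<noteq> 0"
      "\<forall>x\<in>V. (\<Sum>i\<le>m. a i (sel [] x) * x ! j ^ i) = 0" using alg[OF j] unfolding alg_over_def by blast
    define r where "r = (\<Sum>i\<le>m. monom (a i []) i)"
    obtain i where i: "i \<le> m" "a i [] \<noteq> 0" using a(2) by auto
    have "coeff r i = a i []" using i(1) by (simp add: r_def coeff_sum if_distrib sum.delta)
    then have "r \<noteq> 0" using i(2) by auto
    then have fin: "finite {y. poly r y = 0}" by (rule poly_roots_finite)
    have root: "poly r (x ! j) = 0" if "x \<in> V" for x using a(3) that by (simp add: r_def poly_sum poly_monom sel_def)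
    show ?thesis
    proof (rule ccontr)
      assume no: "\<not> ?thesis"
      have "\<exists>x\<in>V. \<forall>y\<in>{y. poly r y = 0}. x ! j - y \<noteq> 0"
      proof (rule zar_irred_prod[OF V fin])
        show "poly_fun n (\<lambda>x. x ! j - y)" for y using j by (intro poly_fun_intros)
        show "\<exists>x\<in>V. x ! j - y \<noteq> 0" for y using no by auto
      qed
      then show False using root by auto
    qed
  qed
  then obtain r where r: "\<And>j x. j < n \<Longrightarrow> x \<in> V \<Longrightarrow> x ! j = r j" by metis
  obtain a where a: "a \<in> V" using VR by blast
  have "x = a" if "x \<in> V" for x
    using that a VR r by (intro nth_equalityI) (auto simp: subset_iff)
  then show ?thesis using a by blast
qed

lemma rational_on_irred:
  assumes V: "zar_irred n V" and graph: "semialg (Suc n) {x @ [f x] |x. x \<in> V}"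
    and curves: "\<forall>C. alg_curve n C \<longrightarrow> C \<subseteq> zar_closure n V \<longrightarrow> rational_on n (V \<inter> C) f"
  shows "rational_on n V f"
proof -
  have VR: "V \<subseteq> Rn n" "V \<noteq> {}" using V by (auto simp: zar_irred_def)
  obtain L where L: "set L \<subseteq> {..<n}" "indep_on (length L) (sel L) V"
    "\<And>j. j < n \<Longrightarrow> alg_over (length L) (sel L) V (\<lambda>x. x ! j)"
    using transcendence_basis[OF VR(2)] by blast
  show ?thesis
  proof (cases "L = []")
    case True
    then obtain a where "V = {a}" using zar_irred_alg_over_empty[OF V] L(3) by auto
    then show ?thesis unfolding rational_on_iff[OF VR(1)]
      by (intro exI[of _ "\<lambda>_. f a"] exI[of _ "\<lambda>_. 1"]) (auto intro: poly_fun_intros)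
  next
    case False
    have gR: "{x @ [f x] |x. x \<in> V} \<subseteq> Rn (Suc n)" using VR by auto
    have "dominates n {x @ [f x] |x. x \<in> V} V"
      unfolding dominates_def
    proof (intro allI impI ballI)
      fix g x assume g: "\<forall>z\<in>{x @ [f x] |x. x \<in> V}. g (take n z) = (0::real)" and x: "x \<in> V"
      have "length x = n" using x VR by auto
      moreover have "g (take n (x @ [f x])) = 0" using g x by blast
      ultimately show "g x = 0" by simp
    qed
    from dominant_piece[OF V graph gR this] obtain S where S: "S \<subseteq> {x @ [f x] |x. x \<in> V}"
      "semialg (Suc n) S" "zar_irred (Suc n) S" "dominates n S V" .
    have algS: "alg_over (length L) (sel L) S (\<lambda>z. z ! j)" if "j < Suc n" for j
      by (rule graph_chart(1)[OF V L(1,2) L(3) S that])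
    obtain b \<gamma> \<rho> where ch: "chart (Suc n) L S b \<gamma> \<rho>" using graph_chart(2)[OF V L(1,2) L(3) S] by blast
    obtain P Q where PQ: "poly_fun n P" "poly_fun n Q" "\<exists>x\<in>V. Q x \<noteq> 0"
      "\<And>z. z \<in> S \<Longrightarrow> z ! n * Q (take n z) = P (take n z)"
      by (rule rational_on_piece[OF V L(1) False S(1,3) ch algS curves]) (assumption, rule that)
    have "\<exists>h. poly_fun n h \<and> (\<forall>x\<in>V. f x * Q x \<noteq> P x \<longrightarrow> h x = 0) \<and> (\<exists>x\<in>V. h x \<noteq> 0)"
      by (rule no_second_piece[OF V L(1) False L(2,3) graph S(1,3,4) ch algS curves PQ(1,2,4)])
    then obtain h where h: "poly_fun n h" "\<forall>x\<in>V. f x * Q x \<noteq> P x \<longrightarrow> h x = 0" "\<exists>x\<in>V. h x \<noteq> 0" by blast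
    show ?thesis
      unfolding rational_on_iff[OF VR(1)]
    \<comment> \<open>Multiplication by \<open>h\<close> removes the points with
      \<open>f * Q \<noteq> P\<close> from the domain of the fraction.\<close>
    proof (rule exI[of _ "\<lambda>x. h x * P x"], rule exI[of _ "\<lambda>x. h x * Q x"], intro conjI allI impI)
      show p: "poly_fun n (\<lambda>x. h x * P x)" "poly_fun n (\<lambda>x. h x * Q x)" by (intro poly_fun_intros h PQ)+
      show "\<forall>x\<in>V. h x * Q x \<noteq> 0 \<longrightarrow> f x * (h x * Q x) = h x * P x"
        using h(2) by (auto simp: mult_ac)
      fix r assume r: "poly_fun n r" "\<forall>x\<in>V. h x * Q x \<noteq> 0 \<longrightarrow> r x = 0"
      obtain x0 where x0: "x0 \<in> V" "h x0 * Q x0 \<noteq> 0"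
        using V h(1,3) PQ(2,3) unfolding zar_irred_def by blast
      have "(h x * Q x) * r x = 0" if "x \<in> V" for x using r(2) that by auto
      then show "\<forall>x\<in>V. r x = 0" using zar_irredD[OF V p(2) r(1) x0] by blast
    qed
  qed
qed

text \<open>With \<open>f = p / q\<close> on \<open>A\<close> and \<open>f = p' / q'\<close> on
  \<open>B\<close>, the fraction \<open>(h * p + a * p') / (h * q + a * q')\<close> reduces to the
  first where \<open>a = 0\<close>, that is on \<open>A\<close>, and to the second where
  \<open>h = 0\<close>, that is on \<open>B\<close>.\<close>

lemma rational_on_glue:
  assumes Z: "alg_set n Z" and V: "V = W \<inter> Z" and a: "poly_fun n a" and b: "poly_fun n b" "\<forall>x\<in>V. a x * b x = 0"
    and nz: "\<exists>x\<in>V. a x \<noteq> 0" "\<exists>x\<in>V. b x \<noteq> 0"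
    and IH: "\<And>Z'. alg_set n Z' \<Longrightarrow> Z' \<subset> Z \<Longrightarrow> rational_on n (W \<inter> Z') f"
  shows "rational_on n V f"
proof -
  have ZR: "Z \<subseteq> Rn n" by (rule alg_set_subset[OF Z])
  then have VR: "V \<subseteq> Rn n" using V by blast
  define A where "A = Z \<inter> {x\<in>Rn n. a x = 0}"
  have A: "alg_set n A" unfolding A_def by (intro alg_set_Int Z alg_set_zeroI a)
  have AZ: "A \<subset> Z" using nz(1) V ZR by (auto simp: A_def)
  have VAR: "V - A \<subseteq> Rn n" using VR by blast
  \<comment> \<open>The closure of \<open>V - A\<close> and not the zero set of \<open>b\<close>:
    the proof of \<open>r = 0\<close> on \<open>B\<close> below uses that \<open>V - A\<close> is
    dense in \<open>B\<close>.\<close>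
  define B where "B = Z \<inter> zar_closure n (V - A)"
  have B: "alg_set n B" unfolding B_def by (intro alg_set_Int Z alg_set_zar_closure VAR)
  have "V - A \<subseteq> {x\<in>Rn n. b x = 0}" using b(2) VR V by (auto simp: A_def)
  then have "B \<subseteq> {x\<in>Rn n. b x = 0}" unfolding B_def using zar_closure_minimal[OF alg_set_zeroI[OF b(1)]] by blast
  then have BZ: "B \<subset> Z" using nz(2) V by (auto simp: B_def)
  have VAB: "V - A \<subseteq> B" using subset_zar_closure[of "V - A" n] V by (auto simp: B_def)
  obtain h where h: "poly_fun n h" "B = {x\<in>Rn n. h x = 0}" using B by (rule alg_set_zeroE)
  have aA: "a x = 0 \<longleftrightarrow> x \<in> A" "h x = 0 \<longleftrightarrow> x \<in> B" if "x \<in> V" for x using that V VR h(2) by (auto simp: A_def)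
  have "W \<inter> A \<subseteq> Rn n" "W \<inter> B \<subseteq> Rn n" using AZ BZ ZR by blast+
  note ratA = IH[OF A AZ, unfolded rational_on_iff[OF this(1)]] and ratB = IH[OF B BZ, unfolded rational_on_iff[OF this(2)]]
  obtain p q where pq: "poly_fun n p" "poly_fun n q"
    "\<forall>r. poly_fun n r \<longrightarrow> (\<forall>x\<in>W \<inter> A. q x \<noteq> 0 \<longrightarrow> r x = 0) \<longrightarrow> (\<forall>x\<in>W \<inter> A. r x = 0)"
    "\<forall>x\<in>W \<inter> A. q x \<noteq> 0 \<longrightarrow> f x * q x = p x" using ratA by blast
  obtain p' q' where pq': "poly_fun n p'" "poly_fun n q'"
    "\<forall>r. poly_fun n r \<longrightarrow> (\<forall>x\<in>W \<inter> B. q' x \<noteq> 0 \<longrightarrow> r x = 0) \<longrightarrow> (\<forall>x\<in>W \<inter> B. r x = 0)"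
    "\<forall>x\<in>W \<inter> B. q' x \<noteq> 0 \<longrightarrow> f x * q' x = p' x" using ratB by blast
  have WA: "x \<in> W \<inter> A \<longleftrightarrow> x \<in> A" "x \<in> W \<inter> B \<longleftrightarrow> x \<in> B" if "x \<in> V" for x using that V by auto
  have AV: "x \<in> V" if "x \<in> W \<inter> A \<or> x \<in> W \<inter> B" for x using that V AZ BZ by blast
  show ?thesis
    unfolding rational_on_iff[OF VR]
  proof (rule exI[of _ "\<lambda>x. h x * p x + a x * p' x"], rule exI[of _ "\<lambda>x. h x * q x + a x * q' x"],
      intro conjI ballI allI impI)
    show "poly_fun n (\<lambda>x. h x * p x + a x * p' x)" "poly_fun n (\<lambda>x. h x * q x + a x * q' x)"
      by (intro poly_fun_intros h a pq pq')+
    fix x assume x: "x \<in> V" and nq: "h x * q x + a x * q' x \<noteq> 0"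
    show "f x * (h x * q x + a x * q' x) = h x * p x + a x * p' x"
    proof (cases "x \<in> A")
      case True
      then have "a x = 0" using aA(1)[OF x] by simp
      moreover have "f x * q x = p x" using pq(4) True WA(1)[OF x] nq calculation by auto
      ultimately show ?thesis by (simp add: mult_ac)
    next
      case False
      then have "x \<in> B" using VAB x by blast
      then have "h x = 0" using aA(2)[OF x] by simp
      moreover have "f x * q' x = p' x" using pq'(4) \<open>x \<in> B\<close> WA(2)[OF x] nq calculation by auto
      ultimately show ?thesis by (simp add: mult_ac)
    qed
  next
    fix r x assume r: "poly_fun n r" "\<forall>x\<in>V. h x * q x + a x * q' x \<noteq> 0 \<longrightarrow> r x = 0" and x: "x \<in> V"
    have "\<forall>x\<in>W \<inter> A. q x \<noteq> 0 \<longrightarrow> r x * h x = 0"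
    proof (intro ballI impI)
      fix x assume x: "x \<in> W \<inter> A" "q x \<noteq> 0"
      then have "x \<in> V" "a x = 0" using AV aA(1) by auto
      then show "r x * h x = 0" using r(2) x(2) by (cases "h x = 0") auto
    qed
    then have 1: "\<forall>x\<in>W \<inter> A. r x * h x = 0" using pq(3) pf_mult[OF r(1) h(1)] by blast
    have "\<forall>x\<in>W \<inter> B. q' x \<noteq> 0 \<longrightarrow> r x * a x = 0"
    proof (intro ballI impI)
      fix x assume x: "x \<in> W \<inter> B" "q' x \<noteq> 0"
      then have "x \<in> V" "h x = 0" using AV aA(2) by auto
      then show "r x * a x = 0" using r(2) x(2) by (cases "a x = 0") auto
    qed
    then have 2: "\<forall>x\<in>W \<inter> B. r x * a x = 0" using pq'(3) pf_mult[OF r(1) a] by blast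
    have "r x = 0" if "x \<in> V - A" for x
      using 2 that VAB aA(1)[of x] WA(2)[of x] by auto
    then have B0: "r x = 0" if "x \<in> B" for x
      using that r(1) unfolding B_def zar_closure_eq[OF VAR] by blast
    show "r x = 0"
    proof (cases "x \<in> B")
      case False
      then have "x \<in> A" "h x \<noteq> 0" using VAB x aA(2)[OF x] by auto
      then show ?thesis using 1 WA(1)[OF x] by auto
    qed (rule B0)
  qed
qed

section \<open>Noetherian induction over subvarieties, in both directions\<close>

lemma semialg_graph_Int:
  assumes "semialg (Suc n) {x @ [f x] |x. x \<in> W}" "W \<subseteq> Rn n" "alg_set n Z"
  shows "semialg (Suc n) {x @ [f x] |x. x \<in> W \<inter> Z}"
proof -
  have "{x @ [f x] |x. x \<in> W \<inter> Z} = {x @ [f x] |x. x \<in> W} \<inter> {z\<in>Rn (Suc n). take n z \<in> Z}"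
    using assms(2) by (auto simp: subset_iff)
  then show ?thesis using sa_inter[OF assms(1) semialg_cylinder[OF semialg_alg_set[OF assms(3)]]] by simp
qed

lemma rational_on_curves_imp_hereditarily:
  assumes "W \<subseteq> Rn n" and sa: "semialg_fun n W f" and cur: "rational_on_curves n X W f"
  shows "hereditarily_rational n X W f"
proof -
  have "Z \<subseteq> X \<longrightarrow> rational_on n (W \<inter> Z) f" if "alg_set n Z" for Z
    using that
  proof (induction Z rule: wf_induct_rule[OF wf_alg_set[of n]])
    case (1 Z)
    show ?case
    proof
      assume ZX: "Z \<subseteq> X"
      have VR: "W \<inter> Z \<subseteq> Rn n" using assms(1) by blast
      consider "W \<inter> Z = {}" | "zar_irred n (W \<inter> Z)" | "W \<inter> Z \<noteq> {}" "\<not> zar_irred n (W \<inter> Z)" by blast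
      then show "rational_on n (W \<inter> Z) f"
      proof cases
        case 1
        then show ?thesis unfolding rational_on_iff[OF VR]
          by (intro exI[of _ "\<lambda>_. 1"]) (auto intro: poly_fun_intros)
      next
        case 2
        show ?thesis
        proof (rule rational_on_irred[OF 2])
          show "semialg (Suc n) {x @ [f x] |x. x \<in> W \<inter> Z}"
            using semialg_graph_Int[OF _ assms(1) \<open>alg_set n Z\<close>] sa unfolding semialg_fun_def by blast
          show "\<forall>C. alg_curve n C \<longrightarrow> C \<subseteq> zar_closure n (W \<inter> Z) \<longrightarrow> rational_on n (W \<inter> Z \<inter> C) f"
          proof (intro allI impI)
            fix C assume C: "alg_curve n C" "C \<subseteq> zar_closure n (W \<inter> Z)"
            \<comment> \<open>\<open>Z\<close> is closed, so a curve in the closure of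
              \<open>W \<inter> Z\<close> lies in \<open>Z\<close>, and there
              \<open>W \<inter> Z\<close> and \<open>W\<close> have the same points.\<close>
            then have "C \<subseteq> Z" using zar_closure_minimal[OF \<open>alg_set n Z\<close>, of "W \<inter> Z"] by blast
            then have "rational_on n (W \<inter> C) f" "W \<inter> Z \<inter> C = W \<inter> C"
              using cur C(1) ZX unfolding rational_on_curves_def by blast+
            then show "rational_on n (W \<inter> Z \<inter> C) f" by simp
          qed
        qed
      next
        case 3
        then obtain a b where ab: "poly_fun n a" "poly_fun n b" "\<forall>x\<in>W \<inter> Z. a x * b x = 0"
          "\<exists>x\<in>W \<inter> Z. a x \<noteq> 0" "\<exists>x\<in>W \<inter> Z. b x \<noteq> 0" using VR unfolding zar_irred_def by blast
        show ?thesis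
        proof (rule rational_on_glue[OF \<open>alg_set n Z\<close> refl ab])
          show "rational_on n (W \<inter> Z') f" if "alg_set n Z'" "Z' \<subset> Z" for Z'
            using 1 that ZX by blast
        qed
      qed
    qed
  qed
  then show ?thesis unfolding hereditarily_rational_def by blast
qed

lemma hereditarily_imp_semialg_fun:
  assumes X: "alg_set n X" "W \<subseteq> X" "semialg n W" and her: "hereditarily_rational n X W f"
  shows "semialg_fun n W f"
proof -
  have "Z \<subseteq> X \<longrightarrow> semialg (Suc n) {x @ [f x] |x. x \<in> W \<inter> Z}" if "alg_set n Z" for Z
    using that
  proof (induction Z rule: wf_induct_rule[OF wf_alg_set[of n]])
    case (1 Z)
    show ?case
    proof
      assume ZX: "Z \<subseteq> X"
      have WR: "W \<subseteq> Rn n" using X alg_set_subset by blast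
      then have VR: "W \<inter> Z \<subseteq> Rn n" by blast
      show "semialg (Suc n) {x @ [f x] |x. x \<in> W \<inter> Z}"
      proof (cases "W \<inter> Z = {}")
        case True
        then show ?thesis using sa_eq[OF pf_const[of "Suc n" 1]] by simp
      next
        case False
        have "rational_on n (W \<inter> Z) f" using her \<open>alg_set n Z\<close> ZX unfolding hereditarily_rational_def by blast
        then obtain p q where pq: "poly_fun n p" "poly_fun n q"
          "\<forall>r. poly_fun n r \<longrightarrow> (\<forall>x\<in>W \<inter> Z. q x \<noteq> 0 \<longrightarrow> r x = 0) \<longrightarrow> (\<forall>x\<in>W \<inter> Z. r x = 0)"
          "\<forall>x\<in>W \<inter> Z. q x \<noteq> 0 \<longrightarrow> f x * q x = p x"
          unfolding rational_on_iff[OF VR] by blast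
        \<comment> \<open>The density clause applied to the constant 1; hence the zeros of
          \<open>q\<close> form a proper subset of \<open>Z\<close> and the induction hypothesis
          applies to it.\<close>
        have "\<exists>x\<in>W \<inter> Z. q x \<noteq> 0"
        proof (rule ccontr)
          assume "\<not> ?thesis"
          then have "\<forall>x\<in>W \<inter> Z. (1::real) = 0" using pq(3)[rule_format, OF pf_const[of n 1]] by blast
          then show False using False by auto
        qed
        then have sub: "Z \<inter> {x\<in>Rn n. q x = 0} \<subset> Z" by auto
        moreover have aZ: "alg_set n (Z \<inter> {x\<in>Rn n. q x = 0})"
          using alg_set_Int[OF \<open>alg_set n Z\<close> alg_set_zeroI[OF pq(2)]] .
        ultimately have s1: "semialg (Suc n) {x @ [f x] |x. x \<in> W \<inter> (Z \<inter> {x\<in>Rn n. q x = 0})}"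
          using 1 ZX by blast
        \<comment> \<open>Over \<open>K\<close> the graph is given by the polynomial equation
          \<open>y * q x = p x\<close>.\<close>
        define K where "K = (W \<inter> Z) \<inter> (Rn n - {x\<in>Rn n. q x = 0})"
        have "semialg n K" unfolding K_def
          by (intro sa_inter X(3) semialg_alg_set \<open>alg_set n Z\<close> sa_compl sa_eq pq)
        moreover have "poly_fun (Suc n) (\<lambda>z. z ! n * q (take n z) - p (take n z))"
          by (intro poly_fun_intros poly_fun_take pq) auto
        ultimately have s2: "semialg (Suc n) ({z\<in>Rn (Suc n). take n z \<in> K} \<inter> {z\<in>Rn (Suc n). z ! n * q (take n z) - p (take n z) = 0})"
          by (intro sa_inter semialg_cylinder sa_eq)
        have "{x @ [f x] |x. x \<in> W \<inter> Z} = {x @ [f x] |x. x \<in> W \<inter> (Z \<inter> {x\<in>Rn n. q x = 0})} \<union>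
          ({z\<in>Rn (Suc n). take n z \<in> K} \<inter> {z\<in>Rn (Suc n). z ! n * q (take n z) - p (take n z) = 0})" (is "?A = ?B \<union> ?C")
        proof (intro set_eqI iffI)
          fix z assume "z \<in> ?A"
          then obtain x where x: "z = x @ [f x]" "x \<in> W \<inter> Z" by blast
          have len: "length x = n" using x VR by auto
          show "z \<in> ?B \<union> ?C"
          proof (cases "q x = 0")
            case True
            then show ?thesis using x len by auto
          next
            case False
            then have "f x * q x = p x" using pq(4) x(2) by blast
            then have "z \<in> ?C" using False x len by (simp add: K_def nth_append)
            then show ?thesis by blast
          qed
        next
          fix z assume "z \<in> ?B \<union> ?C"
          then show "z \<in> ?A"
          proof
            assume z: "z \<in> ?C"
            then obtain x y where xy: "z = x @ [y]" "length x = n" by (auto elim: length_SucE)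
            then have x: "x \<in> W \<inter> Z" "q x \<noteq> 0" "y * q x = p x" using z by (auto simp: K_def nth_append)
            then have "f x * q x = y * q x" using pq(4) by auto
            then have "y = f x" using x(2) by simp
            then show "z \<in> ?A" using xy x by blast
          qed blast
        qed
        then show ?thesis using sa_union[OF s1 s2] by simp
      qed
    qed
  qed
  from this[OF X(1)] have "semialg (Suc n) {x @ [f x] |x. x \<in> W \<inter> X}" by simp
  moreover have "W \<inter> X = W" using X(2) by blast
  ultimately show ?thesis by (simp add: semialg_fun_def)
qed

theorem theorem3p8:
  fixes n :: nat and X W :: "real list set" and f :: "real list \<Rightarrow> real"
  assumes "alg_set n X"
    and "W \<subseteq> X"
    and "semialg n W"
  shows "hereditarily_rational n X W f \<longleftrightarrow>
         (rational_on_curves n X W f \<and> semialg_fun n W f)"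
proof (intro iffI conjI)
  assume her: "hereditarily_rational n X W f"
  show "rational_on_curves n X W f"
    using her unfolding hereditarily_rational_def rational_on_curves_def alg_curve_def alg_irreducible_def by blast
  show "semialg_fun n W f" by (rule hereditarily_imp_semialg_fun[OF assms her])
next
  assume "rational_on_curves n X W f \<and> semialg_fun n W f"
  moreover have "W \<subseteq> Rn n" using assms(1,2) alg_set_subset by blast
  ultimately show "hereditarily_rational n X W f" by (intro rational_on_curves_imp_hereditarily) auto
qed

end
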